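(* Let $D_a>0$, $L>0$ and fix $\alpha>0$. Consider the optimization problem $\mathbf{S}_\alpha$: minimize $\kappa^2$ over all $\kappa\in\mathbb{R}$ such that (i) the $C_0$-semigroup $(T_{A_\kappa}(t))_{t\ge0}$ generated by $A_\kappa$ on $\mathrm{L}^2(0,L)$ is positive and (ii) $(T_{A_\kappa}(t))_{t\ge0}$ is $\beta$-exponentially stable for all $\beta\in(-\alpha,0]$. Then $\mathbf{S}_\alpha$ is feasible (i.e. there is at least one $\kappa\in\mathbb{R}$ satisfying (i) and (ii)) if, and only if, $\alpha<\pi^2D_a/(4L^2)$. In this case, $\mathbf{S}_\alpha$ has a unique solution $\kappa_*$, given by $$\kappa_*=-\sqrt{\alpha D_a^{-1}}\,\tan\!\left(L\sqrt{\alpha D_a^{-1}}\right).$$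
   Context: For $\kappa\in\mathbb{R}$, $A_\kappa$ is the operator on the (real) space $\mathrm{L}^2(0,L)$ defined by $A_\kappa x=D_a\frac{\mathrm{d}^2x}{\mathrm{d}z^2}$ with domain $D(A_\kappa)=\{x\in\mathrm{H}^2(0,L):\frac{\mathrm{d}x}{\mathrm{d}z}(0)+\kappa x(0)=0=\frac{\mathrm{d}x}{\mathrm{d}z}(L)\}$; it generates a $C_0$-semigroup. (It arises from the diffusion equation $\partial_tx=D_a\partial_z^2x$ on $[0,L]$ with $\partial_zx(0,t)+u(t)=0$, $\partial_zx(L,t)=0$ and state feedback $u(t)=\kappa x(0,t)$.) A semigroup on $\mathrm{L}^2(0,L)$ is positive if it maps (a.e.) nonnegative functions to nonnegative functions for every $t\ge0$. A $C_0$-semigroup is $\beta$-exponentially stable if its growth bound is less than $\beta$; thus condition (ii) is equivalent to the growth bound of $(T_{A_\kappa}(t))_{t\ge 0}$ being at most $-\alpha$. *)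

theory Defs
  imports "HOL-Analysis.Analysis"
begin

definition square_integrable :: "(real \<Rightarrow> real) \<Rightarrow> bool" where
  "square_integrable f \<longleftrightarrow> f \<in> borel_measurable lborel \<and> integrable lborel (\<lambda>z. (f z)\<^sup>2)"

definition L2_eq :: "(real \<Rightarrow> real) \<Rightarrow> (real \<Rightarrow> real) \<Rightarrow> bool" where
  "L2_eq f g \<longleftrightarrow> square_integrable f \<and> square_integrable g \<and> (AE z in lborel. f z = g z)"

lemma square_integrable_mult:
  assumes "square_integrable f" "square_integrable g"
  shows "integrable lborel (\<lambda>z. f z * g z)"
proof (rule Bochner_Integration.integrable_bound)
  show "integrable lborel (\<lambda>z. (f z)\<^sup>2 + (g z)\<^sup>2)"
    using assms by (auto simp: square_integrable_def)
  show "(\<lambda>z. f z * g z) \<in> borel_measurable lborel"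
    using assms by (auto simp: square_integrable_def)
  have "\<bar>a * b\<bar> \<le> a\<^sup>2 + b\<^sup>2" for a b :: real
  proof -
    have "0 \<le> (\<bar>a\<bar> - \<bar>b\<bar>)\<^sup>2" by simp
    then have "2 * (\<bar>a\<bar> * \<bar>b\<bar>) \<le> a\<^sup>2 + b\<^sup>2" by (simp add: power2_diff)
    moreover have "0 \<le> \<bar>a\<bar> * \<bar>b\<bar>" by simp
    ultimately show ?thesis unfolding abs_mult by linarith
  qed
  then show "AE z in lborel. norm (f z * g z) \<le> norm ((f z)\<^sup>2 + (g z)\<^sup>2)"
    by (intro AE_I2) simp
qed

lemma square_integrable_zero: "square_integrable (\<lambda>z. 0)"
  by (simp add: square_integrable_def)

lemma square_integrable_add:
  assumes "square_integrable f" "square_integrable g"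
  shows "square_integrable (\<lambda>z. f z + g z)"
proof -
  have "integrable lborel (\<lambda>z. (f z)\<^sup>2 + (g z)\<^sup>2 + 2 * (f z * g z))"
    using assms square_integrable_mult[OF assms]
    by (intro Bochner_Integration.integrable_add integrable_mult_right) (auto simp: square_integrable_def)
  then show ?thesis
    using assms by (auto simp: square_integrable_def power2_sum mult.assoc)
qed

lemma square_integrable_scale:
  assumes "square_integrable f"
  shows "square_integrable (\<lambda>z. c * f z)"
  using assms by (auto simp: square_integrable_def power_mult_distrib)

lemma square_integrable_uminus:
  assumes "square_integrable f"
  shows "square_integrable (\<lambda>z. - f z)"
  using assms by (auto simp: square_integrable_def)

lemma square_integrable_diff:
  assumes "square_integrable f" "square_integrable g"
  shows "square_integrable (\<lambda>z. f z - g z)"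
  using square_integrable_add[OF assms(1) square_integrable_uminus[OF assms(2)]] by simp

quotient_type L2 = "real \<Rightarrow> real" / partial: L2_eq
proof (rule part_equivpI)
  show "\<exists>f. L2_eq f f"
    using square_integrable_zero by (auto simp: L2_eq_def)
  show "symp L2_eq"
    by (auto simp: L2_eq_def symp_def)
  show "transp L2_eq"
    unfolding transp_def L2_eq_def by (auto elim: AE_mp)
qed

text \<open>
  \<open>L2\<close> is \<open>L\<^sup>2(\<real>)\<close>. A class of Lebesgue measurable functions modulo null sets always contains
  Borel functions, so nothing is lost by requiring measurability with respect to \<open>lborel\<close>.
\<close>

instantiation L2 :: real_inner
begin

lift_definition zero_L2 :: L2 is "\<lambda>z. 0"
  by (simp add: L2_eq_def square_integrable_zero)

lift_definition plus_L2 :: "L2 \<Rightarrow> L2 \<Rightarrow> L2" is "\<lambda>f g z. f z + g z"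
  unfolding L2_eq_def by (auto intro: square_integrable_add)

lift_definition uminus_L2 :: "L2 \<Rightarrow> L2" is "\<lambda>f z. - f z"
  unfolding L2_eq_def by (auto intro: square_integrable_uminus)

lift_definition minus_L2 :: "L2 \<Rightarrow> L2 \<Rightarrow> L2" is "\<lambda>f g z. f z - g z"
  unfolding L2_eq_def by (auto intro: square_integrable_diff)

lift_definition scaleR_L2 :: "real \<Rightarrow> L2 \<Rightarrow> L2" is "\<lambda>c f z. c * f z"
  unfolding L2_eq_def by (auto intro: square_integrable_scale)

lift_definition inner_L2 :: "L2 \<Rightarrow> L2 \<Rightarrow> real" is "\<lambda>f g. LINT z|lborel. f z * g z"
  unfolding L2_eq_def square_integrable_def by (auto intro!: integral_cong_AE)

definition norm_L2 :: "L2 \<Rightarrow> real" where "norm_L2 x = sqrt (inner x x)"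
definition dist_L2 :: "L2 \<Rightarrow> L2 \<Rightarrow> real" where "dist_L2 x y = norm (x - y)"
definition sgn_L2 :: "L2 \<Rightarrow> L2" where "sgn_L2 x = inverse (norm x) *\<^sub>R x"
definition uniformity_L2 :: "(L2 \<times> L2) filter" where
  "uniformity_L2 = (INF e\<in>{0<..}. principal {(x, y). dist x y < e})"
definition open_L2 :: "L2 set \<Rightarrow> bool" where
  "open_L2 U \<longleftrightarrow> (\<forall>x\<in>U. eventually (\<lambda>(x', y). x' = x \<longrightarrow> y \<in> U) uniformity)"

instance
proof
  fix x y z :: L2 and a b :: real
  show "x + y + z = x + (y + z)"
    by transfer (simp add: L2_eq_def square_integrable_add add.assoc)
  show "x + y = y + x"
    by transfer (simp add: L2_eq_def square_integrable_add add.commute)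
  show "0 + x = x"
    by transfer (simp add: L2_eq_def)
  show "- x + x = 0"
    by transfer (simp add: L2_eq_def square_integrable_zero)
  show "x - y = x + - y"
    by transfer (simp add: L2_eq_def square_integrable_diff)
  show "a *\<^sub>R (x + y) = a *\<^sub>R x + a *\<^sub>R y"
    by transfer (simp add: L2_eq_def square_integrable_add square_integrable_scale distrib_left)
  show "(a + b) *\<^sub>R x = a *\<^sub>R x + b *\<^sub>R x"
    by transfer (auto simp: L2_eq_def distrib_right
      intro!: square_integrable_add square_integrable_scale)
  show "a *\<^sub>R b *\<^sub>R x = (a * b) *\<^sub>R x"
    by transfer (simp add: L2_eq_def square_integrable_scale mult.assoc)
  show "1 *\<^sub>R x = x"
    by transfer (simp add: L2_eq_def)
  show "inner x y = inner y x"
    by transfer (simp add: mult.commute)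
  show "inner (x + y) z = inner x z + inner y z"
    by transfer (simp add: L2_eq_def distrib_right square_integrable_mult)
  show "inner (a *\<^sub>R x) y = a * inner x y"
    by transfer (simp add: mult.assoc)
  show "0 \<le> inner x x"
    by transfer simp
  show "inner x x = 0 \<longleftrightarrow> x = 0"
  proof transfer
    fix f assume f: "L2_eq f f"
    have "(LINT z|lborel. f z * f z) = 0 \<longleftrightarrow> (AE z in lborel. f z * f z = 0)"
      using f by (intro integral_nonneg_eq_0_iff_AE) (auto simp: L2_eq_def square_integrable_mult)
    then show "(LINT z|lborel. f z * f z) = 0 \<longleftrightarrow> L2_eq f (\<lambda>z. 0)"
      using f by (simp add: L2_eq_def square_integrable_zero)
  qed
qed (fact norm_L2_def dist_L2_def sgn_L2_def uniformity_L2_def open_L2_def)+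

end

lemma square_integrable_rep_L2: "square_integrable (rep_L2 x)"
  using Quotient3_rep_reflp[OF Quotient3_L2] by (auto simp: L2_eq_def)

lemma rep_abs_L2:
  assumes "square_integrable f"
  shows "AE z in lborel. rep_L2 (abs_L2 f) z = f z"
  using rep_abs_rsp_left[OF Quotient3_L2, of f f] assms by (auto simp: L2_eq_def)

lemma abs_rep_L2 [simp]: "abs_L2 (rep_L2 x) = x"
  using Quotient3_abs_rep[OF Quotient3_L2] .

lemma abs_L2_diff:
  assumes "square_integrable f" "square_integrable g"
  shows "abs_L2 f - abs_L2 g = abs_L2 (\<lambda>z. f z - g z)"
  using assms by (simp add: minus_L2.abs_eq L2_eq_def)

lemma norm_abs_L2:
  assumes "square_integrable f"
  shows "(norm (abs_L2 f))\<^sup>2 = (LINT z|lborel. (f z)\<^sup>2)"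
  using assms by (simp add: norm_L2_def inner_L2.abs_eq L2_eq_def power2_eq_square)

lemma norm_diff_rep_L2:
  "ennreal ((norm (x - y))\<^sup>2) = (\<integral>\<^sup>+ z. ennreal ((rep_L2 x z - rep_L2 y z)\<^sup>2) \<partial>lborel)"
proof -
  have sq: "square_integrable (\<lambda>z. rep_L2 x z - rep_L2 y z)"
    by (intro square_integrable_diff square_integrable_rep_L2)
  have "x - y = abs_L2 (\<lambda>z. rep_L2 x z - rep_L2 y z)"
    using abs_L2_diff[OF square_integrable_rep_L2[of x] square_integrable_rep_L2[of y]] by simp
  then have "(norm (x - y))\<^sup>2 = (LINT z|lborel. (rep_L2 x z - rep_L2 y z)\<^sup>2)"
    using norm_abs_L2[OF sq] by simp
  then show ?thesis
    using sq by (simp add: nn_integral_eq_integral square_integrable_def)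
qed

instance L2 :: complete_space
proof
  fix u :: "nat \<Rightarrow> L2" assume u: "Cauchy u"
  have quarter: "((1/2) ^ k)\<^sup>2 = (1/4 :: real) ^ k" for k
    by (induction k) (simp_all add: power2_eq_square)
  have half: "2 ^ k * (1/4) ^ k = (1/2 :: real) ^ k" for k
    by (induction k) simp_all
  have one: "2 ^ k * (1/2) ^ k = (1 :: real)" for k
    by (induction k) simp_all
  have "\<exists>N. \<forall>m\<ge>N. \<forall>n\<ge>N. norm (u m - u n) < (1/2) ^ k" for k
    using u unfolding Cauchy_def dist_norm by (metis zero_less_power half_gt_zero zero_less_one)
  then obtain N where N: "norm (u m - u n) < (1/2) ^ k" if "m \<ge> N k" "n \<ge> N k" for k m n
    by metis
  define r where "r = rec_nat (N 0) (\<lambda>k p. max (Suc p) (N (Suc k)))"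
  have r_Suc: "r (Suc k) = max (Suc (r k)) (N (Suc k))" for k
    by (simp add: r_def)
  have r_mono: "strict_mono r"
    by (rule strict_monoI_Suc) (simp add: r_Suc)
  have r_N: "r k \<ge> N k" for k
    by (cases k) (simp_all add: r_Suc, simp add: r_def)
  have close: "norm (u (r m) - u (r n)) < (1/2) ^ k" if "m \<ge> k" "n \<ge> k" for k m n
    using that r_N[of k] strict_mono_leD[OF r_mono] by (intro N) (meson order_trans)+
  define f where "f n = rep_L2 (u (r n))" for n
  have f_sq: "square_integrable (f n)" for n
    by (simp add: f_def square_integrable_rep_L2)
  then have f_meas [measurable]: "f n \<in> borel_measurable lborel" for n
    by (simp add: square_integrable_def)
  have f_close: "(\<integral>\<^sup>+ z. ennreal ((f n z - f m z)\<^sup>2) \<partial>lborel) \<le> ennreal ((1/4) ^ k)"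
    if "m \<ge> k" "n \<ge> k" for k m n
  proof -
    have "(norm (u (r n) - u (r m)))\<^sup>2 \<le> ((1/2) ^ k)\<^sup>2"
      using close[OF that(2) that(1)] by (intro power_mono) auto
    also have "\<dots> = (1/4) ^ k"
      by (rule quarter)
    finally show ?thesis
      unfolding f_def norm_diff_rep_L2[symmetric] by (rule ennreal_leI)
  qed
  have "(\<integral>\<^sup>+ z. (\<Sum>k. ennreal (2 ^ k * (f (Suc k) z - f k z)\<^sup>2)) \<partial>lborel)
      = (\<Sum>k. \<integral>\<^sup>+ z. ennreal (2 ^ k * (f (Suc k) z - f k z)\<^sup>2) \<partial>lborel)"
    by (rule nn_integral_suminf) measurable
  also have "\<dots> \<le> (\<Sum>k. ennreal ((1/2) ^ k))"
  proof (intro suminf_le summableI)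
    fix k
    have "(\<integral>\<^sup>+ z. ennreal (2 ^ k * (f (Suc k) z - f k z)\<^sup>2) \<partial>lborel)
        = ennreal (2 ^ k) * (\<integral>\<^sup>+ z. ennreal ((f (Suc k) z - f k z)\<^sup>2) \<partial>lborel)"
      by (subst nn_integral_cmult[symmetric]) (auto simp: ennreal_mult intro!: nn_integral_cong)
    also have "\<dots> \<le> ennreal (2 ^ k) * ennreal ((1/4) ^ k)"
      by (intro mult_left_mono f_close) auto
    also have "\<dots> = ennreal ((1/2) ^ k)"
      by (simp only: ennreal_mult[symmetric] half zero_le_power zero_le_numeral zero_le_divide_1_iff)
    finally show "(\<integral>\<^sup>+ z. ennreal (2 ^ k * (f (Suc k) z - f k z)\<^sup>2) \<partial>lborel) \<le> ennreal ((1/2) ^ k)" .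
  qed
  also have "\<dots> < \<infinity>"
  proof -
    have "(\<Sum>k. ennreal ((1/2) ^ k)) = ennreal (\<Sum>k. (1/2) ^ k)"
      by (rule suminf_ennreal2) (auto intro: summable_geometric)
    then show ?thesis by (simp add: ennreal_less_top)
  qed
  finally have "AE z in lborel. (\<Sum>k. ennreal (2 ^ k * (f (Suc k) z - f k z)\<^sup>2)) \<noteq> \<infinity>"
    by (intro nn_integral_PInf_AE) auto
  then have conv: "AE z in lborel. convergent (\<lambda>n. f n z)"
  proof (rule AE_mp, intro AE_I2 impI)
    fix z assume "(\<Sum>k. ennreal (2 ^ k * (f (Suc k) z - f k z)\<^sup>2)) \<noteq> \<infinity>"
    then have "summable (\<lambda>k. 2 ^ k * (f (Suc k) z - f k z)\<^sup>2)"
      by (intro summable_suminf_not_top) auto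
    then have sum: "summable (\<lambda>k. (1/2) ^ k + 2 ^ k * (f (Suc k) z - f k z)\<^sup>2)"
      by (intro summable_add summable_geometric) auto
    have bd: "\<bar>d\<bar> \<le> (1/2) ^ k + 2 ^ k * d\<^sup>2" for k and d :: real
    proof (cases "\<bar>d\<bar> \<le> (1/2) ^ k")
      case True
      then show ?thesis by (simp add: add_increasing2)
    next
      case False
      then have "(1/2) ^ k * \<bar>d\<bar> \<le> \<bar>d\<bar> * \<bar>d\<bar>"
        by (intro mult_right_mono) auto
      then have "2 ^ k * ((1/2) ^ k * \<bar>d\<bar>) \<le> 2 ^ k * d\<^sup>2"
        by (intro mult_left_mono) (auto simp: power2_eq_square)
      then have "\<bar>d\<bar> \<le> 2 ^ k * d\<^sup>2"
        by (simp only: mult.assoc[symmetric] one mult_1_left)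
      then show ?thesis
        by (simp add: add_increasing)
    qed
    have "summable (\<lambda>k. f (Suc k) z - f k z)"
      using bd by (intro summable_comparison_test'[OF sum, where N = 0]) (simp only: real_norm_def)
    then have "convergent (\<lambda>n. \<Sum>k<n. f (Suc k) z - f k z)"
      by (simp add: summable_iff_convergent)
    then have "convergent (\<lambda>n. (f n z - f 0 z) + f 0 z)"
      by (intro convergent_add convergent_const)
        (simp add: sum_lessThan_telescope[of "\<lambda>k. f k z"])
    then show "convergent (\<lambda>n. f n z)" by simp
  qed
  define F where "F z = lim (\<lambda>n. f n z)" for z
  have F_meas [measurable]: "F \<in> borel_measurable lborel"
    unfolding F_def by (rule borel_measurable_lim_metric) measurable
  have F_lim: "AE z in lborel. (\<lambda>n. f n z) \<longlonglongrightarrow> F z"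
    using conv by (auto simp: F_def convergent_LIMSEQ_iff)
  have F_close: "(\<integral>\<^sup>+ z. ennreal ((f n z - F z)\<^sup>2) \<partial>lborel) \<le> ennreal ((1/4) ^ n)" for n
  proof -
    have "(\<integral>\<^sup>+ z. ennreal ((f n z - F z)\<^sup>2) \<partial>lborel)
        = (\<integral>\<^sup>+ z. liminf (\<lambda>m. ennreal ((f n z - f m z)\<^sup>2)) \<partial>lborel)"
    proof (rule nn_integral_cong_AE, rule AE_mp[OF F_lim], intro AE_I2 impI)
      fix z assume "(\<lambda>n. f n z) \<longlonglongrightarrow> F z"
      then have "(\<lambda>m. ennreal ((f n z - f m z)\<^sup>2)) \<longlonglongrightarrow> ennreal ((f n z - F z)\<^sup>2)"
        by (intro tendsto_intros)
      then show "ennreal ((f n z - F z)\<^sup>2) = liminf (\<lambda>m. ennreal ((f n z - f m z)\<^sup>2))"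
        by (intro lim_imp_Liminf[symmetric] sequentially_bot)
    qed
    also have "\<dots> \<le> liminf (\<lambda>m. \<integral>\<^sup>+ z. ennreal ((f n z - f m z)\<^sup>2) \<partial>lborel)"
      by (rule nn_integral_liminf) measurable
    also have "\<dots> \<le> ennreal ((1/4) ^ n)"
      by (intro Liminf_le)
        (auto simp: eventually_sequentially intro!: exI[of _ n] f_close)
    finally show ?thesis .
  qed
  have diff_sq: "square_integrable (\<lambda>z. f n z - F z)" for n
    unfolding square_integrable_def
  proof (intro conjI integrableI_bounded)
    have "(\<integral>\<^sup>+ z. ennreal (norm ((f n z - F z)\<^sup>2)) \<partial>lborel) \<le> ennreal ((1/4) ^ n)"
      using F_close[of n] by simp
    then show "(\<integral>\<^sup>+ z. ennreal (norm ((f n z - F z)\<^sup>2)) \<partial>lborel) < \<infinity>"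
      by (rule le_less_trans) (simp add: ennreal_less_top)
  qed measurable
  have F_sq: "square_integrable F"
    using square_integrable_diff[OF f_sq[of 0] diff_sq[of 0]] by simp
  have bound: "norm (u (r n) - abs_L2 F) \<le> (1/2) ^ n" for n
  proof -
    have "u (r n) - abs_L2 F = abs_L2 (\<lambda>z. f n z - F z)"
      using abs_L2_diff[OF f_sq[of n] F_sq] by (simp add: f_def)
    then have "(norm (u (r n) - abs_L2 F))\<^sup>2 = (LINT z|lborel. (f n z - F z)\<^sup>2)"
      using norm_abs_L2[OF diff_sq[of n]] by simp
    then have "ennreal ((norm (u (r n) - abs_L2 F))\<^sup>2) \<le> ennreal ((1/4) ^ n)"
      using diff_sq[of n] F_close[of n] by (simp add: nn_integral_eq_integral square_integrable_def)
    then have "(norm (u (r n) - abs_L2 F))\<^sup>2 \<le> (1/4) ^ n"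
      by (simp add: ennreal_le_iff)
    also have "(1/4 :: real) ^ n = ((1/2) ^ n)\<^sup>2"
      by (rule quarter[symmetric])
    finally show ?thesis
      by (rule power2_le_imp_le) simp
  qed
  have "(\<lambda>n. u (r n) - abs_L2 F) \<longlonglongrightarrow> 0"
    by (rule Lim_null_comparison[OF _ LIMSEQ_power_zero[of "1/2::real"]])
      (auto intro!: always_eventually bound)
  then have "(u \<circ> r) \<longlonglongrightarrow> abs_L2 F"
    by (simp add: LIM_zero_iff o_def)
  then show "convergent u"
    using Cauchy_converges_subseq[OF u r_mono] by (auto simp: convergent_def)
qed

text \<open>
  An element of \<open>L\<^sup>2(0, L)\<close> is identified with its extension by zero to the line; this embeds
  \<open>L\<^sup>2(0, L)\<close> isometrically as a closed subspace of \<open>L\<^sup>2(\<real>)\<close>.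
\<close>

definition L2_on :: "real \<Rightarrow> L2 set" where
  "L2_on L = {x. AE z in lborel. z \<notin> {0<..<L} \<longrightarrow> rep_L2 x z = 0}"

lemma rep_L2_zero: "AE z in lborel. rep_L2 0 z = 0"
  using rep_abs_L2[OF square_integrable_zero] by (simp add: zero_L2_def)

lemma rep_L2_add: "AE z in lborel. rep_L2 (x + y) z = rep_L2 x z + rep_L2 y z"
proof -
  have "x + y = abs_L2 (\<lambda>z. rep_L2 x z + rep_L2 y z)"
    using plus_L2.abs_eq[of "rep_L2 x" "rep_L2 y"] by (simp add: L2_eq_def square_integrable_rep_L2)
  then show ?thesis
    using rep_abs_L2[OF square_integrable_add[OF square_integrable_rep_L2 square_integrable_rep_L2]]
    by simp
qed

lemma rep_L2_scaleR: "AE z in lborel. rep_L2 (c *\<^sub>R x) z = c * rep_L2 x z"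
proof -
  have "c *\<^sub>R x = abs_L2 (\<lambda>z. c * rep_L2 x z)"
    using scaleR_L2.abs_eq[of "rep_L2 x" c] by (simp add: L2_eq_def square_integrable_rep_L2)
  then show ?thesis
    using rep_abs_L2[OF square_integrable_scale[OF square_integrable_rep_L2]] by simp
qed

lemma subspace_L2_on: "subspace (L2_on L)"
proof (rule subspaceI)
  show "0 \<in> L2_on L"
    using rep_L2_zero by (auto simp: L2_on_def)
next
  fix x y assume "x \<in> L2_on L" "y \<in> L2_on L"
  then show "x + y \<in> L2_on L"
    using rep_L2_add[of x y] by (auto simp: L2_on_def)
next
  fix c x assume "x \<in> L2_on L"
  then show "c *\<^sub>R x \<in> L2_on L"
    using rep_L2_scaleR[of c x] by (auto simp: L2_on_def)
qed

lemma closed_L2_on: "closed (L2_on L)"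
  unfolding closed_sequential_limits
proof (intro allI impI, elim conjE)
  fix u x assume u: "\<forall>n. u n \<in> L2_on L" and lim: "u \<longlonglongrightarrow> x"
  have [measurable]: "rep_L2 x \<in> borel_measurable lborel"
    using square_integrable_rep_L2 by (simp add: square_integrable_def)
  let ?I = "\<integral>\<^sup>+ z. ennreal (indicator (- {0<..<L}) z * (rep_L2 x z)\<^sup>2) \<partial>lborel"
  have "?I \<le> ennreal ((norm (x - u n))\<^sup>2)" for n
    unfolding norm_diff_rep_L2
  proof (rule nn_integral_mono_AE)
    have "AE z in lborel. z \<notin> {0<..<L} \<longrightarrow> rep_L2 (u n) z = 0"
      using u by (auto simp: L2_on_def)
    then show "AE z in lborel. ennreal (indicator (- {0<..<L}) z * (rep_L2 x z)\<^sup>2)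
        \<le> ennreal ((rep_L2 x z - rep_L2 (u n) z)\<^sup>2)"
      by eventually_elim (auto simp: indicator_def intro!: ennreal_leI)
  qed
  moreover have "(\<lambda>n. ennreal ((norm (x - u n))\<^sup>2)) \<longlonglongrightarrow> ennreal ((norm (x - x))\<^sup>2)"
    using lim by (intro tendsto_intros)
  ultimately have "?I \<le> ennreal ((norm (x - x))\<^sup>2)"
    by (intro LIMSEQ_le_const) auto
  then have "?I = 0" by simp
  then have "AE z in lborel. ennreal (indicator (- {0<..<L}) z * (rep_L2 x z)\<^sup>2) = 0"
    by (subst (asm) nn_integral_0_iff_AE) auto
  then have "AE z in lborel. z \<notin> {0<..<L} \<longrightarrow> rep_L2 x z = 0"
    by eventually_elim (auto simp: indicator_def split: if_splits)
  then show "x \<in> L2_on L" by (simp add: L2_on_def)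
qed

text \<open>
  Sobolev spaces are defined by weak derivatives tested against \<open>C\<^sub>c\<^sup>1(0, L)\<close> (as, e.g., in Brezis,
  \<^emph>\<open>Functional Analysis, Sobolev Spaces and PDE\<close>, Chapter 8). The weak derivative \<open>y\<close> of \<open>x\<close>, if it
  exists, is unique in \<open>L\<^sup>2(0, L)\<close>.
\<close>

definition test_function :: "real \<Rightarrow> (real \<Rightarrow> real) \<Rightarrow> bool" where
  "test_function L \<phi> \<longleftrightarrow>
     (\<forall>z. \<phi> differentiable (at z)) \<and> continuous_on UNIV (deriv \<phi>) \<and>
     (\<exists>K. compact K \<and> K \<subseteq> {0<..<L} \<and> (\<forall>z. z \<notin> K \<longrightarrow> \<phi> z = 0))"

definition has_weak_deriv :: "real \<Rightarrow> L2 \<Rightarrow> L2 \<Rightarrow> bool" where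
  "has_weak_deriv L x y \<longleftrightarrow> x \<in> L2_on L \<and> y \<in> L2_on L \<and>
     (\<forall>\<phi>. test_function L \<phi> \<longrightarrow>
       (LINT z:{0<..<L}|lborel. rep_L2 x z * deriv \<phi> z)
         = - (LINT z:{0<..<L}|lborel. rep_L2 y z * \<phi> z))"

definition H1 :: "real \<Rightarrow> L2 set" where
  "H1 L = {x. \<exists>y. has_weak_deriv L x y}"

definition H2 :: "real \<Rightarrow> L2 set" where
  "H2 L = {x. \<exists>y. has_weak_deriv L x y \<and> y \<in> H1 L}"

text \<open>
  Every \<open>H\<^sup>1\<close> function on \<open>(0, L)\<close> has a unique representative that is continuous on \<open>[0, L]\<close>;
  boundary values are the values of this representative.
\<close>

definition continuous_rep :: "real \<Rightarrow> L2 \<Rightarrow> (real \<Rightarrow> real) \<Rightarrow> bool" where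
  "continuous_rep L x g \<longleftrightarrow> continuous_on {0..L} g \<and>
     (AE z in lborel. z \<in> {0<..<L} \<longrightarrow> rep_L2 x z = g z)"

text \<open>Unbounded operators are represented by their graphs.\<close>

definition A_dom :: "real \<Rightarrow> real \<Rightarrow> L2 set" where
  "A_dom L \<kappa> = {x \<in> H2 L. \<exists>x' g g'. has_weak_deriv L x x' \<and>
     continuous_rep L x g \<and> continuous_rep L x' g' \<and> g' 0 + \<kappa> * g 0 = 0 \<and> g' L = 0}"

definition A_graph :: "real \<Rightarrow> real \<Rightarrow> real \<Rightarrow> (L2 \<times> L2) set" where
  "A_graph D L \<kappa> = {(x, D *\<^sub>R x'') | x x' x''.
     x \<in> A_dom L \<kappa> \<and> has_weak_deriv L x x' \<and> has_weak_deriv L x' x''}"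

text \<open>
  Operators on a subspace \<open>X\<close> are functions on the ambient type of which only the values on \<open>X\<close>
  matter; likewise only \<open>T t\<close> with \<open>t \<ge> 0\<close> matters.
\<close>

definition bounded_operator_on :: "'a::real_normed_vector set \<Rightarrow> ('a \<Rightarrow> 'a) \<Rightarrow> bool" where
  "bounded_operator_on X S \<longleftrightarrow> S ` X \<subseteq> X \<and>
     (\<forall>x\<in>X. \<forall>y\<in>X. S (x + y) = S x + S y) \<and> (\<forall>c. \<forall>x\<in>X. S (c *\<^sub>R x) = c *\<^sub>R S x) \<and>
     (\<exists>K. \<forall>x\<in>X. norm (S x) \<le> K * norm x)"

definition C0_semigroup :: "'a::real_normed_vector set \<Rightarrow> (real \<Rightarrow> 'a \<Rightarrow> 'a) \<Rightarrow> bool" where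
  "C0_semigroup X T \<longleftrightarrow>
     (\<forall>t\<ge>0. bounded_operator_on X (T t)) \<and>
     (\<forall>x\<in>X. T 0 x = x) \<and>
     (\<forall>s\<ge>0. \<forall>t\<ge>0. \<forall>x\<in>X. T (s + t) x = T s (T t x)) \<and>
     (\<forall>x\<in>X. ((\<lambda>t. T t x) \<longlongrightarrow> x) (at_right 0))"

definition generator_graph ::
  "'a::real_normed_vector set \<Rightarrow> (real \<Rightarrow> 'a \<Rightarrow> 'a) \<Rightarrow> ('a \<times> 'a) set" where
  "generator_graph X T =
     {(x, y). x \<in> X \<and> y \<in> X \<and> ((\<lambda>t. (T t x - x) /\<^sub>R t) \<longlongrightarrow> y) (at_right 0)}"

text \<open>
  The growth bound is the infimum of all \<open>\<omega>\<close> such that \<open>\<parallel>T(t)\<parallel> \<le> M e\<^bsup>\<omega>t\<^esup>\<close> for some \<open>M\<close>;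
  it may be \<open>-\<infinity>\<close>.
\<close>

definition growth_bound :: "'a::real_normed_vector set \<Rightarrow> (real \<Rightarrow> 'a \<Rightarrow> 'a) \<Rightarrow> ereal" where
  "growth_bound X T =
     Inf {ereal \<omega> | \<omega>. \<exists>M. \<forall>t\<ge>0. \<forall>x\<in>X. norm (T t x) \<le> M * exp (\<omega> * t) * norm x}"

definition exponentially_stable ::
  "'a::real_normed_vector set \<Rightarrow> (real \<Rightarrow> 'a \<Rightarrow> 'a) \<Rightarrow> real \<Rightarrow> bool" where
  "exponentially_stable X T \<beta> \<longleftrightarrow> growth_bound X T < ereal \<beta>"

definition L2_nonneg :: "L2 \<Rightarrow> bool" where
  "L2_nonneg x \<longleftrightarrow> (AE z in lborel. 0 \<le> rep_L2 x z)"

definition positive_semigroup :: "L2 set \<Rightarrow> (real \<Rightarrow> L2 \<Rightarrow> L2) \<Rightarrow> bool" where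
  "positive_semigroup X T \<longleftrightarrow> (\<forall>t\<ge>0. \<forall>x\<in>X. L2_nonneg x \<longrightarrow> L2_nonneg (T t x))"

text \<open>
  A semigroup is uniquely determined on \<open>L\<^sup>2(0, L)\<close> by its generator, so \<open>T\<close> below is the
  semigroup generated by \<open>A\<^sub>\<kappa>\<close>.
\<close>

definition feasible :: "real \<Rightarrow> real \<Rightarrow> real \<Rightarrow> real \<Rightarrow> bool" where
  "feasible D L \<alpha> \<kappa> \<longleftrightarrow> (\<exists>T.
     C0_semigroup (L2_on L) T \<and> generator_graph (L2_on L) T = A_graph D L \<kappa> \<and>
     positive_semigroup (L2_on L) T \<and>
     (\<forall>\<beta>\<in>{-\<alpha><..0}. exponentially_stable (L2_on L) T \<beta>))"

end

theory Submission
  imports Defs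
begin

text \<open>
  For \<open>\<kappa> < 0\<close> write \<open>\<kappa> = - r tan (L r)\<close> with \<open>0 < L r < \<pi>/2\<close>. Then \<open>cos (r (L - z))\<close> is a positive
  eigenfunction of \<open>A\<^sub>\<kappa>\<close> for the eigenvalue \<open>- D r\<^sup>2\<close>, and this is the growth bound: an eigenvalue is a
  lower bound, and Picone's identity with this ground state gives \<open>\<langle>h, R h\<rangle> \<ge> D r\<^sup>2 \<parallel>R h\<parallel>\<^sup>2\<close> for
  \<open>R = - A\<^sub>\<kappa>\<inverse>\<close>. For \<open>\<kappa> \<ge> 0\<close> there is an eigenvalue \<open>\<ge> 0\<close> with a \<open>cosh\<close> eigenfunction. As
  \<open>r tan (L r)\<close> increases from \<open>0\<close> to \<open>\<infinity>\<close>, the feasible \<open>\<kappa>\<close> are bounded above by \<open>\<kappa>\<^sub>*\<close>, so it suffices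
  that \<open>\<kappa>\<^sub>*\<close> itself is feasible. The semigroup is generated by the Yosida approximations
  \<open>- n (I + n R)\<inverse>\<close>; it is positive because the resolvent is, by a minimum principle.
\<close>

section \<open>Bounded endomorphisms as a Banach algebra\<close>

text \<open>The construction works with the bounded operator \<open>R\<close> instead of the
  unbounded \<open>A\<close>: for \<kappa> = -K < 0 the problem -A u = x is uniquely solvable
  because the condition at 0 fixes the additive constant. Density of the domain becomes density of
  the range of \<open>R\<close>, and the generator is matched with \<open>A_graph\<close> by
  integrating twice. Weak derivatives are reduced to primitives beforehand: by the lemma of du
  Bois-Reymond, \<open>x\<close> has weak derivative \<open>y\<close> exactly when \<open>x\<close>
  is a constant plus the primitive of \<open>y\<close>. An obstacle is that exponential series live
  in an algebra over a type, while the space at hand is only a closed subspace of \<open>L2\<close>.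
  So \<open>R\<close> is defined on all of \<open>L2\<close>, its values lie in the subspace, and
  only there is it injective. The necessary conditions concern an arbitrary semigroup supplied by
  \<open>feasible\<close>, not the constructed one. They rest on its orbit through an eigenvector,
  and the uniform bound required for that orbit comes from stability with \<beta> = 0.\<close>

typedef (overloaded) 'a endo = "UNIV :: ('a::real_normed_vector \<Rightarrow>\<^sub>L 'a) set"
  morphisms blinfun_of_endo Endo ..

setup_lifting type_definition_endo

instantiation endo :: (real_normed_vector) real_normed_vector
begin

lift_definition zero_endo :: "'a endo" is 0 .
lift_definition plus_endo :: "'a endo \<Rightarrow> 'a endo \<Rightarrow> 'a endo" is "(+)" .
lift_definition uminus_endo :: "'a endo \<Rightarrow> 'a endo" is uminus .
lift_definition minus_endo :: "'a endo \<Rightarrow> 'a endo \<Rightarrow> 'a endo" is "(-)" .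
lift_definition scaleR_endo :: "real \<Rightarrow> 'a endo \<Rightarrow> 'a endo" is "(*\<^sub>R)" .
lift_definition norm_endo :: "'a endo \<Rightarrow> real" is norm .
definition dist_endo :: "'a endo \<Rightarrow> 'a endo \<Rightarrow> real" where "dist_endo x y = norm (x - y)"
definition sgn_endo :: "'a endo \<Rightarrow> 'a endo" where "sgn_endo x = inverse (norm x) *\<^sub>R x"
definition uniformity_endo :: "('a endo \<times> 'a endo) filter" where
  "uniformity_endo = (INF e\<in>{0<..}. principal {(x, y). dist x y < e})"
definition open_endo :: "'a endo set \<Rightarrow> bool" where
  "open_endo U \<longleftrightarrow> (\<forall>x\<in>U. eventually (\<lambda>(x', y). x' = x \<longrightarrow> y \<in> U) uniformity)"

instance
  by standard
    (fact dist_endo_def sgn_endo_def uniformity_endo_def open_endo_def |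
      (transfer, simp add: algebra_simps norm_triangle_ineq))+

end

instance endo :: (banach) banach
proof
  fix u :: "nat \<Rightarrow> 'a endo" assume "Cauchy u"
  then have "Cauchy (\<lambda>n. blinfun_of_endo (u n))"
    unfolding Cauchy_def dist_norm by transfer
  then obtain l where "(\<lambda>n. blinfun_of_endo (u n)) \<longlonglongrightarrow> l"
    using Cauchy_convergent unfolding convergent_def by blast
  then have "u \<longlonglongrightarrow> Endo l"
    unfolding LIMSEQ_def dist_norm by (transfer, simp)
  then show "convergent u" by (auto simp: convergent_def)
qed

text \<open>\<open>perfect_space\<close> excludes the zero space, where the identity would have norm
  0. The wrapper type itself exists because \<open>blinfun\<close> has two type parameters and so
  cannot carry a multiplication of one type.\<close>

instantiation endo :: ("{real_normed_vector, perfect_space}") real_normed_algebra_1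
begin

lift_definition one_endo :: "'a endo" is id_blinfun .
lift_definition times_endo :: "'a endo \<Rightarrow> 'a endo \<Rightarrow> 'a endo" is "(o\<^sub>L)" .

instance
proof
  fix a b c :: "'a endo" and r :: real
  show "a * b * c = a * (b * c)" by transfer (rule blinfun_eqI, simp)
  show "(a + b) * c = a * c + b * c" by transfer (simp add: blinfun.bilinear_simps blinfun_eqI)
  show "a * (b + c) = a * b + a * c" by transfer (simp add: blinfun.bilinear_simps blinfun_eqI)
  show "r *\<^sub>R a * b = r *\<^sub>R (a * b)" by transfer (simp add: blinfun.bilinear_simps blinfun_eqI)
  show "a * r *\<^sub>R b = r *\<^sub>R (a * b)" by transfer (simp add: blinfun.bilinear_simps blinfun_eqI)
  show "1 * a = a" by transfer (simp add: blinfun_eqI)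
  show "a * 1 = a" by transfer (simp add: blinfun_eqI)
  show "norm (a * b) \<le> norm a * norm b" by transfer (rule norm_blinfun_compose)
  show "norm (1 :: 'a endo) = 1" by transfer simp
  then show "(0 :: 'a endo) \<noteq> 1" by (metis norm_zero zero_neq_one)
qed

end

lift_definition app :: "'a::real_normed_vector endo \<Rightarrow> 'a \<Rightarrow> 'a" is blinfun_apply .

lemma bounded_bilinear_app: "bounded_bilinear (app :: 'a::real_normed_vector endo \<Rightarrow> _)"
proof
  fix a a' :: "'a endo" and b b' and r :: real
  show "app (a + a') b = app a b + app a' b" by transfer (simp add: blinfun.bilinear_simps)
  show "app a (b + b') = app a b + app a b'" by transfer (simp add: blinfun.bilinear_simps)
  show "app (r *\<^sub>R a) b = r *\<^sub>R app a b" by transfer (simp add: blinfun.bilinear_simps)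
  show "app a (r *\<^sub>R b) = r *\<^sub>R app a b" by transfer (simp add: blinfun.bilinear_simps)
  have "norm (app a b) \<le> norm a * norm b * 1" for a :: "'a endo" and b
    by transfer (simp add: norm_blinfun)
  then show "\<exists>K. \<forall>(a :: 'a endo) b. norm (app a b) \<le> norm a * norm b * K" by blast
qed

interpretation app: bounded_bilinear app
  by (rule bounded_bilinear_app)

lemma norm_app: "norm (app a x) \<le> norm a * norm x"
  by transfer (rule norm_blinfun)

lemma norm_endo_bound: "0 \<le> b \<Longrightarrow> (\<And>x. norm (app a x) \<le> b * norm x) \<Longrightarrow> norm a \<le> b"
  by transfer (rule norm_blinfun_bound)

lemma app_one [simp]: "app 1 x = x"
  by transfer simp

lemma app_times [simp]: "app (a * b) x = app a (app b x)"
  by transfer simp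

lemma endo_eqI: "(\<And>x. app a x = app b x) \<Longrightarrow> a = b"
  by transfer (rule blinfun_eqI)

lemma bounded_linear_imp_endo:
  assumes "bounded_linear f"
  obtains a where "app a = f"
  by (metis app.abs_eq assms bounded_linear_Blinfun_apply)

text \<open>This makes the exponential a Poisson average of the powers of \<open>g\<close>: Yosida
  approximations have the form of a multiple of \<open>g - 1\<close>, so their norm bound and
  positivity can be read off from \<open>g\<close>.\<close>

lemma exp_scaleR_minus_one:
  fixes g :: "'a::{real_normed_algebra_1,banach}"
  shows "exp (s *\<^sub>R (g - 1)) = exp (- s) *\<^sub>R exp (s *\<^sub>R g)"
proof -
  have "exp (s *\<^sub>R (g - 1)) = exp (s *\<^sub>R g + (- s) *\<^sub>R 1)"
    by (simp add: algebra_simps)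
  also have "\<dots> = exp (s *\<^sub>R g) * exp ((- s) *\<^sub>R 1)"
    by (rule exp_add_commuting) simp
  also have "\<dots> = exp (- s) *\<^sub>R exp (s *\<^sub>R g)"
    by (metis exp_of_real mult.right_neutral mult_scaleR_right of_real_def)
  finally show ?thesis .
qed

lemma norm_exp_minus_one:
  fixes g :: "'a::{real_normed_algebra_1,banach}"
  assumes "0 \<le> s"
  shows "norm (exp (s *\<^sub>R (g - 1))) \<le> exp (s * (norm g - 1))"
proof -
  have "norm (exp (s *\<^sub>R (g - 1))) = exp (- s) * norm (exp (s *\<^sub>R g))"
    by (simp add: exp_scaleR_minus_one)
  also have "\<dots> \<le> exp (- s) * exp (s * norm g)"
    using norm_exp[of "s *\<^sub>R g"] assms by (intro mult_left_mono) auto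
  finally show ?thesis
    by (simp add: exp_add[symmetric] algebra_simps)
qed

text \<open>All coefficients of the exponential series are nonnegative, so partial sums stay in the
  cone, and closedness passes to the limit. It serves both for the subspace \<open>X\<close> and for
  positivity.\<close>

lemma exp_preserves_cone:
  fixes g :: "'a::{banach,perfect_space} endo"
  assumes P: "closed P" "0 \<in> P" "\<And>x y. x \<in> P \<Longrightarrow> y \<in> P \<Longrightarrow> x + y \<in> P"
    "\<And>c x. 0 \<le> c \<Longrightarrow> x \<in> P \<Longrightarrow> c *\<^sub>R x \<in> P"
    and g: "\<And>x. x \<in> P \<Longrightarrow> app g x \<in> P" and s: "0 \<le> s" and x: "x \<in> P"
  shows "app (exp (s *\<^sub>R (g - 1))) x \<in> P"
proof -
  have pow: "app ((s *\<^sub>R g) ^ n) x \<in> P" for n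
  proof (induction n)
    case (Suc n)
    then show ?case
      unfolding power_Suc app_times app.scaleR_left by (intro P(4) g s)
  qed (simp add: x)
  have "app (\<Sum>i<n. (s *\<^sub>R g) ^ i /\<^sub>R fact i) x \<in> P" for n
  proof (induction n)
    case (Suc n)
    have "inverse (fact n) *\<^sub>R app ((s *\<^sub>R g) ^ n) x \<in> P"
      by (rule P(4)[OF _ pow]) simp
    then have "app (\<Sum>i<n. (s *\<^sub>R g) ^ i /\<^sub>R fact i) x + app ((s *\<^sub>R g) ^ n /\<^sub>R fact n) x \<in> P"
      unfolding app.scaleR_left by (rule P(3)[OF Suc])
    then show ?case
      unfolding sum.lessThan_Suc app.add_left .
  qed (simp add: P(2) app.zero_left)
  moreover have "(\<lambda>n. app (\<Sum>i<n. (s *\<^sub>R g) ^ i /\<^sub>R fact i) x) \<longlonglongrightarrow> app (exp (s *\<^sub>R g)) x"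
    using exp_converges[of "s *\<^sub>R g"] unfolding sums_def by (intro app.tendsto tendsto_const)
  ultimately have "app (exp (s *\<^sub>R g)) x \<in> P"
    by (rule closed_sequentially[OF P(1)])
  then show ?thesis
    by (simp add: exp_scaleR_minus_one app.scaleR_left P(4))
qed

section \<open>Semigroups from the inverse of a coercive operator\<close>

lemma norm_diff_le_of_vector_derivative:
  fixes f :: "real \<Rightarrow> 'b::real_normed_vector"
  assumes "convex S" "\<And>s. s \<in> S \<Longrightarrow> (f has_vector_derivative f' s) (at s within S)"
    "\<And>s. s \<in> S \<Longrightarrow> norm (f' s) \<le> c" "t \<in> S" "t' \<in> S"
  shows "norm (f t - f t') \<le> c * norm (t - t')"
proof (rule differentiable_bound[OF assms(1) _ _ assms(4,5)])
  fix s assume s: "s \<in> S"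
  show "(f has_derivative (\<lambda>h. h *\<^sub>R f' s)) (at s within S)"
    using assms(2)[OF s] by (simp add: has_vector_derivative_def)
  show "onorm (\<lambda>h. h *\<^sub>R f' s) \<le> c"
    using assms(3)[OF s] by (intro onorm_le) (simp add: mult.commute[of c] mult_left_mono)
qed

text \<open>\<open>R\<close> stands for -A^{-1}: with u = R h, coercivity says that the inner
  product of -A u and u is at least \<alpha> |u|^2. Injectivity is asked on \<open>X\<close> only,
  since the operator in view ignores whatever lives outside the interval.\<close>

locale accretive_inverse =
  fixes X :: "'a::{real_inner,banach,perfect_space} set" and R :: "'a \<Rightarrow> 'a" and \<alpha> :: real
  assumes closed_X: "closed X" and subspace_X: "subspace X"
    and bounded_linear_R: "bounded_linear R" and R_in: "R h \<in> X"
    and R_inj: "h \<in> X \<Longrightarrow> R h = 0 \<Longrightarrow> h = 0"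
    and \<alpha>_nonneg: "0 \<le> \<alpha>" and coercive: "\<alpha> * (norm (R h))\<^sup>2 \<le> inner h (R h)"
begin

interpretation R: bounded_linear R
  by (rule bounded_linear_R)

lemma inner_R_nonneg: "0 \<le> inner h (R h)"
  using coercive[of h] \<alpha>_nonneg by (meson mult_nonneg_nonneg order_trans zero_le_power2)

lemma norm_le_of_resolvent_eq:
  assumes "0 \<le> l" "x + l *\<^sub>R R x = y"
  shows "norm x \<le> norm y"
proof -
  have "norm x * norm x \<le> inner x x + l * inner x (R x)"
    using assms inner_R_nonneg[of x] by (simp add: dot_square_norm power2_eq_square)
  also have "\<dots> = inner x y"
    using assms(2) by (auto simp: inner_add_right)
  also have "\<dots> \<le> norm x * norm y"
    by (rule norm_cauchy_schwarz)
  finally show ?thesis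
    by (cases "x = 0") auto
qed

lemma resolvent_eq_unique:
  assumes "0 \<le> l" "x + l *\<^sub>R R x = x' + l *\<^sub>R R x'"
  shows "x = x'"
proof -
  have "(x - x') + l *\<^sub>R R (x - x') = 0"
    using assms(2) by (simp add: R.diff algebra_simps)
  from norm_le_of_resolvent_eq[OF assms(1) this] show ?thesis by simp
qed

text \<open>Lax-Milgram by fixed-point iteration: accretivity makes \<open>S\<close> coercive with
  constant 1, so a damped correction step is a contraction however large \<open>l\<close>
  is.\<close>

lemma resolvent_eq_solvable:
  assumes l: "0 \<le> l"
  shows "\<exists>x. x + l *\<^sub>R R x = y"
proof -
  obtain K where K: "K > 0" "norm (R x) \<le> norm x * K" for x
    using R.pos_bounded by blast
  define S where "S x = x + l *\<^sub>R R x" for x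
  define c where "c = 1 + l * K"
  have c: "1 \<le> c" using l K by (simp add: c_def)
  have S_le: "norm (S x) \<le> c * norm x" for x
  proof -
    have "norm (S x) \<le> norm x + l * norm (R x)"
      unfolding S_def using norm_triangle_ineq[of x "l *\<^sub>R R x"] l by simp
    also have "\<dots> \<le> norm x + l * (norm x * K)"
      by (intro add_left_mono mult_left_mono K l)
    finally show ?thesis by (simp add: c_def algebra_simps)
  qed
  have S_ge: "(norm x)\<^sup>2 \<le> inner x (S x)" for x
    using l inner_R_nonneg[of x] by (simp add: S_def inner_add_right dot_square_norm)
  have S_diff: "S x - S x' = S (x - x')" for x x'
    by (simp add: S_def R.diff algebra_simps)
  \<comment> \<open>This value minimizes the factor 1 - 2 e + e^2 c^2 for the squared distance,
    which then equals 1 - e.\<close>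
  define e where "e = 1 / c\<^sup>2"
  have e: "0 < e" "e \<le> 1" "e * c\<^sup>2 = 1"
    using c by (auto simp: e_def)
  define f where "f x = x - e *\<^sub>R (S x - y)" for x
  have "\<exists>!x. f x = x"
  proof (rule banach_fix_type[of "sqrt (1 - e)"])
    show "0 \<le> sqrt (1 - e)" "sqrt (1 - e) < 1" using e by auto
    show "\<forall>x x'. dist (f x) (f x') \<le> sqrt (1 - e) * dist x x'"
    proof (intro allI)
      fix x x' :: 'a
      define d where "d = x - x'"
      have "f x - f x' = d - e *\<^sub>R S d"
        by (simp add: f_def d_def S_diff[symmetric] algebra_simps)
      then have "(norm (f x - f x'))\<^sup>2 = inner (d - e *\<^sub>R S d) (d - e *\<^sub>R S d)"
        by (simp only: power2_norm_eq_inner)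
      also have "\<dots> = (norm d)\<^sup>2 - 2 * e * inner d (S d) + e\<^sup>2 * (norm (S d))\<^sup>2"
        unfolding power2_norm_eq_inner
        by (simp add: inner_diff inner_commute power2_eq_square algebra_simps)
      also have "\<dots> \<le> (norm d)\<^sup>2 - 2 * e * (norm d)\<^sup>2 + e\<^sup>2 * (c * norm d)\<^sup>2"
        using e by (intro add_mono diff_mono mult_left_mono S_ge power_mono S_le) auto
      also have "\<dots> = (1 - 2 * e + e * (e * c\<^sup>2)) * (norm d)\<^sup>2"
        by (simp add: power2_eq_square algebra_simps)
      also have "\<dots> = (1 - e) * (norm d)\<^sup>2"
        using e(3) by simp
      finally have "norm (f x - f x') \<le> sqrt ((1 - e) * (norm d)\<^sup>2)"
        by (rule real_le_rsqrt)
      then show "dist (f x) (f x') \<le> sqrt (1 - e) * dist x x'"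
        by (simp add: real_sqrt_mult dist_norm d_def)
    qed
  qed
  then obtain x where "f x = x" by blast
  then have "S x = y" using e by (simp add: f_def)
  then show ?thesis by (auto simp: S_def)
qed

lemma ex_resolvent:
  assumes l: "0 \<le> l"
  shows "\<exists>b. \<forall>y. app b y + l *\<^sub>R R (app b y) = y"
proof -
  obtain f where f: "f y + l *\<^sub>R R (f y) = y" for y
    using resolvent_eq_solvable[OF l] by metis
  have "bounded_linear f"
  proof (rule bounded_linear_intro)
    fix x y :: 'a and r :: real
    show "f (x + y) = f x + f y"
    proof (rule resolvent_eq_unique[OF l])
      have "f x + f y + l *\<^sub>R R (f x + f y) = (f x + l *\<^sub>R R (f x)) + (f y + l *\<^sub>R R (f y))"
        by (simp add: R.add algebra_simps)
      then show "f (x + y) + l *\<^sub>R R (f (x + y)) = f x + f y + l *\<^sub>R R (f x + f y)"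
        by (simp only: f)
    qed
    show "f (r *\<^sub>R x) = r *\<^sub>R f x"
    proof (rule resolvent_eq_unique[OF l])
      have "r *\<^sub>R f x + l *\<^sub>R R (r *\<^sub>R f x) = r *\<^sub>R (f x + l *\<^sub>R R (f x))"
        by (simp add: R.scaleR algebra_simps)
      then show "f (r *\<^sub>R x) + l *\<^sub>R R (f (r *\<^sub>R x)) = r *\<^sub>R f x + l *\<^sub>R R (r *\<^sub>R f x)"
        by (simp only: f)
    qed
    show "norm (f x) \<le> norm x * 1"
      using norm_le_of_resolvent_eq[OF l f[of x]] by simp
  qed
  with f show ?thesis by (metis bounded_linear_imp_endo)
qed

text \<open>\<open>B n = (I + n R)\<inverse>\<close>; in terms of \<open>A = - R\<inverse>\<close> the operator \<open>G n = I - B n\<close> below is \<open>n (n - A)\<inverse>\<close>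
  and \<open>yosida n = - n B n\<close> is the Yosida approximation of \<open>A\<close>.\<close>

definition B :: "nat \<Rightarrow> 'a endo" where
  "B n = (SOME b. \<forall>y. app b y + real n *\<^sub>R R (app b y) = y)"

lemma B_eq: "app (B n) y + real n *\<^sub>R R (app (B n) y) = y"
  using someI_ex[OF ex_resolvent[of "real n"]] by (simp add: B_def)

lemma B_eqI: "x + real n *\<^sub>R R x = y \<Longrightarrow> app (B n) y = x"
  by (rule resolvent_eq_unique[of "real n"]) (simp_all add: B_eq)

lemma B_R: "app (B n) (R y) = R (app (B n) y)"
proof (rule B_eqI)
  have "R (app (B n) y) + real n *\<^sub>R R (R (app (B n) y)) = R (app (B n) y + real n *\<^sub>R R (app (B n) y))"
    by (simp add: R.add R.scaleR)
  then show "R (app (B n) y) + real n *\<^sub>R R (R (app (B n) y)) = R y"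
    by (simp add: B_eq)
qed

lemma B_commute: "B n * B m = B m * B n"
proof (rule endo_eqI)
  fix y
  have "app (B n) (app (B m) y) = app (B m) (app (B n) y)"
  proof (rule B_eqI)
    have "app (B m) (app (B n) y) + real n *\<^sub>R R (app (B m) (app (B n) y))
        = app (B m) (app (B n) y + real n *\<^sub>R R (app (B n) y))"
      by (simp add: app.add_right app.scaleR_right B_R)
    then show "app (B m) (app (B n) y) + real n *\<^sub>R R (app (B m) (app (B n) y)) = app (B m) y"
      by (simp add: B_eq)
  qed
  then show "app (B n * B m) y = app (B m * B n) y" by simp
qed

lemma B_in: "y \<in> X \<Longrightarrow> app (B n) y \<in> X"
proof -
  assume "y \<in> X"
  moreover have "app (B n) y = y - real n *\<^sub>R R (app (B n) y)"
    using B_eq[of n y] by (simp add: eq_diff_eq)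
  ultimately show ?thesis
    by (metis R_in subspace_X subspace_diff subspace_scale)
qed

text \<open>It expresses differences of resolvents as values of \<open>R\<close>, which lets
  accretivity act on them in the convergence proof below.\<close>

lemma resolvent_identity:
  "app (B n) y - app (B m) y = (real m - real n) *\<^sub>R R (app (B n) (app (B m) y))"
proof -
  have "app (B n) y = app (B m) y + (real m - real n) *\<^sub>R R (app (B n) (app (B m) y))"
  proof (rule B_eqI)
    define w where "w = app (B m) y"
    define u where "u = app (B n) w"
    have "R u + real n *\<^sub>R R (R u) = R w"
      using arg_cong[OF B_eq[of n w], of R] by (simp add: u_def R.add R.scaleR)
    then have "(real m - real n) *\<^sub>R R w = (real m - real n) *\<^sub>R (R u + real n *\<^sub>R R (R u))"
      by simp
    then have "w + (real m - real n) *\<^sub>R R u + real n *\<^sub>R R (w + (real m - real n) *\<^sub>R R u)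
        = w + real m *\<^sub>R R w"
      by (simp add: R.add R.diff R.scaleR algebra_simps)
    also have "\<dots> = y"
      unfolding w_def by (rule B_eq)
    finally show "app (B m) y + (real m - real n) *\<^sub>R R (app (B n) (app (B m) y)) + real n *\<^sub>R
        R (app (B m) y + (real m - real n) *\<^sub>R R (app (B n) (app (B m) y))) = y"
      unfolding u_def w_def .
  qed
  then show ?thesis by simp
qed

text \<open>
  The sequence \<open>w\<^sub>n = B n y\<close> satisfies \<open>\<parallel>w\<^sub>n - w\<^sub>m\<parallel>\<^sup>2 \<le> \<parallel>w\<^sub>n\<parallel>\<^sup>2 - \<parallel>w\<^sub>m\<parallel>\<^sup>2\<close> for \<open>n \<le> m\<close>, hence
  converges; since \<open>n R w\<^sub>n = y - w\<^sub>n\<close> is bounded, its limit lies in the kernel of \<open>R\<close>.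
\<close>

lemma B_tendsto_0:
  assumes y: "y \<in> X"
  shows "(\<lambda>n. app (B n) y) \<longlonglongrightarrow> 0"
proof -
  define w where "w n = app (B n) y" for n
  have key: "(norm (w n - w m))\<^sup>2 \<le> (norm (w n))\<^sup>2 - (norm (w m))\<^sup>2" if "n \<le> m" for n m
  proof -
    \<comment> \<open>By the resolvent identity \<open>w n - w m\<close> is (m - n) R u, and
      \<open>w m\<close> is u + n R u. Accretivity makes their inner product nonnegative, and
      expanding the square of \<open>(w n - w m) + w m\<close> gives the estimate.\<close>
    define u where "u = app (B n) (w m)"
    have "inner (R u) (w m) = inner (R u) (u + real n *\<^sub>R R u)"
      using B_eq[of n "w m"] by (simp add: u_def)
    also have "\<dots> = inner u (R u) + real n * (norm (R u))\<^sup>2"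
      by (simp add: inner_add_right power2_norm_eq_inner inner_commute)
    also have "\<dots> \<ge> 0"
      using inner_R_nonneg by simp
    finally have "inner (w n - w m) (w m) \<ge> 0"
      using that resolvent_identity[of n y m] by (simp add: w_def u_def)
    moreover have "(norm (w n))\<^sup>2 = (norm ((w n - w m) + w m))\<^sup>2" by simp
    ultimately show ?thesis
      unfolding power2_norm_eq_inner by (simp add: inner_add inner_commute inner_diff algebra_simps)
  qed
  have "decseq (\<lambda>n. (norm (w n))\<^sup>2)"
    unfolding decseq_def using key by (meson diff_ge_0_iff_ge order_trans zero_le_power2)
  then obtain c where "(\<lambda>n. (norm (w n))\<^sup>2) \<longlonglongrightarrow> c"
    by (rule decseq_convergent[where B = 0]) auto
  then have "convergent (\<lambda>n. (norm (w n))\<^sup>2)"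
    by (rule convergentI)
  then have C: "Cauchy (\<lambda>n. (norm (w n))\<^sup>2)"
    by (rule convergent_Cauchy)
  have "Cauchy w"
  proof (rule metric_CauchyI)
    fix e :: real assume "0 < e"
    then obtain N where N: "dist ((norm (w m))\<^sup>2) ((norm (w n))\<^sup>2) < e\<^sup>2" if "m \<ge> N" "n \<ge> N" for m n
      using metric_CauchyD[OF C, of "e\<^sup>2"] by auto
    have le: "dist (w n) (w m) < e" if "n \<ge> N" "m \<ge> n" for n m
    proof -
      have "(norm (w n - w m))\<^sup>2 < e\<^sup>2"
        using key[of n m] N[of n m] that by (auto simp: dist_real_def)
      then show ?thesis
        using \<open>0 < e\<close> by (simp add: dist_norm power2_less_imp_less)
    qed
    show "\<exists>M. \<forall>m\<ge>M. \<forall>n\<ge>M. dist (w m) (w n) < e"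
      using le by (metis dist_commute nle_le)
  qed
  then obtain v where v: "w \<longlonglongrightarrow> v"
    by (auto simp: convergent_def dest!: Cauchy_convergent)
  have "v \<in> X"
    by (rule closed_sequentially[OF closed_X _ v]) (simp add: w_def B_in y)
  have "(\<lambda>n. inverse (real n) *\<^sub>R (y - w n)) \<longlonglongrightarrow> 0 *\<^sub>R (y - v)"
    by (intro tendsto_intros v lim_inverse_n)
  moreover have "\<forall>\<^sub>F n in sequentially. inverse (real n) *\<^sub>R (y - w n) = R (w n)"
    using eventually_gt_at_top[of 0]
  proof eventually_elim
    case (elim n)
    have "y - w n = real n *\<^sub>R R (w n)"
      using B_eq[of n y] by (simp add: w_def algebra_simps)
    with elim show ?case by simp
  qed
  ultimately have "(\<lambda>n. R (w n)) \<longlonglongrightarrow> 0"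
    by (auto simp: tendsto_cong)
  moreover have "(\<lambda>n. R (w n)) \<longlonglongrightarrow> R v"
    by (rule R.tendsto[OF v])
  ultimately have "R v = 0"
    using LIMSEQ_unique by blast
  with \<open>v \<in> X\<close> have "v = 0" by (rule R_inj)
  with v show ?thesis by (simp add: w_def[abs_def])
qed

text \<open>\<open>x - app (B n) x\<close> is a value of \<open>R\<close> on \<open>X\<close>, so
  the convergence of \<open>B n\<close> to 0 is precisely density of the domain of the
  generator.\<close>

lemma range_R_dense:
  assumes "x \<in> X" "0 < e"
  obtains w where "w \<in> X" "norm (x - R w) < e"
proof -
  from B_tendsto_0[OF assms(1)] obtain n where "norm (app (B n) x) < e"
    by (metis LIMSEQ_iff assms(2) diff_zero order_refl)
  moreover have "app (B n) x = x - R (real n *\<^sub>R app (B n) x)"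
    using B_eq[of n x] by (simp add: R.scaleR eq_diff_eq)
  moreover have "real n *\<^sub>R app (B n) x \<in> X"
    using B_in assms(1) subspace_X subspace_scale by blast
  ultimately show ?thesis using that by metis
qed

definition G :: "nat \<Rightarrow> 'a endo" where "G n = 1 - B n"

lemma G_eq: "app (G n) y = real n *\<^sub>R R (app (B n) y)"
  using B_eq[of n y] by (simp add: G_def app.diff_left diff_eq_eq add.commute)

text \<open>The Hille-Yosida estimate for n (n - A)^{-1}. With x = n R w and w = y - x, coercivity
  at \<open>w\<close> reads \<alpha> |x|^2 \<le> n (y - x, x), and Cauchy-Schwarz finishes.\<close>

lemma norm_G: "n > 0 \<Longrightarrow> norm (G n) \<le> real n / (real n + \<alpha>)"
proof (rule norm_endo_bound)
  assume n: "n > 0"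
  show "0 \<le> real n / (real n + \<alpha>)" using \<alpha>_nonneg by simp
  fix y
  define w where "w = app (B n) y"
  define x where "x = app (G n) y"
  have x: "x = real n *\<^sub>R R w" "w = y - x"
    unfolding x_def w_def by (rule G_eq, simp add: G_def app.diff_left)
  have Rw: "R w = inverse (real n) *\<^sub>R x" using x(1) n by simp
  have "\<alpha> * (norm x)\<^sup>2 = (real n)\<^sup>2 * (\<alpha> * (norm (R w))\<^sup>2)"
    using n by (simp add: Rw power2_eq_square divide_simps)
  also have "\<dots> \<le> (real n)\<^sup>2 * inner w (R w)"
    by (intro mult_left_mono coercive) auto
  also have "\<dots> = real n * inner (y - x) x"
    using n by (simp add: Rw x(2)[symmetric] power2_eq_square)
  also have "\<dots> = real n * inner y x - real n * (norm x)\<^sup>2"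
    by (simp add: inner_diff power2_norm_eq_inner right_diff_distrib)
  finally have "(real n + \<alpha>) * (norm x)\<^sup>2 \<le> real n * inner y x"
    by (simp add: algebra_simps)
  also have "\<dots> \<le> real n * (norm y * norm x)"
    by (intro mult_left_mono norm_cauchy_schwarz) auto
  finally have "((real n + \<alpha>) * norm x) * norm x \<le> (real n * norm y) * norm x"
    by (simp add: power2_eq_square mult.assoc)
  then have "(real n + \<alpha>) * norm x \<le> real n * norm y"
    by (cases "norm x = 0") auto
  then show "norm (app (G n) y) \<le> real n / (real n + \<alpha>) * norm y"
    using n \<alpha>_nonneg by (simp add: x_def field_simps)
qed

lemma G_tendsto: "y \<in> X \<Longrightarrow> (\<lambda>n. app (G n) y) \<longlonglongrightarrow> y"
  using tendsto_diff[OF tendsto_const[of y] B_tendsto_0[of y]] by (simp add: G_def app.diff_left)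

lemma G_in: "app (G n) y \<in> X"
  unfolding G_eq using R_in subspace_X subspace_scale by blast

section \<open>Yosida approximations and their exponentials\<close>

definition yosida :: "nat \<Rightarrow> 'a endo" where "yosida n = real n *\<^sub>R (G n - 1)"

definition yosida_sg :: "nat \<Rightarrow> real \<Rightarrow> 'a endo" where "yosida_sg n t = exp (t *\<^sub>R yosida n)"

lemma yosida_sg_eq: "yosida_sg n t = exp ((t * real n) *\<^sub>R (G n - 1))"
  by (simp add: yosida_sg_def yosida_def)

lemma yosida_R: "app (yosida n) (R y) = - app (G n) y"
proof -
  have "app (yosida n) (R y) = - (real n *\<^sub>R app (B n) (R y))"
    by (simp add: yosida_def G_def app.scaleR_left app.minus_left)
  then show ?thesis by (simp add: B_R G_eq)
qed

lemma yosida_commute: "yosida n * yosida m = yosida m * yosida n"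
  by (simp add: yosida_def G_def B_commute)

lemma yosida_sg_0: "yosida_sg n 0 = 1"
  by (simp add: yosida_sg_def)

lemma yosida_sg_add: "yosida_sg n (s + t) = yosida_sg n s * yosida_sg n t"
  unfolding yosida_sg_def scaleR_add_left by (rule exp_add_commuting) simp

text \<open>The exponent tends to -\<alpha> t as \<open>n\<close> grows, so the limit semigroup
  loses nothing of the decay rate \<alpha>.\<close>

lemma norm_yosida_sg:
  assumes "0 \<le> t" "0 < n"
  shows "norm (yosida_sg n t) \<le> exp (t * (- (real n * \<alpha>) / (real n + \<alpha>)))"
proof -
  have "norm (yosida_sg n t) \<le> exp (t * real n * (norm (G n) - 1))"
    unfolding yosida_sg_eq by (rule norm_exp_minus_one) (use assms in simp)
  also have "\<dots> \<le> exp (t * real n * (real n / (real n + \<alpha>) - 1))"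
    using assms norm_G[OF assms(2)] by (intro exp_mono mult_left_mono) auto
  also have "t * real n * (real n / (real n + \<alpha>) - 1) = t * (- (real n * \<alpha>) / (real n + \<alpha>))"
    using assms \<alpha>_nonneg by (simp add: field_simps add_nonneg_eq_0_iff)
  finally show ?thesis .
qed

lemma norm_yosida_sg_le_1: "0 \<le> t \<Longrightarrow> norm (yosida_sg n t) \<le> 1"
proof (cases "n = 0")
  case False
  assume t: "0 \<le> t"
  have "t * (- (real n * \<alpha>) / (real n + \<alpha>)) \<le> 0"
    using t \<alpha>_nonneg by (simp add: mult_nonneg_nonneg)
  then show ?thesis
    using norm_yosida_sg[OF t, of n] False by (meson exp_le_one_iff gr0I order_trans)
qed (simp add: yosida_sg_eq)

lemma norm_app_yosida_sg: "0 \<le> t \<Longrightarrow> norm (app (yosida_sg n t) x) \<le> norm x"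
  using norm_app[of "yosida_sg n t" x] mult_right_mono[OF norm_yosida_sg_le_1[of t n], of "norm x"] by simp

lemma yosida_sg_vector_derivative:
  "((\<lambda>s. app (exp (s *\<^sub>R a)) x) has_vector_derivative app (exp (s *\<^sub>R a)) (app a x)) (at s within S)"
  for a :: "'a endo"
  using bounded_linear.has_vector_derivative[OF app.bounded_linear_left
      exp_scaleR_has_vector_derivative_right[of a s S], of x] by simp

text \<open>Mean value inequality for the orbit minus its expected tangent
  \<open>s *\<^sub>R y\<close>.\<close>

lemma yosida_sg_taylor:
  assumes "0 \<le> t" "\<And>s. 0 \<le> s \<Longrightarrow> s \<le> t \<Longrightarrow> norm (app (yosida_sg n s) (app (yosida n) x) - y) \<le> c"
  shows "norm (app (yosida_sg n t) x - x - t *\<^sub>R y) \<le> t * c"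
proof -
  have "norm ((app (yosida_sg n t) x - t *\<^sub>R y) - (app (yosida_sg n 0) x - 0 *\<^sub>R y)) \<le> c * norm (t - 0)"
  proof (rule norm_diff_le_of_vector_derivative[of "{0..t}"])
    fix s assume "s \<in> {0..t}"
    then show "norm (app (yosida_sg n s) (app (yosida n) x) - y) \<le> c" using assms(2) by simp
    show "((\<lambda>s. app (yosida_sg n s) x - s *\<^sub>R y) has_vector_derivative (app (yosida_sg n s) (app (yosida n) x) - y))
        (at s within {0..t})"
      unfolding yosida_sg_def
      by (intro has_vector_derivative_diff yosida_sg_vector_derivative)
        (auto simp: has_vector_derivative_def intro!: derivative_eq_intros)
  qed (use assms in auto)
  then show ?thesis
    using assms(1) by (simp add: yosida_sg_0 algebra_simps)
qed

text \<open>The curve \<open>f\<close> interpolates between the two exponentials. Since the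
  approximations commute it has two forms: the defining one is easy to differentiate, and
  \<open>yosida_sg m (t - s) * yosida_sg n s\<close> exhibits contractions that bound the
  derivative.\<close>

lemma yosida_sg_diff:
  assumes t: "0 \<le> t"
  shows "norm (app (yosida_sg n t) x - app (yosida_sg m t) x) \<le> t * norm (app (yosida n) x - app (yosida m) x)"
proof -
  define a where "a = yosida n - yosida m"
  define f where "f s = app (yosida_sg m t) (app (exp (s *\<^sub>R a)) x)" for s
  have yosida_sg_a: "yosida_sg m t * exp (s *\<^sub>R a) = yosida_sg m (t - s) * yosida_sg n s" for s
  proof -
    have "yosida_sg m t * exp (s *\<^sub>R a) = exp (t *\<^sub>R yosida m + s *\<^sub>R a)"
      unfolding yosida_sg_def by (rule exp_add_commuting[symmetric]) (simp add: a_def algebra_simps yosida_commute)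
    also have "\<dots> = exp ((t - s) *\<^sub>R yosida m + s *\<^sub>R yosida n)"
      by (simp add: a_def algebra_simps)
    also have "\<dots> = yosida_sg m (t - s) * yosida_sg n s"
      unfolding yosida_sg_def by (rule exp_add_commuting) (simp add: yosida_commute)
    finally show ?thesis .
  qed
  have "norm (f t - f 0) \<le> norm (app a x) * norm (t - 0)"
  proof (rule norm_diff_le_of_vector_derivative[of "{0..t}"])
    fix s assume s: "s \<in> {0..t}"
    show "(f has_vector_derivative app (yosida_sg m t) (app (exp (s *\<^sub>R a)) (app a x))) (at s within {0..t})"
      unfolding f_def
      by (rule bounded_linear.has_vector_derivative[OF app.bounded_linear_right yosida_sg_vector_derivative])
    have "app (yosida_sg m t) (app (exp (s *\<^sub>R a)) (app a x)) = app (yosida_sg m (t - s)) (app (yosida_sg n s) (app a x))"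
      by (metis app_times yosida_sg_a)
    then show "norm (app (yosida_sg m t) (app (exp (s *\<^sub>R a)) (app a x))) \<le> norm (app a x)"
      using norm_app_yosida_sg s by (metis atLeastAtMost_iff diff_ge_0_iff_ge order_trans)
  qed (use t in auto)
  moreover have "f t = app (yosida_sg n t) x" "f 0 = app (yosida_sg m t) x"
    using yosida_sg_a[of t] by (auto simp: f_def yosida_sg_0 app_times[symmetric] simp del: app_times)
  ultimately show ?thesis
    using t by (simp add: a_def app.diff_left mult.commute)
qed

lemma yosida_sg_in: "0 \<le> t \<Longrightarrow> x \<in> X \<Longrightarrow> app (yosida_sg n t) x \<in> X"
  unfolding yosida_sg_eq using closed_X subspace_X G_in
  by (intro exp_preserves_cone) (auto simp: subspace_0 subspace_add subspace_scale)

section \<open>The limit semigroup\<close>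

definition T :: "real \<Rightarrow> 'a \<Rightarrow> 'a" where "T t x = lim (\<lambda>n. app (yosida_sg n t) x)"

text \<open>At \<open>R w\<close> the approximations take the values \<open>- app (G n) w\<close>,
  which converge, so the orbits are Cauchy there. Density of the range and contractivity carry this
  over to \<open>X\<close>.\<close>

lemma yosida_sg_tendsto_T:
  assumes t: "0 \<le> t" and x: "x \<in> X"
  shows "(\<lambda>n. app (yosida_sg n t) x) \<longlonglongrightarrow> T t x"
proof -
  have "Cauchy (\<lambda>n. app (yosida_sg n t) x)"
  proof (rule metric_CauchyI)
    fix e :: real assume e: "0 < e"
    obtain w where w: "w \<in> X" "norm (x - R w) < e / 4"
      using range_R_dense[OF x, of "e / 4"] e by auto
    have "Cauchy (\<lambda>n. app (G n) w)"
      by (rule LIMSEQ_imp_Cauchy[OF G_tendsto[OF w(1)]])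
    \<comment> \<open>The denominator contains \<open>t + 1\<close> rather than \<open>t\<close> so
      that t = 0 is covered.\<close>
    then obtain N where N: "dist (app (G n) w) (app (G m) w) < e / (2 * (t + 1))"
      if "n \<ge> N" "m \<ge> N" for n m
      using metric_CauchyD[of _ "e / (2 * (t + 1))"] e t by (metis add_nonneg_pos divide_pos_pos mult_pos_pos zero_less_numeral zero_less_one)
    have "dist (app (yosida_sg n t) x) (app (yosida_sg m t) x) < e" if "n \<ge> N" "m \<ge> N" for n m
    proof -
      have "app (yosida_sg n t) x - app (yosida_sg m t) x = app (yosida_sg n t) (x - R w) - app (yosida_sg m t) (x - R w)
          + (app (yosida_sg n t) (R w) - app (yosida_sg m t) (R w))"
        by (simp add: app.diff_right)
      then have "dist (app (yosida_sg n t) x) (app (yosida_sg m t) x) \<le> norm (app (yosida_sg n t) (x - R w))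
          + norm (app (yosida_sg m t) (x - R w)) + norm (app (yosida_sg n t) (R w) - app (yosida_sg m t) (R w))"
        unfolding dist_norm using norm_triangle_ineq norm_triangle_ineq4 add_mono order_refl order_trans
        by (smt (verit))
      also have "\<dots> \<le> norm (x - R w) + norm (x - R w) + t * norm (app (yosida n) (R w) - app (yosida m) (R w))"
        by (intro add_mono norm_app_yosida_sg yosida_sg_diff t)
      also have "norm (app (yosida n) (R w) - app (yosida m) (R w)) = dist (app (G n) w) (app (G m) w)"
        by (simp add: yosida_R dist_norm norm_minus_commute)
      also have "t * \<dots> \<le> t * (e / (2 * (t + 1)))"
        using N[OF that] t by (intro mult_left_mono) auto
      also have "t * (e / (2 * (t + 1))) \<le> e / 2"
        using t e by (simp add: field_simps)
      finally show ?thesis using w(2) by simp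
    qed
    then show "\<exists>M. \<forall>m\<ge>M. \<forall>n\<ge>M. dist (app (yosida_sg m t) x) (app (yosida_sg n t) x) < e"
      by blast
  qed
  then show ?thesis
    unfolding T_def by (simp add: Cauchy_convergent_iff convergent_LIMSEQ_iff)
qed

lemma T_in: "0 \<le> t \<Longrightarrow> x \<in> X \<Longrightarrow> T t x \<in> X"
  by (rule closed_sequentially[OF closed_X _ yosida_sg_tendsto_T]) (auto intro: yosida_sg_in)

lemma norm_T:
  assumes t: "0 \<le> t" and x: "x \<in> X"
  shows "norm (T t x) \<le> exp (- \<alpha> * t) * norm x"
proof (rule LIMSEQ_le)
  show "(\<lambda>n. norm (app (yosida_sg n t) x)) \<longlonglongrightarrow> norm (T t x)"
    by (intro tendsto_norm yosida_sg_tendsto_T t x)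
  have "(\<lambda>n. \<alpha> / real n) \<longlonglongrightarrow> 0"
    by (rule lim_const_over_n)
  then have "(\<lambda>n. exp (t * (- \<alpha> / (1 + \<alpha> / real n))) * norm x) \<longlonglongrightarrow> exp (t * (- \<alpha> / (1 + 0))) * norm x"
    by (intro tendsto_intros) auto
  moreover have "\<forall>\<^sub>F n in sequentially. exp (t * (- \<alpha> / (1 + \<alpha> / real n))) * norm x
      = exp (t * (- (real n * \<alpha>) / (real n + \<alpha>))) * norm x"
    using eventually_gt_at_top[of 0] by eventually_elim (simp add: field_simps)
  ultimately have "(\<lambda>n. exp (t * (- (real n * \<alpha>) / (real n + \<alpha>))) * norm x) \<longlonglongrightarrow> exp (t * (- \<alpha> / (1 + 0))) * norm x"
    by (rule Lim_transform_eventually)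
  then show "(\<lambda>n. exp (t * (- (real n * \<alpha>) / (real n + \<alpha>))) * norm x) \<longlonglongrightarrow> exp (- \<alpha> * t) * norm x"
    by (simp add: mult.commute)
  have "norm (app (yosida_sg n t) x) \<le> exp (t * (- (real n * \<alpha>) / (real n + \<alpha>))) * norm x" if "n \<ge> 1" for n
    by (rule order_trans[OF norm_app mult_right_mono[OF norm_yosida_sg[OF t]]]) (use that in auto)
  then show "\<exists>N. \<forall>n\<ge>N. norm (app (yosida_sg n t) x) \<le> exp (t * (- (real n * \<alpha>) / (real n + \<alpha>))) * norm x"
    by blast
qed

lemma norm_T_le: "0 \<le> t \<Longrightarrow> x \<in> X \<Longrightarrow> norm (T t x) \<le> norm x"
proof -
  assume t: "0 \<le> t" and x: "x \<in> X"
  have "exp (- \<alpha> * t) * norm x \<le> 1 * norm x"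
    using t \<alpha>_nonneg by (intro mult_right_mono) auto
  then show ?thesis using norm_T[OF t x] by simp
qed

lemma T_0: "x \<in> X \<Longrightarrow> T 0 x = x"
  using yosida_sg_tendsto_T[of 0 x] by (simp add: yosida_sg_0 LIMSEQ_const_iff)

lemma T_plus: "0 \<le> t \<Longrightarrow> x \<in> X \<Longrightarrow> y \<in> X \<Longrightarrow> T t (x + y) = T t x + T t y"
  by (rule LIMSEQ_unique[OF yosida_sg_tendsto_T])
    (auto simp: app.add_right subspace_add[OF subspace_X] intro!: tendsto_add yosida_sg_tendsto_T)

lemma T_scaleR: "0 \<le> t \<Longrightarrow> x \<in> X \<Longrightarrow> T t (c *\<^sub>R x) = c *\<^sub>R T t x"
  by (rule LIMSEQ_unique[OF yosida_sg_tendsto_T])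
    (auto simp: app.scaleR_right subspace_scale[OF subspace_X] intro!: tendsto_scaleR tendsto_const yosida_sg_tendsto_T)

lemma T_add:
  assumes "0 \<le> s" "0 \<le> t" and x: "x \<in> X"
  shows "T (s + t) x = T s (T t x)"
proof (rule LIMSEQ_unique)
  show "(\<lambda>n. app (yosida_sg n (s + t)) x) \<longlonglongrightarrow> T (s + t) x"
    using assms by (intro yosida_sg_tendsto_T) auto
  have "(\<lambda>n. app (yosida_sg n t) x - T t x) \<longlonglongrightarrow> 0"
    using yosida_sg_tendsto_T[OF assms(2) x] by (simp add: LIM_zero_iff)
  then have "(\<lambda>n. app (yosida_sg n s) (app (yosida_sg n t) x - T t x)) \<longlonglongrightarrow> 0"
    by (rule Lim_null_comparison[OF always_eventually tendsto_norm_zero, rotated])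
      (use norm_app_yosida_sg[OF assms(1)] in blast)
  then have "(\<lambda>n. app (yosida_sg n s) (app (yosida_sg n t) x - T t x) + app (yosida_sg n s) (T t x)) \<longlonglongrightarrow> 0 + T s (T t x)"
    by (intro tendsto_add yosida_sg_tendsto_T T_in assms)
  then show "(\<lambda>n. app (yosida_sg n (s + t)) x) \<longlonglongrightarrow> T s (T t x)"
    by (simp add: app.diff_right yosida_sg_add)
qed

text \<open>An orbit through \<open>R w\<close> has speed at most \<open>norm w\<close>, and
  replacing \<open>x\<close> by \<open>R w\<close> costs their distance twice. The bound is uniform
  in \<open>n\<close>, hence survives the limit and gives strong continuity.\<close>

lemma yosida_sg_minus_id:
  assumes t: "0 \<le> t"
  shows "norm (app (yosida_sg n t) x - x) \<le> 2 * norm (x - R w) + t * norm w"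
proof -
  have "norm (app (yosida_sg n t) (R w) - R w - t *\<^sub>R 0) \<le> t * norm w"
  proof (rule yosida_sg_taylor[OF t])
    fix s :: real assume "0 \<le> s"
    have "norm (G n) \<le> 1"
    proof (cases "n = 0")
      case False
      then show ?thesis
        using norm_G[of n] \<alpha>_nonneg by (simp add: order_trans[OF norm_G])
    qed (simp add: G_eq norm_endo_bound)
    then have "norm (app (G n) w) \<le> norm w"
      using norm_app[of "G n" w] mult_right_mono[of "norm (G n)" 1 "norm w"] by simp
    then show "norm (app (yosida_sg n s) (app (yosida n) (R w)) - 0) \<le> norm w"
      using norm_app_yosida_sg[OF \<open>0 \<le> s\<close>, of n "app (G n) w"] by (simp add: yosida_R app.minus_right)
  qed
  then have "norm (app (yosida_sg n t) (R w) - R w) \<le> t * norm w" by simp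
  moreover have "norm (app (yosida_sg n t) (x - R w)) \<le> norm (x - R w)"
    by (rule norm_app_yosida_sg[OF t])
  moreover have "app (yosida_sg n t) x - x = (app (yosida_sg n t) (x - R w) - (x - R w)) + (app (yosida_sg n t) (R w) - R w)"
    by (simp add: app.diff_right)
  then have "norm (app (yosida_sg n t) x - x) \<le> norm (app (yosida_sg n t) (x - R w)) + norm (x - R w)
      + norm (app (yosida_sg n t) (R w) - R w)"
    by (simp only: order_trans[OF norm_triangle_ineq add_right_mono[OF norm_triangle_ineq4]])
  ultimately show ?thesis by linarith
qed

lemma T_minus_id:
  assumes "0 \<le> t" "x \<in> X"
  shows "norm (T t x - x) \<le> 2 * norm (x - R w) + t * norm w"
  by (rule Lim_norm_ubound[OF _ tendsto_diff[OF yosida_sg_tendsto_T[OF assms] tendsto_const]])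
    (auto intro!: always_eventually yosida_sg_minus_id assms)

text \<open>The velocity of an approximate orbit through \<open>R y\<close> differs from
  \<open>- y\<close> by two terms: the defect \<open>y - app (G n) y\<close>, which vanishes in the
  limit, and the displacement of \<open>y\<close> itself, which \<open>yosida_sg_minus_id\<close>
  controls.\<close>

lemma T_taylor:
  assumes t: "0 \<le> t" and y: "y \<in> X"
  shows "norm (T t (R y) - R y + t *\<^sub>R y) \<le> t * (2 * norm (y - R w) + t * norm w)"
proof (rule LIMSEQ_le)
  let ?c = "\<lambda>n. norm (y - app (G n) y) + (2 * norm (y - R w) + t * norm w)"
  show "(\<lambda>n. norm (app (yosida_sg n t) (R y) - R y + t *\<^sub>R y)) \<longlonglongrightarrow> norm (T t (R y) - R y + t *\<^sub>R y)"
    by (intro tendsto_intros yosida_sg_tendsto_T t R_in)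
  have "(\<lambda>n. t * ?c n) \<longlonglongrightarrow> t * (norm (y - y) + (2 * norm (y - R w) + t * norm w))"
    by (intro tendsto_intros G_tendsto y)
  then show "(\<lambda>n. t * ?c n) \<longlonglongrightarrow> t * (2 * norm (y - R w) + t * norm w)" by simp
  have "norm (app (yosida_sg n t) (R y) - R y - t *\<^sub>R (- y)) \<le> t * ?c n" for n
  proof (rule yosida_sg_taylor[OF t])
    fix s :: real assume s: "0 \<le> s" "s \<le> t"
    have "app (yosida_sg n s) (app (yosida n) (R y)) - (- y) = app (yosida_sg n s) (y - app (G n) y) - (app (yosida_sg n s) y - y)"
      by (simp add: yosida_R app.diff_right app.minus_right)
    then have "norm (app (yosida_sg n s) (app (yosida n) (R y)) - (- y))
        \<le> norm (app (yosida_sg n s) (y - app (G n) y)) + norm (app (yosida_sg n s) y - y)"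
      by (simp only: norm_triangle_ineq4)
    also have "\<dots> \<le> norm (y - app (G n) y) + (2 * norm (y - R w) + s * norm w)"
      by (intro add_mono norm_app_yosida_sg yosida_sg_minus_id s)
    also have "\<dots> \<le> ?c n"
      using s by (simp add: mult_right_mono)
    finally show "norm (app (yosida_sg n s) (app (yosida n) (R y)) - (- y)) \<le> ?c n" .
  qed
  then show "\<exists>N. \<forall>n\<ge>N. norm (app (yosida_sg n t) (R y) - R y + t *\<^sub>R y) \<le> t * ?c n" by simp
qed

section \<open>Strong continuity and identification of the generator\<close>

lemma C0_semigroup_T: "C0_semigroup X T"
  unfolding C0_semigroup_def bounded_operator_on_def
proof (intro conjI allI impI ballI)
  fix t :: real assume "0 \<le> t"
  then show "T t ` X \<subseteq> X" by (auto intro: T_in)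
  show "\<exists>K. \<forall>x\<in>X. norm (T t x) \<le> K * norm x"
    using norm_T_le[OF \<open>0 \<le> t\<close>] by (intro exI[of _ 1]) auto
next
  fix x assume x: "x \<in> X"
  show "((\<lambda>t. T t x) \<longlongrightarrow> x) (at_right 0)"
  proof (rule tendstoI)
    fix e :: real assume "0 < e"
    then obtain w where w: "norm (x - R w) < e / 4"
      using range_R_dense[OF x, of "e / 4"] by auto
    have "((\<lambda>t. t * norm w) \<longlongrightarrow> 0 * norm w) (at_right 0)"
      by (intro tendsto_intros)
    then have "\<forall>\<^sub>F t in at_right 0. t * norm w < e / 2"
      using \<open>0 < e\<close> by (intro order_tendstoD) auto
    then show "\<forall>\<^sub>F t in at_right 0. dist (T t x) x < e"
      using eventually_at_right_less
    proof eventually_elim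
      case (elim t)
      then show ?case
        using T_minus_id[of t x w] x w by (simp add: dist_norm)
    qed
  qed
qed (auto simp: T_0 T_plus T_scaleR T_add)

text \<open>One inclusion is the first-order expansion. For the other, a suitable known element of
  the graph is subtracted so that the difference \<open>w\<close> satisfies A w = w; dissipativity
  of a contraction semigroup forces \<open>w\<close> to vanish.\<close>

lemma generator_graph_T: "generator_graph X T = {(- R y, y) | y. y \<in> X}"
proof -
  have in_gen: "(- R y, y) \<in> generator_graph X T" if y: "y \<in> X" for y
  proof -
    have "((\<lambda>t. (T t (- R y) - (- R y)) /\<^sub>R t) \<longlongrightarrow> y) (at_right 0)"
    proof (rule tendstoI)
      fix e :: real assume "0 < e"
      then obtain w where w: "norm (y - R w) < e / 4"
        using range_R_dense[OF y, of "e / 4"] by auto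
      have "((\<lambda>t. t * norm w) \<longlongrightarrow> 0 * norm w) (at_right 0)"
        by (intro tendsto_intros)
      then have "\<forall>\<^sub>F t in at_right 0. t * norm w < e / 2"
        using \<open>0 < e\<close> by (intro order_tendstoD) auto
      then show "\<forall>\<^sub>F t in at_right 0. dist ((T t (- R y) - (- R y)) /\<^sub>R t) y < e"
        using eventually_at_right_less
      proof eventually_elim
        case (elim t)
        have "T t (- R y) = - T t (R y)"
          using T_scaleR[of t "R y" "-1"] elim R_in by simp
        then have "(T t (- R y) - (- R y)) /\<^sub>R t - y = (- inverse t) *\<^sub>R (T t (R y) - R y + t *\<^sub>R y)"
          using elim by (simp add: algebra_simps)
        then have "dist ((T t (- R y) - (- R y)) /\<^sub>R t) y = inverse t * norm (T t (R y) - R y + t *\<^sub>R y)"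
          using elim by (simp add: dist_norm)
        also have "\<dots> \<le> inverse t * (t * (2 * norm (y - R w) + t * norm w))"
          using elim y by (intro mult_left_mono T_taylor) auto
        also have "\<dots> = 2 * norm (y - R w) + t * norm w"
          using elim by simp
        finally show ?case using elim w by simp
      qed
    qed
    moreover have "- R y \<in> X"
      using R_in subspace_X subspace_neg by blast
    ultimately show ?thesis
      using y by (simp add: generator_graph_def)
  qed
  have "\<exists>z\<in>X. (x, y) = (- R z, z)" if xy: "(x, y) \<in> generator_graph X T" for x y
  proof -
    have x: "x \<in> X" and y: "y \<in> X" and lim: "((\<lambda>t. (T t x - x) /\<^sub>R t) \<longlongrightarrow> y) (at_right 0)"
      using xy by (auto simp: generator_graph_def)
    \<comment> \<open>\<open>z\<close> solves z + R z = y - x, so that x + R z and y - z are the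
      same vector \<open>w\<close>.\<close>
    define z where "z = app (B 1) (y - x)"
    have z: "z \<in> X" "z + R z = y - x"
      using B_eq[of 1 "y - x"] x y subspace_diff[OF subspace_X] by (auto simp: z_def intro: B_in)
    define w where "w = x - (- R z)"
    have w: "w \<in> X" "w = y - z"
      using x R_in[of z] subspace_X z(2) by (auto simp: w_def subspace_add algebra_simps)
    have "((\<lambda>t. (T t x - x) /\<^sub>R t - (T t (- R z) - (- R z)) /\<^sub>R t) \<longlongrightarrow> y - z) (at_right 0)"
      using in_gen[OF z(1)] by (intro tendsto_diff lim) (auto simp: generator_graph_def)
    moreover have "\<forall>\<^sub>F t in at_right 0. (T t x - x) /\<^sub>R t - (T t (- R z) - (- R z)) /\<^sub>R t = (T t w - w) /\<^sub>R t"
      using eventually_at_right_less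
    proof eventually_elim
      case (elim t)
      have "T t x = T t (w + (- R z))" by (simp add: w_def)
      also have "\<dots> = T t w + T t (- R z)"
        using elim w(1) R_in[of z] subspace_neg[OF subspace_X] by (intro T_plus) auto
      finally show ?case by (simp add: w_def algebra_simps)
    qed
    ultimately have "((\<lambda>t. (T t w - w) /\<^sub>R t) \<longlongrightarrow> w) (at_right 0)"
      by (simp add: tendsto_cong w(2)[symmetric])
    then have "((\<lambda>t. inner ((T t w - w) /\<^sub>R t) w) \<longlongrightarrow> inner w w) (at_right 0)"
      by (intro tendsto_intros)
    moreover have "\<forall>\<^sub>F t in at_right 0. inner ((T t w - w) /\<^sub>R t) w \<le> 0"
      using eventually_at_right_less
    proof eventually_elim
      case (elim t)
      have "inner (T t w) w \<le> norm (T t w) * norm w"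
        by (rule norm_cauchy_schwarz)
      also have "\<dots> \<le> norm w * norm w"
        using elim w(1) by (intro mult_right_mono norm_T_le) auto
      finally have "inner (T t w) w \<le> inner w w"
        by (simp add: dot_square_norm power2_eq_square)
      then show ?case
        using elim by (simp add: inner_diff mult_nonneg_nonpos)
    qed
    ultimately have "inner w w \<le> 0"
      by (rule tendsto_upperbound) simp
    then have "w = 0"
      by (metis inner_eq_zero_iff inner_ge_zero order_antisym)
    then show ?thesis
      using z(1) w(2) by (auto simp: w_def eq_neg_iff_add_eq_0)
  qed
  with in_gen show ?thesis by auto
qed

text \<open>Assumption \<open>R\<close> says, without inverses, that (l - A)^{-1} = R (I + l R)^{-1}
  maps the cone into itself. For l = n this passes to \<open>G n\<close>, and from there to the
  exponentials.\<close>

lemma T_preserves_cone: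
  assumes P: "closed P" "0 \<in> P" "\<And>x y. x \<in> P \<Longrightarrow> y \<in> P \<Longrightarrow> x + y \<in> P"
    "\<And>c x. 0 \<le> c \<Longrightarrow> x \<in> P \<Longrightarrow> c *\<^sub>R x \<in> P"
    and R: "\<And>l h. 0 < l \<Longrightarrow> h + l *\<^sub>R R h \<in> P \<Longrightarrow> R h \<in> P"
    and t: "0 \<le> t" and x: "x \<in> P" "x \<in> X"
  shows "T t x \<in> P"
proof (rule closed_sequentially[OF P(1) _ yosida_sg_tendsto_T[OF t x(2)]])
  fix n
  show "app (yosida_sg n t) x \<in> P"
    unfolding yosida_sg_eq
  proof (rule exp_preserves_cone[OF P])
    fix y assume "y \<in> P"
    show "app (G n) y \<in> P"
    proof (cases "n = 0")
      case False
      then have "R (app (B n) y) \<in> P"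
        using B_eq[of n y] \<open>y \<in> P\<close> by (intro R[of "real n"]) auto
      then show ?thesis by (simp add: G_eq P(4))
    qed (simp add: G_eq P(2))
  qed (use t x in auto)
qed

lemma growth_bound_T: "growth_bound X T \<le> ereal (- \<alpha>)"
  unfolding growth_bound_def
  by (rule Inf_lower) (use norm_T in \<open>auto intro!: exI[of _ 1]\<close>)

end

section \<open>Integrals of square integrable functions\<close>

lemma integral_cong_AE_lborel:
  fixes f g :: "real \<Rightarrow> real"
  assumes "AE z in lborel. z \<in> S \<longrightarrow> f z = g z"
  shows "integral S f = integral S g"
proof -
  obtain N where N: "N \<in> null_sets lborel" "{z. \<not> (z \<in> S \<longrightarrow> f z = g z)} \<subseteq> N"
    using assms by (auto elim!: AE_E2 simp: eventually_ae_filter)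
  then have "negligible N"
    using null_sets_completionI negligible_iff_null_sets by blast
  then show ?thesis
    by (rule integral_spike) (use N(2) in auto)
qed

lemma square_integrable_indicator_interval: "square_integrable (indicator {a..b :: real})"
  by (auto simp: square_integrable_def power2_eq_square integrable_indicator_iff emeasure_lborel_Icc_eq
      simp flip: indicator_inter_arith)

lemma square_integrable_imp_set_integrable:
  assumes "square_integrable f"
  shows "set_integrable lborel {a..b} f"
  using square_integrable_mult[OF square_integrable_indicator_interval assms]
  by (simp add: set_integrable_def)

lemma square_integrable_integrable_on: "square_integrable f \<Longrightarrow> f integrable_on {a..b}"
  by (intro set_borel_integral_eq_integral(1) square_integrable_imp_set_integrable)

text \<open>Weak derivatives are stated with Lebesgue integrals over the open interval; gauge
  integrals over the closed one make the fundamental theorem of calculus available.\<close>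

lemma set_lebesgue_integral_open_interval:
  fixes f :: "real \<Rightarrow> real"
  assumes "set_integrable lborel {a..b} f"
  shows "(LINT z:{a<..<b}|lborel. f z) = integral {a..b} f"
proof -
  have "set_integrable lborel {a<..<b} f"
    by (rule set_integrable_subset[OF assms]) auto
  then show ?thesis
    by (simp add: set_borel_integral_eq_integral integral_open_interval_real)
qed

text \<open>The positive and negative parts of \<open>f\<close> are densities of two finite measures
  that agree on half-lines. The measures therefore coincide, and so do their densities almost
  everywhere.\<close>

lemma AE_zero_of_integrals_zero:
  fixes f :: "real \<Rightarrow> real"
  assumes f: "integrable lborel f" and zero: "\<And>x. (LINT z:{x<..}|lborel. f z) = 0"
  shows "AE z in lborel. f z = 0"
proof -
  define M where "M s = density lborel (\<lambda>z. ennreal (max 0 (s * f z)))" for s :: real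
  have [measurable]: "f \<in> borel_measurable lborel" using f by simp
  have int: "integrable lborel (\<lambda>z. max 0 (s * f z))" for s
    using f by (intro integrable_max) auto
  have em: "emeasure (M s) {x<..} = ennreal (LINT z:{x<..}|lborel. max 0 (s * f z))" for s x
  proof -
    have "emeasure (M s) {x<..} = (\<integral>\<^sup>+ z. ennreal (indicator {x<..} z * max 0 (s * f z)) \<partial>lborel)"
      unfolding M_def by (subst emeasure_density) (auto intro!: nn_integral_cong simp: indicator_def)
    also have "\<dots> = ennreal (LINT z|lborel. indicator {x<..} z * max 0 (s * f z))"
      using integrable_mult_indicator[OF _ int[of s], of "{x<..}"]
      by (intro nn_integral_eq_integral) auto
    finally show ?thesis by (simp add: set_lebesgue_integral_def)
  qed
  have "M 1 = M (-1)"
  proof (rule measure_eqI_lessThan)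
    fix x
    show "emeasure (M 1) {x<..} < \<infinity>" by (simp add: em)
    have "(LINT z:{x<..}|lborel. max 0 (1 * f z)) - (LINT z:{x<..}|lborel. max 0 (-1 * f z))
        = (LINT z:{x<..}|lborel. max 0 (1 * f z) - max 0 (-1 * f z))"
      using integrable_mult_indicator[OF _ int[of 1], of "{x<..}"] integrable_mult_indicator[OF _ int[of "-1"], of "{x<..}"]
      by (intro set_integral_diff(2)[symmetric]) (simp_all add: set_integrable_def)
    also have "\<dots> = (LINT z:{x<..}|lborel. f z)"
      by (rule set_lebesgue_integral_cong) (simp_all add: max_def)
    finally show "emeasure (M 1) {x<..} = emeasure (M (-1)) {x<..}"
      using zero[of x] by (simp add: em)
  qed (simp_all add: M_def)
  then have "AE z in lborel. ennreal (max 0 (1 * f z)) = ennreal (max 0 (-1 * f z))"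
    unfolding M_def by (intro sigma_finite_measure.density_unique[OF sigma_finite_lborel]) auto
  then show ?thesis
  proof eventually_elim
    case (elim z)
    then have "max 0 (f z) = max 0 (- f z)" by (simp add: ennreal_inj)
    then show ?case by (simp add: max_def split: if_splits)
  qed
qed

text \<open>Continuity of indefinite integrals extends the hypothesis to intervals that touch 0 or
  \<open>L\<close>. The two ends are moved separately, starting from the midpoint
  \<open>m\<close>.\<close>

lemma AE_zero_of_interval_integrals_zero:
  assumes f: "square_integrable f"
    and zero: "\<And>a b. 0 < a \<Longrightarrow> a < b \<Longrightarrow> b < L \<Longrightarrow> integral {a..b} f = 0"
  shows "AE z in lborel. z \<in> {0<..<L} \<longrightarrow> f z = 0"
proof (cases "0 < L")
  case True
  define g where "g z = indicator {0..L} z * f z" for z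
  have int: "integral {x..L} f = 0" if x: "0 \<le> x" "x < L" for x
  proof -
    define m where "m = (x + L) / 2"
    have m: "x < m" "m < L" using x by (auto simp: m_def)
    have eq: "integral {a..b} f = 0" if "x < a" "a < b" "b < L" for a b
      using zero[of a b] that x by auto
    have c: "continuous_on {m..L} (\<lambda>b. integral {m..b} f)"
      by (intro indefinite_integral_continuous_1 square_integrable_integrable_on f)
    have "integral {m..L} f = 0"
    proof (rule continuous_constant_on_closure[of "{m<..<L}" "\<lambda>b. integral {m..b} f"])
      show "continuous_on (closure {m<..<L}) (\<lambda>b. integral {m..b} f)"
        using c m by simp
    qed (use m eq in auto)
    moreover have c: "continuous_on {x..m} (\<lambda>a. integral {a..m} f)"
      by (intro indefinite_integral_continuous_1' square_integrable_integrable_on f)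
    have "integral {x..m} f = 0"
    proof (rule continuous_constant_on_closure[of "{x<..<m}" "\<lambda>a. integral {a..m} f"])
      show "continuous_on (closure {x<..<m}) (\<lambda>a. integral {a..m} f)"
        using c m by simp
    qed (use m eq in auto)
    ultimately show ?thesis
      using Henstock_Kurzweil_Integration.integral_combine[OF _ _ square_integrable_integrable_on[OF f], of x m L] m by simp
  qed
  have gi: "integrable lborel g"
    using square_integrable_imp_set_integrable[OF f, of 0 L] by (simp add: g_def[abs_def] set_integrable_def)
  have "(LINT z:{x<..}|lborel. g z) = 0" for x
  proof -
    have "(LINT z:{x<..}|lborel. g z) = (LINT z:{x<..} \<inter> {0..L}|lborel. f z)"
      unfolding set_lebesgue_integral_def g_def by (intro Bochner_Integration.integral_cong) (auto simp: indicator_def)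
    also have "\<dots> = integral ({x<..} \<inter> {0..L}) f"
      by (intro set_borel_integral_eq_integral set_integrable_subset[OF square_integrable_imp_set_integrable[OF f, of 0 L]]) auto
    also have "\<dots> = integral {max x 0..L} f"
      by (rule integral_spike_set; rule negligible_subset[of "{x}"]) auto
    also have "\<dots> = 0"
      using int[of "max x 0"] by (cases "max x 0" L rule: linorder_cases) (simp_all add: integral_null)
    finally show ?thesis .
  qed
  from AE_zero_of_integrals_zero[OF gi this] show ?thesis
    by eventually_elim (auto simp: g_def indicator_def split: if_splits)
qed simp

text \<open>The set of disagreement inside the interval is open and negligible, hence empty; the
  endpoints follow by closure.\<close>

lemma continuous_AE_eq_imp_eq:
  fixes f g :: "real \<Rightarrow> real"
  assumes f: "continuous_on {a..b} f" and g: "continuous_on {a..b} g" and "a < b"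
    and ae: "AE z in lborel. z \<in> {a<..<b} \<longrightarrow> f z = g z" and z: "z \<in> {a..b}"
  shows "f z = g z"
proof -
  define U where "U = {z \<in> {a<..<b}. f z - g z \<noteq> 0}"
  have "continuous_on {a<..<b} (\<lambda>z. f z - g z)"
    by (intro continuous_intros continuous_on_subset[OF f] continuous_on_subset[OF g]) auto
  then have "open U"
    unfolding U_def using continuous_open_preimage[of "{a<..<b}" "\<lambda>z. f z - g z" "- {0}"]
    by (simp add: vimage_def Int_def open_Compl)
  moreover have "negligible U"
  proof -
    obtain N where N: "N \<in> null_sets lborel" "{z. \<not> (z \<in> {a<..<b} \<longrightarrow> f z = g z)} \<subseteq> N"
      using ae by (auto simp: eventually_ae_filter)
    have "negligible N"
      using N(1) null_sets_completionI negligible_iff_null_sets by blast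
    then show ?thesis
      by (rule negligible_subset) (use N(2) in \<open>auto simp: U_def\<close>)
  qed
  ultimately have "U = {}"
    using open_not_negligible by blast
  then have "f z - g z = 0" if "z \<in> {a<..<b}" for z
    using that by (auto simp: U_def)
  moreover have "continuous_on (closure {a<..<b}) (\<lambda>z. f z - g z)"
    using \<open>a < b\<close> by (auto intro!: continuous_intros f g)
  moreover have "z \<in> closure {a<..<b}"
    using z \<open>a < b\<close> by simp
  ultimately have "f z - g z = 0"
    by (intro continuous_constant_on_closure[of "{a<..<b}" "\<lambda>z. f z - g z" 0 z])
  then show ?thesis by simp
qed

text \<open>Fubini on the triangle 0 \<le> s \<le> z \<le> L. It replaces integration by parts when
  the functions are merely square integrable.\<close>

lemma integral_triangle_swap:
  assumes f: "square_integrable f" and k: "square_integrable k"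
  shows "integral {0..L} (\<lambda>z. f z * integral {0..z} k) = integral {0..L} (\<lambda>s. k s * integral {s..L} f)"
proof -
  have [measurable]: "f \<in> borel_measurable borel" "k \<in> borel_measurable borel"
    using f k by (auto simp: square_integrable_def)
  define F where "F z = indicator {0..L} z * f z" for z
  define K where "K z = indicator {0..L} z * k z" for z
  have F: "integrable lborel F" and K: "integrable lborel K"
    using square_integrable_imp_set_integrable[OF f] square_integrable_imp_set_integrable[OF k]
    by (simp_all add: set_integrable_def F_def[abs_def] K_def[abs_def])
  have [measurable]: "F \<in> borel_measurable borel" "K \<in> borel_measurable borel"
    using F K by auto
  define H where "H = (\<lambda>(z, s). if s \<le> z then F z * K s else (0 :: real))"
  have "integrable (lborel \<Otimes>\<^sub>M lborel) (\<lambda>(z, s). F z * K s)"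
  proof (rule lborel_pair.Fubini_integrable)
    show "integrable lborel (\<lambda>x. LINT y|lborel. norm (case (x, y) of (z, s) \<Rightarrow> F z * K s))"
      using F K by (simp add: abs_mult)
  qed (use K in auto)
  then have H: "integrable (lborel \<Otimes>\<^sub>M lborel) H"
    by (rule Bochner_Integration.integrable_bound) (auto simp: H_def)
  have swap: "(LINT z|lborel. LINT s|lborel. H (z, s)) = (LINT s|lborel. LINT z|lborel. H (z, s))"
    using lborel_pair.Fubini_integral[of "\<lambda>z s. H (z, s)"] H by simp
  have 1: "(LINT s|lborel. H (z, s)) = indicator {0..L} z * (f z * integral {0..z} k)" for z
  proof -
    have "(LINT s|lborel. H (z, s)) = F z * (LINT s:{0..z}|lborel. k s)"
      unfolding set_lebesgue_integral_def integral_mult_right_zero[symmetric]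
      by (intro Bochner_Integration.integral_cong) (auto simp: H_def F_def K_def indicator_def)
    then show ?thesis
      using square_integrable_imp_set_integrable[OF k, of 0 z]
      by (simp add: set_borel_integral_eq_integral F_def)
  qed
  have 2: "(LINT z|lborel. H (z, s)) = indicator {0..L} s * (k s * integral {s..L} f)" for s
  proof -
    have "(LINT z|lborel. H (z, s)) = K s * (LINT z:{s..L}|lborel. f z)"
      unfolding set_lebesgue_integral_def integral_mult_right_zero[symmetric]
      by (intro Bochner_Integration.integral_cong) (auto simp: H_def F_def K_def indicator_def)
    then show ?thesis
      using square_integrable_imp_set_integrable[OF f, of s L]
      by (simp add: set_borel_integral_eq_integral K_def)
  qed
  have "set_integrable lborel {0..L} (\<lambda>z. f z * integral {0..z} k)"
    using lborel_pair.integrable_fst'[OF H] by (simp add: set_integrable_def 1)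
  moreover have "set_integrable lborel {0..L} (\<lambda>s. k s * integral {s..L} f)"
    using lborel_pair.integrable_snd[of "\<lambda>z s. H (z, s)"] H by (simp add: set_integrable_def 2)
  ultimately show ?thesis
    using swap by (simp add: set_borel_integral_eq_integral(2)[symmetric] 1 2 set_lebesgue_integral_def)
qed

section \<open>Weak derivatives and primitives\<close>

lemma square_integrable_indicator_continuous:
  assumes "continuous_on {0..L} g"
  shows "square_integrable (\<lambda>z. indicator {0..L} z * g z)"
proof -
  have "set_integrable lborel {0..L} (\<lambda>z. (g z)\<^sup>2)"
    by (intro borel_integrable_atLeastAtMost' continuous_intros assms)
  moreover have "(\<lambda>z. indicator {0..L} z * g z) \<in> borel_measurable borel"
    using borel_measurable_continuous_on_indicator[OF _ assms] by simp
  ultimately show ?thesis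
    by (simp add: square_integrable_def set_integrable_def power_mult_distrib power2_eq_square[of "indicator _ _"]
        flip: indicator_inter_arith)
qed

lemma set_integrable_mult_continuous:
  assumes "square_integrable f" "continuous_on {0..L} g"
  shows "set_integrable lborel {0..L} (\<lambda>z. f z * g z)"
  using square_integrable_mult[OF assms(1) square_integrable_indicator_continuous[OF assms(2)]]
  by (simp add: set_integrable_def mult.left_commute)

definition emb :: "real \<Rightarrow> (real \<Rightarrow> real) \<Rightarrow> L2" where
  "emb L g = abs_L2 (\<lambda>z. indicator {0..L} z * g z)"

lemma rep_emb:
  "continuous_on {0..L} g \<Longrightarrow> AE z in lborel. rep_L2 (emb L g) z = indicator {0..L} z * g z"
  unfolding emb_def by (intro rep_abs_L2 square_integrable_indicator_continuous)

lemma emb_in: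
  assumes "continuous_on {0..L} g"
  shows "emb L g \<in> L2_on L"
  unfolding L2_on_def mem_Collect_eq
  using rep_emb[OF assms] AE_lborel_singleton[of 0] AE_lborel_singleton[of L]
  by eventually_elim (auto simp: indicator_def)

lemma continuous_rep_emb: "continuous_on {0..L} g \<Longrightarrow> continuous_rep L (emb L g) g"
  unfolding continuous_rep_def using rep_emb[of L g]
  by (auto elim!: eventually_mono)

lemma L2_eqI:
  assumes "AE z in lborel. rep_L2 x z = rep_L2 y z"
  shows "x = y"
proof -
  have "L2_eq (rep_L2 x) (rep_L2 y)"
    using assms by (simp add: L2_eq_def square_integrable_rep_L2)
  then show ?thesis
    using Quotient3_rel_abs[OF Quotient3_L2] abs_rep_L2 by metis
qed

lemma L2_on_eqI:
  assumes "x \<in> L2_on L" "y \<in> L2_on L" "AE z in lborel. z \<in> {0<..<L} \<longrightarrow> rep_L2 x z = rep_L2 y z"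
  shows "x = y"
  using assms unfolding L2_on_def mem_Collect_eq
  by (intro L2_eqI) (auto elim: AE_mp)

lemma L2_on_eq_emb:
  assumes "x \<in> L2_on L" "continuous_rep L x g"
  shows "x = emb L g"
proof -
  have g: "continuous_on {0..L} g" using assms(2) by (simp add: continuous_rep_def)
  show ?thesis
    using assms(2) continuous_rep_emb[OF g] unfolding continuous_rep_def
    by (intro L2_on_eqI[OF assms(1) emb_in[OF g]]) (auto elim: AE_mp)
qed

lemma continuous_on_primitive:
  "continuous_on {0..L} (\<lambda>z. integral {0..z} (rep_L2 x))"
  by (intro indefinite_integral_continuous_1 square_integrable_integrable_on square_integrable_rep_L2)

lemma test_function_FTC:
  assumes "test_function L \<phi>" "a \<le> b"
  shows "(deriv \<phi> has_integral \<phi> b - \<phi> a) {a..b}"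
proof (rule fundamental_theorem_of_calculus[OF assms(2)])
  fix z
  have "(\<phi> has_real_derivative deriv \<phi> z) (at z)"
    using assms(1) by (simp add: test_function_def DERIV_deriv_iff_real_differentiable)
  then show "(\<phi> has_vector_derivative deriv \<phi> z) (at z within {a..b})"
    by (simp add: has_real_derivative_iff_has_vector_derivative has_vector_derivative_at_within)
qed

lemma test_function_boundary: "test_function L \<phi> \<Longrightarrow> z \<notin> {0<..<L} \<Longrightarrow> \<phi> z = 0"
  by (auto simp: test_function_def)

lemma test_function_continuous:
  assumes "test_function L \<phi>"
  shows "continuous_on S \<phi>" "continuous_on S (deriv \<phi>)"
proof -
  show "continuous_on S \<phi>"
    using assms by (intro continuous_at_imp_continuous_on)
      (simp add: test_function_def differentiable_imp_continuous_within)
  show "continuous_on S (deriv \<phi>)"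
    using assms by (auto simp: test_function_def intro: continuous_on_subset)
qed

lemma has_weak_deriv_iff:
  "has_weak_deriv L x y \<longleftrightarrow> x \<in> L2_on L \<and> y \<in> L2_on L \<and>
     (\<forall>\<phi>. test_function L \<phi> \<longrightarrow> integral {0..L} (\<lambda>z. rep_L2 x z * deriv \<phi> z)
        = - integral {0..L} (\<lambda>z. rep_L2 y z * \<phi> z))"
proof -
  have "(LINT z:{0<..<L}|lborel. rep_L2 x z * deriv \<phi> z) = integral {0..L} (\<lambda>z. rep_L2 x z * deriv \<phi> z)"
    "(LINT z:{0<..<L}|lborel. rep_L2 y z * \<phi> z) = integral {0..L} (\<lambda>z. rep_L2 y z * \<phi> z)"
    if "test_function L \<phi>" for \<phi>
    by (intro set_lebesgue_integral_open_interval set_integrable_mult_continuous square_integrable_rep_L2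
        test_function_continuous[OF that])+
  then show ?thesis
    unfolding has_weak_deriv_def by auto
qed

lemma integral_primitive_mult_deriv:
  assumes \<phi>: "test_function L \<phi>" and f: "square_integrable f" and "0 \<le> L"
  shows "integral {0..L} (\<lambda>z. integral {0..z} f * deriv \<phi> z) = - integral {0..L} (\<lambda>z. f z * \<phi> z)"
proof -
  define \<psi> where "\<psi> z = indicator {0..L} z * deriv \<phi> z" for z
  have "integral {0..L} (\<lambda>z. integral {0..z} f * deriv \<phi> z) = integral {0..L} (\<lambda>z. \<psi> z * integral {0..z} f)"
    by (intro integral_cong) (simp add: \<psi>_def)
  also have "\<dots> = integral {0..L} (\<lambda>s. f s * integral {s..L} \<psi>)"
    unfolding \<psi>_def
    by (intro integral_triangle_swap square_integrable_indicator_continuous test_function_continuous[OF \<phi>] f)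
  also have "\<dots> = integral {0..L} (\<lambda>s. - (f s * \<phi> s))"
  proof (rule integral_cong)
    fix s assume s: "s \<in> {0..L}"
    have "integral {s..L} \<psi> = integral {s..L} (deriv \<phi>)"
      using s by (intro integral_cong) (simp add: \<psi>_def)
    also have "\<dots> = \<phi> L - \<phi> s"
      using test_function_FTC[OF \<phi>, of s L] s by (simp add: integral_unique)
    finally show "f s * integral {s..L} \<psi> = - (f s * \<phi> s)"
      using test_function_boundary[OF \<phi>, of L] by simp
  qed
  finally show ?thesis by simp
qed

lemma has_weak_derivI:
  assumes x: "x \<in> L2_on L" and y: "y \<in> L2_on L" and L: "0 \<le> L"
    and eq: "continuous_rep L x (\<lambda>z. c + integral {0..z} (rep_L2 y))"
  shows "has_weak_deriv L x y"
  unfolding has_weak_deriv_iff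
proof (intro conjI x y allI impI)
  fix \<phi> assume \<phi>: "test_function L \<phi>"
  have "integral {0..L} (\<lambda>z. rep_L2 x z * deriv \<phi> z)
      = integral {0..L} (\<lambda>z. (c + integral {0..z} (rep_L2 y)) * deriv \<phi> z)"
  proof (rule integral_cong_AE_lborel)
    show "AE z in lborel. z \<in> {0..L} \<longrightarrow> rep_L2 x z * deriv \<phi> z = (c + integral {0..z} (rep_L2 y)) * deriv \<phi> z"
      using conjunct2[OF eq[unfolded continuous_rep_def]] AE_lborel_singleton[of 0] AE_lborel_singleton[of L]
      by eventually_elim auto
  qed
  also have "\<dots> = c * integral {0..L} (deriv \<phi>) + integral {0..L} (\<lambda>z. integral {0..z} (rep_L2 y) * deriv \<phi> z)"
    unfolding distrib_right
    by (subst Henstock_Kurzweil_Integration.integral_add)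
      (auto intro!: integrable_continuous_real continuous_intros continuous_on_primitive
        test_function_continuous[OF \<phi>])
  also have "integral {0..L} (deriv \<phi>) = 0"
    using test_function_FTC[OF \<phi> L] test_function_boundary[OF \<phi>] by (simp add: integral_unique)
  finally show "integral {0..L} (\<lambda>z. rep_L2 x z * deriv \<phi> z) = - integral {0..L} (\<lambda>z. rep_L2 y z * \<phi> z)"
    by (simp add: integral_primitive_mult_deriv[OF \<phi> square_integrable_rep_L2 L])
qed

section \<open>The lemma of du Bois-Reymond\<close>

lemma zero_mean_test_function:
  fixes \<psi> :: "real \<Rightarrow> real"
  assumes \<psi>: "continuous_on UNIV \<psi>" and K: "0 < a" "a \<le> b" "b < L"
    and supp: "\<And>z. z \<notin> {a..b} \<Longrightarrow> \<psi> z = 0" and mean: "integral {0..L} \<psi> = 0"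
  obtains \<phi> where "test_function L \<phi>" "deriv \<phi> = \<psi>"
proof -
  obtain F where "\<And>x. (F has_vector_derivative \<psi> x) (at x)"
    using einterval_antiderivative[of "- \<infinity>" "\<infinity>" \<psi>] \<psi> by (auto simp: continuous_on_eq_continuous_at)
  then have F: "(F has_real_derivative \<psi> x) (at x)" for x
    by (simp add: has_real_derivative_iff_has_vector_derivative)
  have FTC: "integral {u..v} \<psi> = F v - F u" if "u \<le> v" for u v
    using F that by (intro integral_unique fundamental_theorem_of_calculus)
      (auto simp: has_real_derivative_iff_has_vector_derivative intro: has_vector_derivative_at_within)
  have flat: "F u = F v" if "u \<le> v" "v \<le> a \<or> b \<le> u" for u v
  proof -
    have "integral {u..v} \<psi> = integral {u<..<v} \<psi>"
      by (simp add: integral_open_interval_real)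
    also have "\<dots> = integral {u<..<v} (\<lambda>_. 0)"
      by (intro integral_cong supp) (use that(2) in auto)
    finally show ?thesis using FTC[OF that(1)] by simp
  qed
  \<comment> \<open>An antiderivative is constant on either side of the support. Normalizing at 0
    makes it vanish on the left, and the zero mean makes it vanish on the right.\<close>
  define \<phi> where "\<phi> z = F z - F 0" for z
  have \<phi>: "(\<phi> has_real_derivative \<psi> x) (at x)" for x
    unfolding \<phi>_def using F[of x] by (auto intro!: derivative_eq_intros)
  have deriv: "deriv \<phi> = \<psi>"
    using \<phi> by (auto intro: DERIV_imp_deriv)
  have "\<phi> z = 0" if "z \<notin> {a..b}" for z
  proof (cases "z < a")
    case True
    with K have "F (min 0 z) = F (max 0 z)"
      by (intro flat) auto
    then show ?thesis
      by (auto simp: \<phi>_def min_def max_def split: if_splits)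
  next
    case False
    with K that have "F (min z L) = F (max z L)"
      by (intro flat) auto
    then have "F z = F L"
      by (auto simp: min_def max_def split: if_splits)
    then show ?thesis
      using FTC[of 0 L] mean K by (simp add: \<phi>_def)
  qed
  then have "test_function L \<phi>"
    unfolding test_function_def deriv using \<phi> \<psi> K
    by (auto simp: real_differentiable_def intro!: exI[of _ "{a..b}"])
  with deriv show ?thesis by (rule that[rotated])
qed

text \<open>A trapezoid with slopes \<open>n\<close> and \<open>- n\<close>, or a triangle for small
  \<open>n\<close>. Continuity suffices here because tents enter as derivatives of test functions,
  which have to be continuous only.\<close>

definition tent :: "real \<Rightarrow> real \<Rightarrow> nat \<Rightarrow> real \<Rightarrow> real" where
  "tent a b n z = min 1 (real n * max 0 (min (z - a) (b - z)))"

lemma tent_bounds: "0 \<le> tent a b n z" "tent a b n z \<le> 1"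
  by (auto simp: tent_def)

lemma tent_outside: "z \<notin> {a<..<b} \<Longrightarrow> tent a b n z = 0"
proof -
  assume "z \<notin> {a<..<b}"
  then have "max 0 (min (z - a) (b - z)) = 0" by auto
  then show ?thesis by (simp add: tent_def)
qed

lemma continuous_tent: "continuous_on S (tent a b n)"
  unfolding tent_def by (intro continuous_intros)

lemma tent_tendsto: "(\<lambda>n. tent a b n z) \<longlonglongrightarrow> indicator {a<..<b} z"
proof (cases "z \<in> {a<..<b}")
  case True
  define d where "d = min (z - a) (b - z)"
  have d: "0 < d" using True by (auto simp: d_def)
  have "\<forall>\<^sub>F n in sequentially. 1 / d \<le> real n"
    by (rule eventually_compose_filterlim[OF eventually_ge_at_top filterlim_real_sequentially])
  then have "\<forall>\<^sub>F n in sequentially. tent a b n z = 1"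
    by eventually_elim (use d in \<open>simp add: tent_def d_def[symmetric] field_simps\<close>)
  with True show ?thesis by (simp add: tendsto_eventually)
qed (simp add: tent_outside)

lemma integral_mult_tent_tendsto:
  assumes h: "set_integrable lborel {0..L} h" and ab: "0 \<le> a" "b \<le> L"
  shows "(\<lambda>n. integral {0..L} (\<lambda>z. h z * tent a b n z)) \<longlonglongrightarrow> integral {a..b} h"
proof -
  have "(\<lambda>n. integral {0..L} (\<lambda>z. h z * tent a b n z)) \<longlonglongrightarrow> integral {0..L} (\<lambda>z. h z * indicator {a<..<b} z)"
  proof (rule dominated_convergence(2)[where h = "\<lambda>z. \<bar>h z\<bar>"])
    fix n
    have "set_integrable lborel {0..L} (\<lambda>z. tent a b n z * h z)"
    proof (rule set_integrable_bound[OF h])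
      show "set_borel_measurable lborel {0..L} (\<lambda>z. tent a b n z * h z)"
      proof -
        have "(\<lambda>z. tent a b n z * (indicator {0..L} z * h z)) \<in> borel_measurable lborel"
        proof (rule borel_measurable_times)
          show "tent a b n \<in> borel_measurable lborel"
            using borel_measurable_continuous_onI[OF continuous_tent] by simp
          show "(\<lambda>z. indicator {0..L} z * h z) \<in> borel_measurable lborel"
            using borel_measurable_integrable[OF h[unfolded set_integrable_def]] by simp
        qed
        then show ?thesis by (simp add: set_borel_measurable_def mult.left_commute)
      qed
      show "AE z in lborel. z \<in> {0..L} \<longrightarrow> norm (tent a b n z * h z) \<le> norm (h z)"
        using tent_bounds[of a b n] by (auto simp: abs_mult intro!: mult_left_le_one_le)
    qed
    then show "(\<lambda>z. h z * tent a b n z) integrable_on {0..L}"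
      using set_borel_integral_eq_integral(1) by (simp add: mult.commute)
    show "norm (h z * tent a b n z) \<le> \<bar>h z\<bar>" for z
      using tent_bounds[of a b n z] by (auto simp: abs_mult intro!: mult_right_le_one_le)
  next
    show "(\<lambda>z. \<bar>h z\<bar>) integrable_on {0..L}"
      using set_borel_integral_eq_integral(1)[OF set_integrable_abs[OF h]] by simp
  qed (intro tendsto_intros tent_tendsto)
  also have "integral {0..L} (\<lambda>z. h z * indicator {a<..<b} z) = integral {0..L} (\<lambda>z. if z \<in> {a<..<b} then h z else 0)"
    by (intro integral_cong) (simp add: indicator_def)
  also have "\<dots> = integral {a<..<b} h"
    using ab by (subst integral_restrict_Int) (auto intro: arg_cong2[where f = integral])
  finally show ?thesis by (simp add: integral_open_interval_real)
qed

text \<open>Testing shows that the mean of \<open>h\<close> over any compact subinterval equals its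
  mean over the middle third of the interval, a fixed reference lying away from both ends. This
  common mean is the constant.\<close>

lemma du_Bois_Reymond:
  assumes h: "square_integrable h" and L: "0 < L"
    and test: "\<And>\<phi>. test_function L \<phi> \<Longrightarrow> integral {0..L} (\<lambda>z. h z * deriv \<phi> z) = 0"
  obtains c where "AE z in lborel. z \<in> {0<..<L} \<longrightarrow> h z = c"
proof -
  have hint: "set_integrable lborel {0..L} h"
    by (rule square_integrable_imp_set_integrable[OF h])
  have one: "set_integrable lborel {0..L} (\<lambda>_. 1 :: real)"
    by (intro borel_integrable_atLeastAtMost') auto
  let ?t1 = "tent (L/3) (2*L/3)"
  have key: "(L/3) * integral {a..b} h = (b - a) * integral {L/3..2*L/3} h" if ab: "0 < a" "a < b" "b < L" for a b
  proof -
    let ?t2 = "tent a b"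
    have eq: "integral {0..L} (?t1 n) * integral {0..L} (\<lambda>z. h z * ?t2 n z)
        = integral {0..L} (?t2 n) * integral {0..L} (\<lambda>z. h z * ?t1 n z)" for n
    proof -
      define m1 m2 where "m1 = integral {0..L} (?t1 n)" and "m2 = integral {0..L} (?t2 n)"
      \<comment> \<open>Each tent is weighted with the mass of the other, so \<open>\<psi>\<close>
        has mean zero and is the derivative of a test function.\<close>
      define \<psi> where "\<psi> z = m1 * ?t2 n z - m2 * ?t1 n z" for z
      have hm: "(\<lambda>z. h z * tent a' b' n z) integrable_on {0..L}" for a' b'
        by (intro set_borel_integral_eq_integral(1) set_integrable_mult_continuous h continuous_tent)
      have tm: "tent a' b' n integrable_on {0..L}" for a' b'
        by (intro integrable_continuous_real continuous_tent)
      have "integral {0..L} \<psi> = m1 * m2 - m2 * m1"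
        unfolding \<psi>_def by (subst Henstock_Kurzweil_Integration.integral_diff)
          (auto simp: m1_def m2_def intro!: integrable_on_mult_right tm)
      then have mean: "integral {0..L} \<psi> = 0" by simp
      obtain \<phi> where \<phi>: "test_function L \<phi>" "deriv \<phi> = \<psi>"
      proof (rule zero_mean_test_function[of \<psi> "min a (L/3)" "max b (2*L/3)" L, OF _ _ _ _ _ mean])
        show "continuous_on UNIV \<psi>"
          unfolding \<psi>_def by (intro continuous_intros continuous_tent)
        show "\<psi> z = 0" if "z \<notin> {min a (L/3)..max b (2*L/3)}" for z
          unfolding \<psi>_def using that
          by (subst (1 2) tent_outside) (auto simp: min_def max_def split: if_splits)
      qed (use ab L in \<open>auto simp: min_def max_def\<close>)
      have "0 = integral {0..L} (\<lambda>z. m1 * (h z * ?t2 n z) - m2 * (h z * ?t1 n z))"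
        using test[OF \<phi>(1)] by (simp add: \<phi>(2) \<psi>_def algebra_simps)
      also have "\<dots> = m1 * integral {0..L} (\<lambda>z. h z * ?t2 n z) - m2 * integral {0..L} (\<lambda>z. h z * ?t1 n z)"
        by (subst Henstock_Kurzweil_Integration.integral_diff) (auto intro!: integrable_on_mult_right hm)
      finally show ?thesis by (simp add: m1_def m2_def)
    qed
    have lim: "(\<lambda>n. integral {0..L} (?t1 n) * integral {0..L} (\<lambda>z. h z * ?t2 n z))
        \<longlonglongrightarrow> integral {L/3..2*L/3} (\<lambda>_. 1) * integral {a..b} h"
      using integral_mult_tent_tendsto[OF one, of "L/3" "2*L/3"] integral_mult_tent_tendsto[OF hint, of a b] ab L
      by (intro tendsto_mult) auto
    have "(\<lambda>n. integral {0..L} (?t2 n) * integral {0..L} (\<lambda>z. h z * ?t1 n z))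
        \<longlonglongrightarrow> integral {a..b} (\<lambda>_. 1) * integral {L/3..2*L/3} h"
      using integral_mult_tent_tendsto[OF one, of a b] integral_mult_tent_tendsto[OF hint, of "L/3" "2*L/3"] ab L
      by (intro tendsto_mult) auto
    from LIMSEQ_unique[OF lim[unfolded eq] this] have "integral {L/3..2*L/3} (\<lambda>_. 1) * integral {a..b} h = integral {a..b} (\<lambda>_. 1) * integral {L/3..2*L/3} h"
      .
    then show ?thesis using ab L by simp
  qed
  define c where "c = integral {L/3..2*L/3} h / (L/3)"
  have "AE z in lborel. z \<in> {0<..<L} \<longrightarrow> h z - indicator {0..L} z * c = 0"
  proof (rule AE_zero_of_interval_integrals_zero)
    show "square_integrable (\<lambda>z. h z - indicator {0..L} z * c)"
      by (intro square_integrable_diff h square_integrable_indicator_continuous) auto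
    fix a b assume ab: "0 < a" "a < b" "b < L"
    have "integral {a..b} (\<lambda>z. h z - indicator {0..L} z * c) = integral {a..b} (\<lambda>z. h z - c)"
      using ab by (intro integral_cong) auto
    also have "\<dots> = integral {a..b} h - (b - a) * c"
      using ab square_integrable_integrable_on[OF h] by (subst Henstock_Kurzweil_Integration.integral_diff) auto
    also have "\<dots> = 0"
      using key[OF ab] L by (simp add: c_def field_simps)
    finally show "integral {a..b} (\<lambda>z. h z - indicator {0..L} z * c) = 0" .
  qed
  then show ?thesis
    by (intro that[of c]) (auto elim!: eventually_mono)
qed

text \<open>Subtracting the primitive of \<open>y\<close> from \<open>x\<close> leaves a function
  with vanishing weak derivative, hence a constant. Together with \<open>has_weak_derivI\<close>
  this characterizes weak derivatives.\<close>

lemma has_weak_derivD: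
  assumes "has_weak_deriv L x y" and L: "0 < L"
  obtains c where "continuous_rep L x (\<lambda>z. c + integral {0..z} (rep_L2 y))"
proof -
  let ?Y = "\<lambda>z. integral {0..z} (rep_L2 y)"
  define h where "h z = rep_L2 x z - indicator {0..L} z * ?Y z" for z
  have h: "square_integrable h"
    unfolding h_def by (intro square_integrable_diff square_integrable_rep_L2
        square_integrable_indicator_continuous continuous_on_primitive)
  obtain c where c: "AE z in lborel. z \<in> {0<..<L} \<longrightarrow> h z = c"
  proof (rule du_Bois_Reymond[OF h L])
    fix \<phi> assume \<phi>: "test_function L \<phi>"
    have "integral {0..L} (\<lambda>z. h z * deriv \<phi> z)
        = integral {0..L} (\<lambda>z. rep_L2 x z * deriv \<phi> z - ?Y z * deriv \<phi> z)"
      by (intro integral_cong) (simp add: h_def algebra_simps)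
    also have "\<dots> = integral {0..L} (\<lambda>z. rep_L2 x z * deriv \<phi> z) - integral {0..L} (\<lambda>z. ?Y z * deriv \<phi> z)"
    proof (rule Henstock_Kurzweil_Integration.integral_diff)
      show "(\<lambda>z. rep_L2 x z * deriv \<phi> z) integrable_on {0..L}"
        by (intro set_borel_integral_eq_integral(1) set_integrable_mult_continuous square_integrable_rep_L2
            test_function_continuous[OF \<phi>])
      show "(\<lambda>z. ?Y z * deriv \<phi> z) integrable_on {0..L}"
        by (intro integrable_continuous_real continuous_intros continuous_on_primitive test_function_continuous[OF \<phi>])
    qed
    also have "\<dots> = 0"
      using assms(1) \<phi> integral_primitive_mult_deriv[OF \<phi> square_integrable_rep_L2[of y]] L
      by (simp add: has_weak_deriv_iff)
    finally show "integral {0..L} (\<lambda>z. h z * deriv \<phi> z) = 0" .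
  qed
  have "continuous_rep L x (\<lambda>z. c + ?Y z)"
    unfolding continuous_rep_def using c
    by (auto intro!: continuous_intros continuous_on_primitive simp: h_def elim!: eventually_mono)
  then show ?thesis by (rule that)
qed

section \<open>Continuous functions as elements of the Hilbert space\<close>

lemma L2_inner: "inner x y = (LINT z|lborel. rep_L2 x z * rep_L2 y z)"
  by (simp add: inner_L2_def)

lemma inner_emb:
  assumes "continuous_on {0..L} g"
  shows "inner x (emb L g) = integral {0..L} (\<lambda>z. rep_L2 x z * g z)"
proof -
  have "inner x (emb L g) = (LINT z|lborel. rep_L2 x z * (indicator {0..L} z * g z))"
    unfolding L2_inner
  proof (rule integral_cong_AE)
    show "AE z in lborel. rep_L2 x z * rep_L2 (emb L g) z = rep_L2 x z * (indicator {0..L} z * g z)"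
      using rep_emb[OF assms] by (auto elim: eventually_mono)
    have m: "rep_L2 x \<in> borel_measurable lborel" for x
      using square_integrable_rep_L2[of x] by (simp add: square_integrable_def)
    have i: "(\<lambda>z. indicator {0..L} z * g z) \<in> borel_measurable lborel"
      using square_integrable_indicator_continuous[OF assms] by (simp only: square_integrable_def)
    show "(\<lambda>z. rep_L2 x z * rep_L2 (emb L g) z) \<in> borel_measurable lborel"
      by (rule borel_measurable_times[OF m m])
    show "(\<lambda>z. rep_L2 x z * (indicator {0..L} z * g z)) \<in> borel_measurable lborel"
      by (rule borel_measurable_times[OF m i])
  qed
  also have "\<dots> = (LINT z:{0..L}|lborel. rep_L2 x z * g z)"
    by (simp add: set_lebesgue_integral_def mult.left_commute)
  also have "\<dots> = integral {0..L} (\<lambda>z. rep_L2 x z * g z)"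
    by (intro set_borel_integral_eq_integral set_integrable_mult_continuous assms square_integrable_rep_L2)
  finally show ?thesis .
qed

lemma integral_rep_emb_mult:
  assumes "continuous_on {0..L} g" "S \<subseteq> {0..L}"
  shows "integral S (\<lambda>z. rep_L2 (emb L g) z * f z) = integral S (\<lambda>z. g z * f z)"
  by (rule integral_cong_AE_lborel) (use rep_emb[OF assms(1)] assms(2) in \<open>auto elim!: eventually_mono\<close>)

lemma integral_rep_emb:
  assumes "continuous_on {0..L} g" "S \<subseteq> {0..L}"
  shows "integral S (rep_L2 (emb L g)) = integral S g"
  using integral_rep_emb_mult[OF assms, of "\<lambda>_. 1"] by simp

lemma norm_emb:
  assumes "continuous_on {0..L} g"
  shows "(norm (emb L g))\<^sup>2 = integral {0..L} (\<lambda>z. (g z)\<^sup>2)"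
  using inner_emb[OF assms, of "emb L g"] integral_rep_emb_mult[OF assms order_refl, of g]
  unfolding power2_norm_eq_inner by (simp add: power2_eq_square)

instance L2 :: banach ..

text \<open>Puts \<open>L2\<close> into the sort over which endomorphisms form a normed algebra; the
  indicator of [0, 1] serves as a unit vector for leaving any point.\<close>

instance L2 :: perfect_space
proof
  fix x :: L2
  have "(norm (emb 1 (\<lambda>_. 1)))\<^sup>2 = 1"
    by (subst norm_emb) auto
  then have one: "norm (emb 1 (\<lambda>_. 1)) = 1"
    using norm_ge_zero[of "emb 1 (\<lambda>_. 1)"] by (auto simp: power2_eq_1_iff simp del: norm_ge_zero)
  show "\<not> open {x}"
  proof
    assume "open {x}"
    then obtain e where e: "0 < e" "\<And>y. dist y x < e \<Longrightarrow> y = x"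
      by (auto simp: open_dist)
    have "x + (e / 2) *\<^sub>R emb 1 (\<lambda>_. 1) = x"
      using e(1) one by (intro e(2)) (simp add: dist_norm)
    with e(1) one show False by auto
  qed
qed

lemma continuous_rep_cong:
  assumes "continuous_rep L x g" "\<And>z. z \<in> {0..L} \<Longrightarrow> g z = h z"
  shows "continuous_rep L x h"
proof -
  have "continuous_on {0..L} h"
    using assms continuous_on_cong[of "{0..L}" "{0..L}" g h] by (simp add: continuous_rep_def)
  then show ?thesis
    using assms unfolding continuous_rep_def by (auto elim!: eventually_mono)
qed

lemma continuous_rep_unique:
  assumes g: "continuous_rep L x g" and h: "continuous_rep L x h" and L: "0 < L" and z: "z \<in> {0..L}"
  shows "g z = h z"
proof (rule continuous_AE_eq_imp_eq[OF _ _ L _ z])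
  show "AE z in lborel. z \<in> {0<..<L} \<longrightarrow> g z = h z"
    using conjunct2[OF g[unfolded continuous_rep_def]] conjunct2[OF h[unfolded continuous_rep_def]]
    by eventually_elim auto
qed (use g h in \<open>auto simp: continuous_rep_def\<close>)

lemma emb_cong: "(\<And>z. z \<in> {0..L} \<Longrightarrow> g z = h z) \<Longrightarrow> emb L g = emb L h"
  unfolding emb_def by (intro arg_cong[where f = abs_L2]) (auto simp: indicator_def)

lemma emb_scaleR:
  assumes "continuous_on {0..L} g"
  shows "emb L (\<lambda>z. c * g z) = c *\<^sub>R emb L g"
proof -
  have "c *\<^sub>R emb L g = abs_L2 (\<lambda>z. c * (indicator {0..L} z * g z))"
    using square_integrable_indicator_continuous[OF assms]
    unfolding emb_def by (simp add: scaleR_L2.abs_eq L2_eq_def)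
  then show ?thesis by (simp add: emb_def mult.left_commute)
qed

lemma has_weak_deriv_unique:
  assumes y: "has_weak_deriv L x y" and y': "has_weak_deriv L x y'" and L: "0 < L"
  shows "y = y'"
proof -
  obtain c c' where c: "continuous_rep L x (\<lambda>z. c + integral {0..z} (rep_L2 y))"
    and c': "continuous_rep L x (\<lambda>z. c' + integral {0..z} (rep_L2 y'))"
    using has_weak_derivD[OF y L] has_weak_derivD[OF y' L] by metis
  have eq: "c + integral {0..z} (rep_L2 y) = c' + integral {0..z} (rep_L2 y')" if "z \<in> {0..L}" for z
    using continuous_rep_unique[OF c c' L that] .
  have int: "rep_L2 x integrable_on {a..b}" for x a b
    by (intro square_integrable_integrable_on square_integrable_rep_L2)
  have "AE z in lborel. z \<in> {0<..<L} \<longrightarrow> rep_L2 y z - rep_L2 y' z = 0"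
  proof (rule AE_zero_of_interval_integrals_zero)
    fix a b assume ab: "0 < a" "a < b" "b < L"
    have split: "integral {0..b} (rep_L2 x) = integral {0..a} (rep_L2 x) + integral {a..b} (rep_L2 x)" for x
      using Henstock_Kurzweil_Integration.integral_combine[OF _ _ int, of 0 a b] ab by simp
    show "integral {a..b} (\<lambda>z. rep_L2 y z - rep_L2 y' z) = 0"
      using eq[of a] eq[of b] ab split[of y] split[of y']
      by (simp add: Henstock_Kurzweil_Integration.integral_diff int)
  qed (intro square_integrable_diff square_integrable_rep_L2)
  then show ?thesis
    using y y' by (intro L2_on_eqI) (auto simp: has_weak_deriv_def elim!: eventually_mono)
qed

lemma has_weak_deriv_emb:
  assumes L: "0 \<le> L" and g: "\<And>z. z \<in> {0..L} \<Longrightarrow> (g has_real_derivative g' z) (at z within {0..L})"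
    and g': "continuous_on {0..L} g'"
  shows "has_weak_deriv L (emb L g) (emb L g')"
proof -
  have gc: "continuous_on {0..L} g"
    using g by (rule DERIV_continuous_on)
  have "g z = g 0 + integral {0..z} (rep_L2 (emb L g'))" if z: "z \<in> {0..L}" for z
  proof -
    have "(g' has_integral g z - g 0) {0..z}"
    proof (rule fundamental_theorem_of_calculus)
      fix w assume "w \<in> {0..z}"
      then have "(g has_real_derivative g' w) (at w within {0..z})"
        using z by (intro has_field_derivative_subset[OF g]) auto
      then show "(g has_vector_derivative g' w) (at w within {0..z})"
        by (simp add: has_real_derivative_iff_has_vector_derivative)
    qed (use z in auto)
    then show ?thesis
      using z integral_rep_emb[OF g', of "{0..z}"] by (simp add: integral_unique)
  qed
  then show ?thesis
    by (intro has_weak_derivI[where c = "g 0"] emb_in gc g' L continuous_rep_cong[OF continuous_rep_emb[OF gc]])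
qed

lemma A_graph_classical:
  assumes L: "0 \<le> L" and g: "\<And>z. (g has_real_derivative g' z) (at z)"
    and g': "\<And>z. (g' has_real_derivative m * g z) (at z)"
    and bc: "g' 0 + \<kappa> * g 0 = 0" "g' L = 0"
  shows "(emb L g, (D * m) *\<^sub>R emb L g) \<in> A_graph D L \<kappa>"
proof -
  have gc: "continuous_on {0..L} g" and gc': "continuous_on {0..L} g'"
    by (rule DERIV_continuous_on[OF has_field_derivative_at_within[OF g]],
        rule DERIV_continuous_on[OF has_field_derivative_at_within[OF g']])
  have w: "has_weak_deriv L (emb L g) (emb L g')"
    by (rule has_weak_deriv_emb[OF L has_field_derivative_at_within[OF g] gc'])
  have w': "has_weak_deriv L (emb L g') (m *\<^sub>R emb L g)"
    unfolding emb_scaleR[OF gc, symmetric]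
    by (rule has_weak_deriv_emb[OF L has_field_derivative_at_within[OF g'] continuous_on_mult_left[OF gc]])
  have "emb L g \<in> A_dom L \<kappa>"
    unfolding A_dom_def H1_def H2_def
    using w w' bc continuous_rep_emb[OF gc] continuous_rep_emb[OF gc'] by blast
  with w w' have "(emb L g, D *\<^sub>R m *\<^sub>R emb L g) \<in> A_graph D L \<kappa>"
    unfolding A_graph_def by blast
  then show ?thesis by simp
qed

lemma emb_nonzero:
  assumes L: "0 < L" and g: "continuous_on {0..L} g" and z: "z \<in> {0..L}" "g z \<noteq> 0"
  shows "emb L g \<noteq> 0"
proof
  assume eq: "emb L g = 0"
  have "continuous_rep L (emb L g) (\<lambda>_. 0)"
    using rep_L2_zero by (auto simp: eq continuous_rep_def elim!: eventually_mono)
  from continuous_rep_unique[OF continuous_rep_emb[OF g] this L z(1)] z(2) show False by simp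
qed

section \<open>The inverse of the Robin operator\<close>

lemma integral_mono_AE_lborel:
  fixes f g :: "real \<Rightarrow> real"
  assumes "set_integrable lborel S f" "set_integrable lborel S g"
    "AE z in lborel. z \<in> S \<longrightarrow> f z \<le> g z"
  shows "integral S f \<le> integral S g"
  using set_integral_mono_AE[OF assms] by (simp add: assms set_borel_integral_eq_integral)

lemma rep_integrable_on: "rep_L2 x integrable_on {a..b}"
  by (intro square_integrable_integrable_on square_integrable_rep_L2)

text \<open>This is D u' for the solution u of -D u'' = x with u' vanishing at \<open>L\<close>, as
  integration from \<open>s\<close> to \<open>L\<close> shows.\<close>

definition tail :: "real \<Rightarrow> L2 \<Rightarrow> real \<Rightarrow> real" where
  "tail L x s = integral {s..L} (rep_L2 x)"

lemma continuous_tail: "continuous_on {0..L} (tail L x)"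
  unfolding tail_def by (intro indefinite_integral_continuous_1' rep_integrable_on)

lemma tail_L: "tail L x L = 0"
  by (simp add: tail_def)

lemma tail_split: "a \<le> b \<Longrightarrow> b \<le> L \<Longrightarrow> tail L x a = integral {a..b} (rep_L2 x) + tail L x b"
  unfolding tail_def
  using Henstock_Kurzweil_Integration.integral_combine[OF _ _ rep_integrable_on, of a b L x] by simp

lemma tail_add: "tail L (x + y) s = tail L x s + tail L y s"
proof -
  have "tail L (x + y) s = integral {s..L} (\<lambda>z. rep_L2 x z + rep_L2 y z)"
    unfolding tail_def
    by (rule integral_cong_AE_lborel) (use rep_L2_add[of x y] in \<open>auto elim: eventually_mono\<close>)
  then show ?thesis
    by (simp add: Henstock_Kurzweil_Integration.integral_add rep_integrable_on tail_def)
qed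

lemma tail_scaleR: "tail L (c *\<^sub>R x) s = c * tail L x s"
proof -
  have "tail L (c *\<^sub>R x) s = integral {s..L} (\<lambda>z. c * rep_L2 x z)"
    unfolding tail_def
    by (rule integral_cong_AE_lborel) (use rep_L2_scaleR[of c x] in \<open>auto elim: eventually_mono\<close>)
  then show ?thesis by (simp add: tail_def)
qed

lemma abs_tail_le:
  assumes "0 \<le> L" "0 \<le> s"
  shows "\<bar>tail L x s\<bar> \<le> sqrt L * norm x"
proof (cases "s \<le> L")
  case True
  define f where "f = (indicator {s..L} :: real \<Rightarrow> real)"
  have sq: "square_integrable f"
    unfolding f_def by (rule square_integrable_indicator_interval)
  have "inner x (abs_L2 f) = inner (abs_L2 (rep_L2 x)) (abs_L2 f)" by simp
  also have "\<dots> = (LINT z|lborel. rep_L2 x z * f z)"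
    using sq square_integrable_rep_L2[of x] by (subst inner_L2.abs_eq) (auto simp: L2_eq_def)
  also have "\<dots> = (LINT z:{s..L}|lborel. rep_L2 x z)"
    by (simp add: set_lebesgue_integral_def f_def mult.commute)
  also have "\<dots> = tail L x s"
    unfolding tail_def
    by (intro set_borel_integral_eq_integral square_integrable_imp_set_integrable square_integrable_rep_L2)
  finally have "\<bar>tail L x s\<bar> \<le> norm x * norm (abs_L2 f)"
    using Cauchy_Schwarz_ineq2[of x "abs_L2 f"] by simp
  moreover have "norm (abs_L2 f) \<le> sqrt L"
  proof (rule real_le_rsqrt)
    have "(norm (abs_L2 f))\<^sup>2 = (LINT z|lborel. indicator {s..L} z)"
      unfolding norm_abs_L2[OF sq] by (intro Bochner_Integration.integral_cong) (auto simp: f_def indicator_def)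
    also have "\<dots> = L - s" using True by simp
    finally show "(norm (abs_L2 f))\<^sup>2 \<le> L" using assms by simp
  qed
  then have "norm x * norm (abs_L2 f) \<le> norm x * sqrt L"
    by (intro mult_left_mono) auto
  ultimately show ?thesis by (simp add: mult.commute)
next
  case False
  then show ?thesis using assms by (simp add: tail_def)
qed

text \<open>The frequency \<open>r\<close> of the ground state is the parameter, not the feedback
  gain. The bound on \<open>L * r\<close> keeps cos (r (L - z)) positive on the closed interval and
  makes \<open>K\<close> positive.\<close>

locale robin_diffusion =
  fixes D L r :: real
  assumes D: "0 < D" and L: "0 < L" and r: "0 < r" and rL: "L * r < pi / 2"
begin

definition K :: real where "K = r * tan (L * r)"

lemma K: "0 < K"
  using r L rL by (auto simp: K_def intro!: mult_pos_pos tan_gt_zero)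

text \<open>\<open>R x\<close> is the solution \<open>u\<close> of \<open>- D u'' = x\<close>, \<open>u' 0 = K u 0\<close>, \<open>u' L = 0\<close>.\<close>

definition sol :: "L2 \<Rightarrow> real \<Rightarrow> real" where
  "sol x z = (tail L x 0 / K + integral {0..z} (tail L x)) / D"

definition R :: "L2 \<Rightarrow> L2" where "R x = emb L (sol x)"

lemma sol_deriv: "z \<in> {0..L} \<Longrightarrow> (sol x has_real_derivative tail L x z / D) (at z within {0..L})"
  unfolding sol_def using integral_has_real_derivative[OF continuous_tail, of z L x]
  using D by (auto intro!: derivative_eq_intros)

lemma continuous_sol: "continuous_on {0..L} (sol x)"
  using sol_deriv by (rule DERIV_continuous_on)

lemma sol_0: "tail L x 0 = D * K * sol x 0"
  using K D by (simp add: sol_def)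

lemma R_in: "R x \<in> L2_on L"
  unfolding R_def by (intro emb_in continuous_sol)

lemma sol_add: "z \<in> {0..L} \<Longrightarrow> sol (x + y) z = sol x z + sol y z"
proof -
  assume "z \<in> {0..L}"
  then have "tail L x integrable_on {0..z}" for x
    by (intro integrable_continuous_real continuous_on_subset[OF continuous_tail]) auto
  then have "integral {0..z} (tail L (x + y)) = integral {0..z} (tail L x) + integral {0..z} (tail L y)"
    unfolding tail_add by (simp add: Henstock_Kurzweil_Integration.integral_add)
  then show ?thesis
    by (simp add: sol_def tail_add add_divide_distrib)
qed

lemma sol_scaleR: "sol (c *\<^sub>R x) z = c * sol x z"
  unfolding sol_def tail_scaleR by (simp add: algebra_simps)

lemma abs_sol_le:
  assumes z: "z \<in> {0..L}"
  shows "\<bar>sol x z\<bar> \<le> (1 / K + L) * sqrt L / D * norm x"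
proof -
  have "norm (integral {0..z} (tail L x)) \<le> (sqrt L * norm x) * (z - 0)"
    using z L abs_tail_le by (intro integral_bound continuous_on_subset[OF continuous_tail]) auto
  also have "\<dots> \<le> (sqrt L * norm x) * L"
    using z L by (intro mult_left_mono) auto
  finally have 1: "\<bar>integral {0..z} (tail L x)\<bar> \<le> (sqrt L * norm x) * L" by simp
  have 2: "\<bar>tail L x 0 / K\<bar> \<le> (sqrt L * norm x) / K"
    using K L abs_tail_le[of L 0 x] by (simp add: abs_divide divide_right_mono)
  have "\<bar>sol x z\<bar> = \<bar>tail L x 0 / K + integral {0..z} (tail L x)\<bar> / D"
    using D by (simp add: sol_def abs_divide)
  also have "\<dots> \<le> ((sqrt L * norm x) / K + (sqrt L * norm x) * L) / D"
    using D 1 2 by (intro divide_right_mono) (auto intro: order_trans[OF abs_triangle_ineq])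
  finally show ?thesis by (simp add: algebra_simps add_divide_distrib)
qed

lemma bounded_linear_R: "bounded_linear R"
proof (rule bounded_linear_intro)
  fix x y :: L2 and c :: real
  have rep: "continuous_rep L (R x) (sol x)" for x
    unfolding R_def by (intro continuous_rep_emb continuous_sol)
  show "R (x + y) = R x + R y"
  proof (rule L2_on_eqI[OF R_in subspace_add[OF subspace_L2_on R_in R_in]])
    show "AE z in lborel. z \<in> {0<..<L} \<longrightarrow> rep_L2 (R (x + y)) z = rep_L2 (R x + R y) z"
      using conjunct2[OF rep[of "x + y", unfolded continuous_rep_def]]
        conjunct2[OF rep[of x, unfolded continuous_rep_def]]
        conjunct2[OF rep[of y, unfolded continuous_rep_def]] rep_L2_add[of "R x" "R y"]
      by eventually_elim (simp add: sol_add)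
  qed
  show "R (c *\<^sub>R x) = c *\<^sub>R R x"
    unfolding R_def sol_scaleR[abs_def] by (rule emb_scaleR[OF continuous_sol])
  let ?M = "(1 / K + L) * sqrt L / D * norm x"
  have "(norm (R x))\<^sup>2 \<le> integral {0..L} (\<lambda>z. ?M\<^sup>2)"
    unfolding R_def norm_emb[OF continuous_sol]
  proof (rule integral_le)
    show "(\<lambda>z. (sol x z)\<^sup>2) integrable_on {0..L}"
      by (intro integrable_continuous_real continuous_intros continuous_sol)
    show "(sol x z)\<^sup>2 \<le> ?M\<^sup>2" if "z \<in> {0..L}" for z
      using abs_sol_le[OF that] by (metis abs_ge_zero power2_abs power_mono)
  qed auto
  also have "\<dots> = (?M * sqrt L)\<^sup>2"
    unfolding power_mult_distrib[of ?M "sqrt L"] using L by simp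
  finally have "norm (R x) \<le> ?M * sqrt L"
  proof (rule power2_le_imp_le)
    show "0 \<le> ?M * sqrt L"
      using K L D by (intro mult_nonneg_nonneg divide_nonneg_nonneg add_nonneg_nonneg) simp_all
  qed
  then show "norm (R x) \<le> norm x * ((1 / K + L) * sqrt L / D * sqrt L)"
    by (simp add: mult_ac)
qed

section \<open>Injectivity, energy identity and coercivity of the solution operator\<close>

lemma R_inj:
  assumes h: "h \<in> L2_on L" and R0: "R h = 0"
  shows "h = 0"
proof -
  have "continuous_rep L (R h) (\<lambda>_. 0)"
    using rep_L2_zero by (auto simp: R0 continuous_rep_def elim!: eventually_mono)
  then have sol0: "sol h z = 0" if "z \<in> {0..L}" for z
    using continuous_rep_unique[OF continuous_rep_emb[OF continuous_sol], of h "\<lambda>_. 0"] that L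
    by (simp add: R_def)
  have tail0: "tail L h z = 0" if z: "0 < z" "z < L" for z
  proof -
    have "(sol h has_real_derivative tail L h z / D) (at z)"
      using sol_deriv[of z h] z by (simp add: at_within_Icc_at)
    moreover have "(sol h has_real_derivative 0) (at z)"
      by (rule has_field_derivative_transform_within_open[of "\<lambda>_. 0" _ _ "{0<..<L}"]) (use z sol0 in auto)
    ultimately show ?thesis
      using DERIV_unique D by fastforce
  qed
  have "AE z in lborel. z \<in> {0<..<L} \<longrightarrow> rep_L2 h z = 0"
  proof (rule AE_zero_of_interval_integrals_zero[OF square_integrable_rep_L2])
    fix a b assume "0 < a" "a < b" "b < L"
    then show "integral {a..b} (rep_L2 h) = 0"
      using tail_split[of a b L h] tail0[of a] tail0[of b] by simp
  qed
  then have "AE z in lborel. rep_L2 h z = rep_L2 0 z"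
    using h[unfolded L2_on_def mem_Collect_eq] rep_L2_zero by eventually_elim auto
  then show ?thesis by (rule L2_eqI)
qed

text \<open>The energy identity: testing -D u'' = h with u = \<open>sol h\<close> produces the
  integral of u'^2, where u' is \<open>tail L h / D\<close>, and a boundary term that u' 0 = K u 0
  turns into a square.\<close>

lemma inner_R:
  "inner h (R h) = D * (K * (sol h 0)\<^sup>2 + integral {0..L} (\<lambda>z. (tail L h z / D)\<^sup>2))"
proof -
  define T where "T z = indicator {0..L} z * tail L h z" for z
  have T: "square_integrable T"
    unfolding T_def by (intro square_integrable_indicator_continuous continuous_tail)
  have "integral {0..L} (\<lambda>z. rep_L2 h z * integral {0..z} (tail L h))
      = integral {0..L} (\<lambda>z. rep_L2 h z * integral {0..z} T)"
    by (intro integral_cong arg_cong2[where f = "(*)"] refl) (simp add: T_def)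
  also have "\<dots> = integral {0..L} (\<lambda>s. T s * integral {s..L} (rep_L2 h))"
    by (rule integral_triangle_swap[OF square_integrable_rep_L2 T])
  also have "\<dots> = integral {0..L} (\<lambda>z. (tail L h z)\<^sup>2)"
    by (intro integral_cong) (simp add: T_def tail_def power2_eq_square)
  finally have swap: "integral {0..L} (\<lambda>z. rep_L2 h z * integral {0..z} (tail L h))
      = integral {0..L} (\<lambda>z. (tail L h z)\<^sup>2)" .
  have int: "(\<lambda>z. rep_L2 h z * integral {0..z} (tail L h)) integrable_on {0..L}"
    by (intro set_borel_integral_eq_integral(1) set_integrable_mult_continuous square_integrable_rep_L2
        indefinite_integral_continuous_1 integrable_continuous_real continuous_tail)
  have "inner h (R h) = integral {0..L} (\<lambda>z. rep_L2 h z * sol h z)"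
    unfolding R_def by (rule inner_emb[OF continuous_sol])
  also have "\<dots> = integral {0..L} (\<lambda>z. (tail L h 0 / (K * D)) * rep_L2 h z
      + (1 / D) * (rep_L2 h z * integral {0..z} (tail L h)))"
    by (intro integral_cong) (simp add: sol_def algebra_simps add_divide_distrib)
  also have "\<dots> = (tail L h 0 / (K * D)) * integral {0..L} (rep_L2 h)
      + (1 / D) * integral {0..L} (\<lambda>z. rep_L2 h z * integral {0..z} (tail L h))"
    by (subst Henstock_Kurzweil_Integration.integral_add)
      (auto intro!: integrable_on_mult_right integrable_on_divide rep_integrable_on int)
  also have "\<dots> = (tail L h 0)\<^sup>2 / (K * D) + integral {0..L} (\<lambda>z. (tail L h z)\<^sup>2) / D"
    by (simp add: swap tail_def power2_eq_square)
  also have "(tail L h 0)\<^sup>2 / (K * D) = D * (K * (sol h 0)\<^sup>2)"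
    using K D by (simp add: sol_0 power2_eq_square)
  also have "integral {0..L} (\<lambda>z. (tail L h z)\<^sup>2) / D = D * integral {0..L} (\<lambda>z. (tail L h z / D)\<^sup>2)"
    using D by (simp add: power_divide power2_eq_square)
  finally show ?thesis by (simp add: distrib_left)
qed

text \<open>
  For the positive ground state \<open>\<phi> z = cos (r (L - z))\<close> the quotient \<open>p = \<phi>' / \<phi>\<close> satisfies
  \<open>p' = - r\<^sup>2 - p\<^sup>2\<close>, whence \<open>u'\<^sup>2 - r\<^sup>2 u\<^sup>2 = (p u\<^sup>2)' + (u' - p u)\<^sup>2\<close> (Picone's identity).
\<close>

lemma coercive_R: "(D * r\<^sup>2) * (norm (R h))\<^sup>2 \<le> inner h (R h)"
proof -
  define u where "u = sol h"
  define u' where "u' z = tail L h z / D" for z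
  define p where "p z = r * tan (r * (L - z))" for z
  have cos: "cos (r * (L - z)) \<noteq> 0" if z: "z \<in> {0..L}" for z
  proof -
    have "0 \<le> r * (L - z)" "r * (L - z) \<le> L * r"
      using z r by (simp_all add: mult.commute mult_left_mono algebra_simps)
    then show ?thesis
      using cos_gt_zero_pi[of "r * (L - z)"] rL by simp
  qed
  have p: "(p has_real_derivative - r\<^sup>2 - (p z)\<^sup>2) (at z within {0..L})" if z: "z \<in> {0..L}" for z
  proof -
    have "((\<lambda>z. r * tan (r * (L - z))) has_real_derivative r * (inverse ((cos (r * (L - z)))\<^sup>2) * (r * (0 - 1)))) (at z within {0..L})"
      using cos[OF z] by (intro derivative_eq_intros | simp)+
    moreover have "r * (inverse ((cos (r * (L - z)))\<^sup>2) * (r * (0 - 1))) = - r\<^sup>2 - (p z)\<^sup>2"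
    proof -
      have "r * (inverse ((cos (r * (L - z)))\<^sup>2) * (r * (0 - 1))) = - r\<^sup>2 * (inverse (cos (r * (L - z))))\<^sup>2"
        by (simp add: power2_eq_square)
      also have "\<dots> = - r\<^sup>2 * (1 + (tan (r * (L - z)))\<^sup>2)"
        by (simp only: tan_sec[OF cos[OF z]])
      finally show ?thesis
        by (simp add: p_def power2_eq_square algebra_simps)
    qed
    ultimately show ?thesis by (simp add: p_def[abs_def])
  qed
  have u: "(u has_real_derivative u' z) (at z within {0..L})" if "z \<in> {0..L}" for z
    using sol_deriv[OF that] by (simp add: u_def u'_def)
  have cu: "continuous_on {0..L} u" "continuous_on {0..L} u'" "continuous_on {0..L} p"
    using continuous_sol D continuous_tail[of L h] DERIV_continuous_on[OF p]
    by (auto simp: u_def u'_def[abs_def] intro!: continuous_on_divide)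
  have "((\<lambda>z. (u' z)\<^sup>2 - r\<^sup>2 * (u z)\<^sup>2 - (u' z - p z * u z)\<^sup>2) has_integral
      p L * (u L)\<^sup>2 - p 0 * (u 0)\<^sup>2) {0..L}"
  proof (rule fundamental_theorem_of_calculus)
    fix z assume z: "z \<in> {0..L}"
    have "((\<lambda>z. p z * (u z)\<^sup>2) has_real_derivative (- r\<^sup>2 - (p z)\<^sup>2) * (u z)\<^sup>2 + (2 * u z * u' z) * p z)
        (at z within {0..L})"
      by (rule derivative_eq_intros p[OF z] u[OF z] refl | simp)+
    also have "(- r\<^sup>2 - (p z)\<^sup>2) * (u z)\<^sup>2 + (2 * u z * u' z) * p z
        = (u' z)\<^sup>2 - r\<^sup>2 * (u z)\<^sup>2 - (u' z - p z * u z)\<^sup>2"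
      by (simp add: power2_eq_square algebra_simps)
    finally show "((\<lambda>z. p z * (u z)\<^sup>2) has_vector_derivative
        (u' z)\<^sup>2 - r\<^sup>2 * (u z)\<^sup>2 - (u' z - p z * u z)\<^sup>2) (at z within {0..L})"
      by (simp add: has_real_derivative_iff_has_vector_derivative)
  qed (use L in simp)
  \<comment> \<open>Here \<open>p L\<close> is 0 and \<open>p 0\<close> is \<open>K\<close>, so
    Picone's identity leaves exactly the boundary term of the energy identity.\<close>
  then have "integral {0..L} (\<lambda>z. (u' z)\<^sup>2 - r\<^sup>2 * (u z)\<^sup>2 - (u' z - p z * u z)\<^sup>2) = - K * (u 0)\<^sup>2"
    by (simp add: integral_unique p_def K_def mult.commute)
  also have "integral {0..L} (\<lambda>z. (u' z)\<^sup>2 - r\<^sup>2 * (u z)\<^sup>2 - (u' z - p z * u z)\<^sup>2)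
      = integral {0..L} (\<lambda>z. (u' z)\<^sup>2) - r\<^sup>2 * integral {0..L} (\<lambda>z. (u z)\<^sup>2)
        - integral {0..L} (\<lambda>z. (u' z - p z * u z)\<^sup>2)"
    by (simp add: Henstock_Kurzweil_Integration.integral_diff integrable_continuous_real
        continuous_on_diff continuous_on_mult continuous_on_power cu)
  finally have "integral {0..L} (\<lambda>z. (u' z)\<^sup>2) + K * (u 0)\<^sup>2
      = r\<^sup>2 * integral {0..L} (\<lambda>z. (u z)\<^sup>2) + integral {0..L} (\<lambda>z. (u' z - p z * u z)\<^sup>2)"
    by simp
  moreover have "0 \<le> integral {0..L} (\<lambda>z. (u' z - p z * u z)\<^sup>2)"
    by (intro integral_nonneg integrable_continuous_real continuous_intros cu) auto
  ultimately have "r\<^sup>2 * integral {0..L} (\<lambda>z. (u z)\<^sup>2) \<le> K * (u 0)\<^sup>2 + integral {0..L} (\<lambda>z. (u' z)\<^sup>2)"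
    by simp
  then have "D * (r\<^sup>2 * integral {0..L} (\<lambda>z. (u z)\<^sup>2)) \<le> D * (K * (u 0)\<^sup>2 + integral {0..L} (\<lambda>z. (u' z)\<^sup>2))"
    using D by (intro mult_left_mono) auto
  then show ?thesis
    unfolding inner_R unfolding R_def norm_emb[OF continuous_sol] by (simp add: u_def u'_def mult.assoc)
qed

text \<open>
  At a negative minimum \<open>z0\<close> of \<open>u = sol h\<close> the boundary condition at \<open>0\<close> forces \<open>z0 > 0\<close> and
  \<open>u' z0 \<ge> 0\<close>, while \<open>h \<ge> - l u > 0\<close> nearby makes \<open>u' = tail L h / D\<close> strictly positive to the
  left of \<open>z0\<close>.
\<close>

lemma sol_nonneg:
  assumes l: "0 < l" and ae: "AE z in lborel. z \<in> {0..L} \<longrightarrow> 0 \<le> rep_L2 h z + l * sol h z"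
    and z: "z \<in> {0..L}"
  shows "0 \<le> sol h z"
proof (rule ccontr)
  assume neg: "\<not> 0 \<le> sol h z"
  obtain z0 where z0: "z0 \<in> {0..L}" and min: "\<And>w. w \<in> {0..L} \<Longrightarrow> sol h z0 \<le> sol h w"
    using continuous_attains_inf[OF compact_Icc _ continuous_sol] z by (metis empty_iff)
  have neg0: "sol h z0 < 0"
    using min[OF z] neg by simp
  \<comment> \<open>If z0 = L the derivative vanishes by the boundary condition; otherwise a
    negative derivative would produce smaller values to the right of the minimum.\<close>
  have tail_ge: "0 \<le> tail L h z0"
  proof (rule ccontr)
    assume t: "\<not> 0 \<le> tail L h z0"
    then have "z0 < L"
      using z0 tail_L by (cases "z0 = L") auto
    have "tail L h z0 / D < 0"
      using t D by (simp add: divide_neg_pos)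
    from has_real_derivative_neg_dec_right[OF sol_deriv[OF z0] this]
    obtain d where d: "0 < d" "\<And>e. 0 < e \<Longrightarrow> z0 + e \<in> {0..L} \<Longrightarrow> e < d \<Longrightarrow> sol h (z0 + e) < sol h z0"
      by blast
    define e where "e = min (d / 2) (L - z0)"
    have e: "0 < e" "e < d" "z0 + e \<in> {0..L}"
      using d(1) \<open>z0 < L\<close> z0 by (auto simp: e_def min_def)
    show False
      using d(2)[OF e(1) e(3) e(2)] min[OF e(3)] by simp
  qed
  have "z0 \<noteq> 0"
  proof
    assume "z0 = 0"
    with neg0 have "D * K * sol h z0 < 0"
      using D K by (simp add: mult_pos_neg)
    with tail_ge \<open>z0 = 0\<close> sol_0[of h] show False by simp
  qed
  \<comment> \<open>A lower bound for \<open>h\<close> wherever the solution stays below half of its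
    negative minimum.\<close>
  define m where "m = - l * (sol h z0 / 2)"
  have m: "0 < m" using l neg0 by (simp add: m_def mult_pos_neg)
  have "\<forall>\<^sub>F w in at z0 within {0..L}. sol h w < sol h z0 / 2"
    using continuous_sol z0 neg0 by (intro order_tendstoD(2)[of _ "sol h z0"]) (auto simp: continuous_on_def)
  then obtain d where d: "0 < d" "\<And>w. w \<in> {0..L} \<Longrightarrow> w \<noteq> z0 \<Longrightarrow> dist w z0 < d \<Longrightarrow> sol h w < sol h z0 / 2"
    by (auto simp: eventually_at)
  \<comment> \<open>Half of \<open>d\<close> keeps the whole segment from \<open>z1\<close> to
    \<open>z0\<close> in the neighbourhood, and the maximum keeps it in the interval.\<close>
  define z1 where "z1 = max 0 (z0 - d / 2)"
  have z1: "0 \<le> z1" "z1 < z0" "z0 - z1 < d"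
    using d(1) z0 \<open>z0 \<noteq> 0\<close> by (auto simp: z1_def max_def)
  have small: "sol h w \<le> sol h z0 / 2" if "z1 \<le> w" "w \<le> z0" for w
    using d(2)[of w] that z1 z0 neg0 by (cases "w = z0") (auto simp: dist_real_def)
  have tail_pos: "0 < tail L h w" if w: "z1 < w" "w < z0" for w
  proof -
    have "integral {w..z0} (\<lambda>_. m) \<le> integral {w..z0} (rep_L2 h)"
    proof (rule integral_mono_AE_lborel)
      show "AE v in lborel. v \<in> {w..z0} \<longrightarrow> m \<le> rep_L2 h v"
        using ae
      proof eventually_elim
        case (elim v)
        show ?case
        proof
          assume v: "v \<in> {w..z0}"
          then have "l * sol h v \<le> l * (sol h z0 / 2)"
            using w l by (intro mult_left_mono small) auto
          with elim v w z1 z0 show "m \<le> rep_L2 h v"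
            by (simp add: m_def)
        qed
      qed
      show "set_integrable lborel {w..z0} (\<lambda>_. m)"
        by (intro borel_integrable_atLeastAtMost') simp
    qed (intro square_integrable_imp_set_integrable square_integrable_rep_L2)
    moreover have "0 < integral {w..z0} (\<lambda>_. m)"
      using w m by simp
    ultimately show ?thesis
      using tail_split[of w z0 L h] tail_ge w z0 by simp
  qed
  have "\<exists>\<xi>\<in>{z1<..<z0}. sol h z0 - sol h z1 = (*) (tail L h \<xi> / D) (z0 - z1)"
  proof (rule mvt_simple[OF z1(2)])
    fix w assume "z1 \<le> w" "w \<le> z0"
    then have "(sol h has_real_derivative tail L h w / D) (at w within {z1..z0})"
      using z1 z0 by (intro has_field_derivative_subset[OF sol_deriv]) auto
    then show "(sol h has_derivative (*) (tail L h w / D)) (at w within {z1..z0})"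
      by (simp only: has_field_derivative_def)
  qed
  then obtain \<xi> where "z1 < \<xi>" "\<xi> < z0" "sol h z0 - sol h z1 = tail L h \<xi> / D * (z0 - z1)"
    by auto
  then have "0 < sol h z0 - sol h z1"
    using tail_pos[of \<xi>] z1 D by simp
  with min[of z1] z1 z0 show False by simp
qed

text \<open>Integrating twice leaves two constants: the condition at \<open>L\<close> fixes that of
  the derivative, and the Robin condition, as \<open>K\<close> is nonzero, fixes that of the
  function.\<close>

lemma A_graph_eq: "A_graph D L (- K) = {(- R y, y) | y. y \<in> L2_on L}"
proof (intro equalityI subsetI)
  fix p assume "p \<in> A_graph D L (- K)"
  then obtain x x' x'' where p: "p = (x, D *\<^sub>R x'')" and dom: "x \<in> A_dom L (- K)"
    and w: "has_weak_deriv L x x'" and w': "has_weak_deriv L x' x''"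
    by (auto simp: A_graph_def)
  \<comment> \<open>Domain and graph each provide a weak derivative of \<open>x\<close>; uniqueness
    lets the boundary conditions refer to \<open>x'\<close>.\<close>
  obtain g g' where g: "continuous_rep L x g" and g': "continuous_rep L x' g'"
    and bc: "g' 0 + (- K) * g 0 = 0" "g' L = 0"
    using dom has_weak_deriv_unique[OF w _ L] unfolding A_dom_def by blast
  obtain c where c: "continuous_rep L x (\<lambda>z. c + integral {0..z} (rep_L2 x'))"
    using has_weak_derivD[OF w L] .
  obtain c' where c': "continuous_rep L x' (\<lambda>z. c' + integral {0..z} (rep_L2 x''))"
    using has_weak_derivD[OF w' L] .
  have in_L2: "x \<in> L2_on L" "x' \<in> L2_on L" "x'' \<in> L2_on L"
    using w w' by (auto simp: has_weak_deriv_def)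
  have g_eq: "g z = c + integral {0..z} (rep_L2 x')" if "z \<in> {0..L}" for z
    by (rule continuous_rep_unique[OF g c L that])
  have g'_eq: "g' z = c' + integral {0..z} (rep_L2 x'')" if "z \<in> {0..L}" for z
    by (rule continuous_rep_unique[OF g' c' L that])
  have c'_eq: "c' = - tail L x'' 0"
    using g'_eq[of L] bc(2) L by (simp add: tail_def)
  have g'_tail: "g' z = - tail L x'' z" if "z \<in> {0..L}" for z
    using g'_eq[OF that] tail_split[of 0 z L x''] that c'_eq by simp
  have x': "x' = emb L g'"
    by (rule L2_on_eq_emb[OF in_L2(2) g'])
  have cg': "continuous_on {0..L} g'"
    using g' by (simp add: continuous_rep_def)
  have "g z = - sol (D *\<^sub>R x'') z" if z: "z \<in> {0..L}" for z
  proof -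
    have "integral {0..z} (rep_L2 x') = integral {0..z} g'"
      unfolding x' using z by (intro integral_rep_emb cg') auto
    also have "\<dots> = integral {0..z} (\<lambda>s. - tail L x'' s)"
      using z by (intro integral_cong g'_tail) auto
    finally have "g z = c - integral {0..z} (tail L x'')"
      using g_eq[OF z] by simp
    moreover have "c = - tail L x'' 0 / K"
      using g_eq[of 0] g'_tail[of 0] bc(1) L K by (simp add: field_simps)
    moreover have "sol (D *\<^sub>R x'') z = tail L x'' 0 / K + integral {0..z} (tail L x'')"
      unfolding sol_scaleR using D by (simp add: sol_def)
    ultimately show ?thesis by simp
  qed
  then have "x = emb L (\<lambda>z. - 1 * sol (D *\<^sub>R x'') z)"
    unfolding L2_on_eq_emb[OF in_L2(1) g] by (intro emb_cong) simp
  also have "\<dots> = - R (D *\<^sub>R x'')"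
    unfolding R_def emb_scaleR[OF continuous_sol] by simp
  finally show "p \<in> {(- R y, y) | y. y \<in> L2_on L}"
    using in_L2(3) subspace_scale[OF subspace_L2_on] p by blast
next
  fix p assume "p \<in> {(- R y, y) | y. y \<in> L2_on L}"
  then obtain y where p: "p = (- R y, y)" and y: "y \<in> L2_on L" by blast
  define g where "g z = - 1 * sol y z" for z
  define g' where "g' z = - 1 * (tail L y z / D)" for z
  have cg: "continuous_on {0..L} g" and cg': "continuous_on {0..L} g'"
    unfolding g_def g'_def using D
    by (intro continuous_intros continuous_sol continuous_tail; simp)+
  have x: "- R y = emb L g"
    unfolding g_def R_def emb_scaleR[OF continuous_sol] by simp
  have w: "has_weak_deriv L (emb L g) (emb L g')"
    unfolding g_def[abs_def] g'_def[abs_def] using L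
    by (intro has_weak_deriv_emb DERIV_cmult sol_deriv) (use cg' in \<open>auto simp: g'_def[abs_def]\<close>)
  have w': "has_weak_deriv L (emb L g') ((1 / D) *\<^sub>R y)"
  proof (rule has_weak_derivI[where c = "g' 0"])
    show "continuous_rep L (emb L g') (\<lambda>z. g' 0 + integral {0..z} (rep_L2 ((1 / D) *\<^sub>R y)))"
    proof (rule continuous_rep_cong[OF continuous_rep_emb[OF cg']])
      fix z assume z: "z \<in> {0..L}"
      have "integral {0..z} (rep_L2 ((1 / D) *\<^sub>R y)) = integral {0..z} (\<lambda>v. (1 / D) * rep_L2 y v)"
        using rep_L2_scaleR[of "1 / D" y] by (intro integral_cong_AE_lborel) (auto elim: eventually_mono)
      also have "\<dots> = (tail L y 0 - tail L y z) / D"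
        using tail_split[of 0 z L y] z by simp
      finally show "g' z = g' 0 + integral {0..z} (rep_L2 ((1 / D) *\<^sub>R y))"
        by (simp add: g'_def diff_divide_distrib)
    qed
  qed (use L y emb_in[OF cg'] subspace_scale[OF subspace_L2_on] in auto)
  have "g' 0 + (- K) * g 0 = 0"
    unfolding g_def g'_def sol_0 using D by simp
  moreover have "g' L = 0"
    by (simp add: g'_def tail_L)
  ultimately have "emb L g \<in> A_dom L (- K)"
    unfolding A_dom_def H1_def H2_def
    using w w' continuous_rep_emb[OF cg] continuous_rep_emb[OF cg'] by blast
  with w w' have "(emb L g, D *\<^sub>R (1 / D) *\<^sub>R y) \<in> A_graph D L (- K)"
    unfolding A_graph_def by blast
  then show "p \<in> A_graph D L (- K)"
    using D by (simp add: p x)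
qed

sublocale accretive_inverse "L2_on L" R "D * r\<^sup>2"
  by (rule accretive_inverse.intro)
    (use D in \<open>auto intro: closed_L2_on subspace_L2_on bounded_linear_R R_in R_inj coercive_R\<close>)

end

section \<open>Feasibility and eigenvalues\<close>

text \<open>The negative part of \<open>x\<close> is dominated pointwise by the distance of
  \<open>x\<close> to any nonnegative function.\<close>

lemma closed_L2_nonneg: "closed {x. L2_nonneg x}"
  unfolding closed_sequential_limits mem_Collect_eq
proof (intro allI impI, elim conjE)
  fix u x assume u: "\<forall>n. L2_nonneg (u n)" and lim: "u \<longlonglongrightarrow> x"
  have [measurable]: "rep_L2 x \<in> borel_measurable borel"
    using square_integrable_rep_L2[of x] by (simp add: square_integrable_def)
  let ?I = "\<integral>\<^sup>+ z. ennreal ((min 0 (rep_L2 x z))\<^sup>2) \<partial>lborel"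
  have "?I \<le> ennreal ((norm (x - u n))\<^sup>2)" for n
    unfolding norm_diff_rep_L2
  proof (rule nn_integral_mono_AE)
    have "AE z in lborel. 0 \<le> rep_L2 (u n) z"
      using u by (simp add: L2_nonneg_def)
    then show "AE z in lborel. ennreal ((min 0 (rep_L2 x z))\<^sup>2) \<le> ennreal ((rep_L2 x z - rep_L2 (u n) z)\<^sup>2)"
    proof eventually_elim
      case (elim z)
      have "\<bar>min 0 (rep_L2 x z)\<bar> \<le> \<bar>rep_L2 x z - rep_L2 (u n) z\<bar>"
        using elim by (auto simp: min_def)
      then show ?case
        by (intro ennreal_leI) (simp only: abs_le_square_iff)
    qed
  qed
  moreover have "(\<lambda>n. ennreal ((norm (x - u n))\<^sup>2)) \<longlonglongrightarrow> ennreal ((norm (x - x))\<^sup>2)"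
    using lim by (intro tendsto_intros)
  ultimately have "?I \<le> ennreal ((norm (x - x))\<^sup>2)"
    by (intro LIMSEQ_le_const) auto
  then have "?I = 0" by simp
  then have "AE z in lborel. ennreal ((min 0 (rep_L2 x z))\<^sup>2) = 0"
    by (subst (asm) nn_integral_0_iff_AE) auto
  then show "L2_nonneg x"
    unfolding L2_nonneg_def by eventually_elim (auto simp: min_def split: if_splits)
qed

context robin_diffusion
begin

lemma R_nonneg:
  assumes l: "0 < l" and nonneg: "L2_nonneg (h + l *\<^sub>R R h)"
  shows "L2_nonneg (R h)"
proof -
  have R: "AE z in lborel. rep_L2 (R h) z = indicator {0..L} z * sol h z"
    unfolding R_def by (rule rep_emb[OF continuous_sol])
  have "AE z in lborel. z \<in> {0..L} \<longrightarrow> 0 \<le> rep_L2 h z + l * sol h z"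
    using nonneg[unfolded L2_nonneg_def] R rep_L2_add[of h "l *\<^sub>R R h"] rep_L2_scaleR[of l "R h"]
    by eventually_elim auto
  then have "0 \<le> indicator {0..L} z * sol h z" for z
    using sol_nonneg[OF l] by (simp add: indicator_def)
  then show ?thesis
    using R by (auto simp: L2_nonneg_def elim!: eventually_mono)
qed

lemma positive_T: "positive_semigroup (L2_on L) T"
  unfolding positive_semigroup_def
proof (intro allI ballI impI)
  fix t x assume "0 \<le> (t :: real)" "x \<in> L2_on L" "L2_nonneg x"
  have "T t x \<in> {x. L2_nonneg x}"
  proof (rule T_preserves_cone[OF closed_L2_nonneg])
    show "0 \<in> {x. L2_nonneg x}"
      using rep_L2_zero by (auto simp: L2_nonneg_def elim: eventually_mono)
    fix x y assume "x \<in> {x. L2_nonneg x}" "y \<in> {x. L2_nonneg x}"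
    then have "AE z in lborel. 0 \<le> rep_L2 x z" "AE z in lborel. 0 \<le> rep_L2 y z"
      by (simp_all add: L2_nonneg_def)
    then have "AE z in lborel. 0 \<le> rep_L2 (x + y) z"
      using rep_L2_add[of x y] by eventually_elim simp
    then show "x + y \<in> {x. L2_nonneg x}" by (simp add: L2_nonneg_def)
  next
    fix c :: real and x assume "0 \<le> c" "x \<in> {x. L2_nonneg x}"
    then have "AE z in lborel. 0 \<le> rep_L2 x z" by (simp add: L2_nonneg_def)
    then have "AE z in lborel. 0 \<le> rep_L2 (c *\<^sub>R x) z"
      using rep_L2_scaleR[of c x] by eventually_elim (simp add: \<open>0 \<le> c\<close>)
    then show "c *\<^sub>R x \<in> {x. L2_nonneg x}" by (simp add: L2_nonneg_def)
  qed (use \<open>0 \<le> t\<close> \<open>x \<in> L2_on L\<close> \<open>L2_nonneg x\<close> R_nonneg in auto)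
  then show "L2_nonneg (T t x)" by simp
qed

lemma feasible_K: "feasible D L (D * r\<^sup>2) (- K)"
  unfolding feasible_def
proof (intro exI conjI ballI)
  show "C0_semigroup (L2_on L) T" by (rule C0_semigroup_T)
  show "generator_graph (L2_on L) T = A_graph D L (- K)"
    by (simp add: generator_graph_T A_graph_eq)
  show "positive_semigroup (L2_on L) T" by (rule positive_T)
  fix \<beta> assume "\<beta> \<in> {- (D * r\<^sup>2)<..0}"
  then have "ereal (- (D * r\<^sup>2)) < ereal \<beta>" by simp
  then show "exponentially_stable (L2_on L) T \<beta>"
    unfolding exponentially_stable_def using growth_bound_T by (rule le_less_trans[rotated])
qed

end

section \<open>Eigenvalues as lower bounds for the growth rate\<close>

lemma growth_bound_lessD:
  assumes "growth_bound X T < ereal b"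
  obtains w M where "w < b" "\<And>t x. 0 \<le> t \<Longrightarrow> x \<in> X \<Longrightarrow> norm (T t x) \<le> M * exp (w * t) * norm x"
proof -
  obtain w M where "w < b" "\<forall>t\<ge>0. \<forall>x\<in>X. norm (T t x) \<le> M * exp (w * t) * norm x"
    using assms unfolding growth_bound_def Inf_less_iff by auto
  then show ?thesis by (intro that[of w M]) auto
qed

text \<open>
  The difference of \<open>s \<mapsto> e\<^bsup>- \<lambda> s\<^esup> T(s) x\<close> at the two ends of \<open>[0, t]\<close> is a sum of \<open>n\<close> increments
  over intervals of length \<open>t / n\<close>, each of which is \<open>o(1 / n)\<close> uniformly.
\<close>

lemma eigenvector_orbit:
  fixes T :: "real \<Rightarrow> 'a \<Rightarrow> 'a::real_normed_vector"
  assumes sg: "C0_semigroup X T" and X: "subspace X"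
    and bd: "\<And>t y. 0 \<le> t \<Longrightarrow> y \<in> X \<Longrightarrow> norm (T t y) \<le> M * norm y"
    and eig: "(x, c *\<^sub>R x) \<in> generator_graph X T" and t: "0 \<le> t"
  shows "T t x = exp (c * t) *\<^sub>R x"
proof (cases "t = 0")
  case False
  with t have t: "0 < t" by simp
  have x: "x \<in> X" and lim: "((\<lambda>h. (T h x - x) /\<^sub>R h) \<longlongrightarrow> c *\<^sub>R x) (at_right 0)"
    using eig by (auto simp: generator_graph_def)
  have op: "bounded_operator_on X (T s)" if "0 \<le> s" for s
    using sg that by (simp add: C0_semigroup_def)
  have T_in: "T s y \<in> X" if "0 \<le> s" "y \<in> X" for s y
    using op[OF that(1)] that(2) unfolding bounded_operator_on_def by blast
  have T_plus: "T s (y + z) = T s y + T s z" if "0 \<le> s" "y \<in> X" "z \<in> X" for s y z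
    using op[OF that(1)] that(2,3) unfolding bounded_operator_on_def by blast
  have T_scaleR: "T s (a *\<^sub>R y) = a *\<^sub>R T s y" if "0 \<le> s" "y \<in> X" for s y a
    using op[OF that(1)] that(2) unfolding bounded_operator_on_def by blast
  define v where "v s = exp (- c * s) *\<^sub>R T s x" for s
  define w where "w h = v h - x" for h
  \<comment> \<open>The semigroup law gives v (s + h) - v s = exp (- c s) T(s) (w h), so every
    increment reduces to the one at 0.\<close>
  have v_step: "norm (v (s + h) - v s) \<le> exp (\<bar>c\<bar> * t) * (M * norm (w h))"
    if s: "0 \<le> s" "s \<le> t" "0 \<le> h" for s h
  proof -
    have wX: "w h \<in> X"
      unfolding w_def v_def using s T_in x by (intro subspace_diff[OF X] subspace_scale[OF X]) auto
    have "T (s + h) x = T s (T h x)"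
      using sg s x by (auto simp: C0_semigroup_def)
    then have "v (s + h) = exp (- c * s) *\<^sub>R T s (v h)"
      using s x T_in by (simp add: v_def T_scaleR exp_add[symmetric] algebra_simps)
    also have "v h = x + w h" by (simp add: w_def)
    finally have "v (s + h) - v s = exp (- c * s) *\<^sub>R T s (w h)"
      using s x wX by (simp add: T_plus v_def scaleR_add_right)
    then have "norm (v (s + h) - v s) = exp (- c * s) * norm (T s (w h))"
      by simp
    also have "\<dots> \<le> exp (\<bar>c\<bar> * t) * (M * norm (w h))"
    proof (intro mult_mono bd s wX)
      have "- c * s \<le> \<bar>c\<bar> * s" using s by (intro mult_right_mono) auto
      also have "\<dots> \<le> \<bar>c\<bar> * t" using s by (intro mult_left_mono) auto
      finally show "exp (- c * s) \<le> exp (\<bar>c\<bar> * t)" by simp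
    qed auto
    finally show ?thesis .
  qed
  have bound: "norm (v t - v 0) \<le> exp (\<bar>c\<bar> * t) * M * t * norm (w (t / real n) /\<^sub>R (t / real n))"
    if n: "0 < n" for n
  proof -
    have "norm (v (real k * (t / real n)) - v 0) \<le> real k * (exp (\<bar>c\<bar> * t) * (M * norm (w (t / real n))))"
      if "k \<le> n" for k
      using that
    proof (induction k)
      case (Suc k)
      have "real k * t \<le> real n * t"
        using Suc.prems t by (intro mult_right_mono) auto
      then have k: "real k * (t / real n) \<le> t"
        using n by (simp add: field_simps)
      have "norm (v (real k * (t / real n) + t / real n) - v (real k * (t / real n)))
          \<le> exp (\<bar>c\<bar> * t) * (M * norm (w (t / real n)))"
        using t k by (intro v_step) auto
      moreover have "real k * (t / real n) + t / real n = real (Suc k) * (t / real n)"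
        by (simp add: algebra_simps add_divide_distrib)
      moreover have "norm (v (real k * (t / real n)) - v 0) \<le> real k * (exp (\<bar>c\<bar> * t) * (M * norm (w (t / real n))))"
        using Suc by simp
      ultimately show ?case
        using norm_triangle_ineq[of "v (real (Suc k) * (t / real n)) - v (real k * (t / real n))"
            "v (real k * (t / real n)) - v 0"]
        by (simp add: algebra_simps)
    qed simp
    from this[of n] have "norm (v t - v 0) \<le> real n * (exp (\<bar>c\<bar> * t) * (M * norm (w (t / real n))))"
      using n by simp
    also have "\<dots> = exp (\<bar>c\<bar> * t) * M * t * norm (w (t / real n) /\<^sub>R (t / real n))"
      using n t by (simp add: field_simps)
    finally show ?thesis .
  qed
  \<comment> \<open>Product rule for the right derivative of \<open>v\<close> at 0: the
    contributions c x and -c x cancel.\<close>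
  have "((\<lambda>h. exp (- c * h) *\<^sub>R ((T h x - x) /\<^sub>R h) + ((exp (- c * h) - 1) / h) *\<^sub>R x)
      \<longlongrightarrow> exp (- c * 0) *\<^sub>R (c *\<^sub>R x) + (- c) *\<^sub>R x) (at_right 0)"
  proof (rule tendsto_add[OF tendsto_scaleR[OF _ lim] tendsto_scaleR[OF _ tendsto_const]])
    show "((\<lambda>h. exp (- c * h)) \<longlongrightarrow> exp (- c * 0)) (at_right 0)"
      by (intro tendsto_intros)
    have "((\<lambda>h. exp (- c * h)) has_real_derivative - c) (at 0)"
      by (auto intro!: derivative_eq_intros)
    then show "((\<lambda>h. (exp (- c * h) - 1) / h) \<longlongrightarrow> - c) (at_right 0)"
      unfolding has_field_derivative_iff by (auto intro: tendsto_mono at_le)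
  qed
  moreover have "exp (- c * h) *\<^sub>R ((T h x - x) /\<^sub>R h) + ((exp (- c * h) - 1) / h) *\<^sub>R x = w h /\<^sub>R h" for h
    by (simp add: w_def v_def algebra_simps divide_inverse)
  ultimately have wlim: "((\<lambda>h. w h /\<^sub>R h) \<longlongrightarrow> 0) (at_right 0)"
    by simp
  have "filterlim (\<lambda>n. t / real n) (at_right 0) sequentially"
    unfolding filterlim_at
  proof
    show "\<forall>\<^sub>F n in sequentially. t / real n \<in> {0<..} \<and> t / real n \<noteq> 0"
      using eventually_gt_at_top[of 0] by eventually_elim (use t in simp)
  qed (rule lim_const_over_n)
  from filterlim_compose[OF wlim this]
  have "(\<lambda>n. exp (\<bar>c\<bar> * t) * M * t * norm (w (t / real n) /\<^sub>R (t / real n))) \<longlonglongrightarrow> exp (\<bar>c\<bar> * t) * M * t * norm (0 :: 'a)"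
    by (intro tendsto_intros)
  moreover have "\<exists>N. \<forall>n\<ge>N. norm (v t - v 0) \<le> exp (\<bar>c\<bar> * t) * M * t * norm (w (t / real n) /\<^sub>R (t / real n))"
    using bound by (intro exI[of _ 1]) auto
  ultimately have "norm (v t - v 0) \<le> exp (\<bar>c\<bar> * t) * M * t * norm (0 :: 'a)"
    by (rule LIMSEQ_le_const)
  then have "v t = v 0" by simp
  moreover have "T 0 x = x"
    using sg x by (simp add: C0_semigroup_def)
  ultimately have "exp (c * t) *\<^sub>R (exp (- c * t) *\<^sub>R T t x) = exp (c * t) *\<^sub>R x"
    by (simp add: v_def)
  then show ?thesis
    by (simp add: exp_minus)
qed (use sg eig in \<open>auto simp: C0_semigroup_def generator_graph_def\<close>)

text \<open>Along the eigenvector the semigroup acts as multiplication by exp (c t), so no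
  admissible growth rate lies below \<open>c\<close>. Letting \<beta> decrease to -\<alpha> gives
  the bound.\<close>

lemma feasible_eigenvalue_le:
  assumes feas: "feasible D L \<alpha> \<kappa>" and \<alpha>: "0 < \<alpha>"
    and eig: "(x, c *\<^sub>R x) \<in> A_graph D L \<kappa>" and x: "x \<noteq> 0"
  shows "c \<le> - \<alpha>"
proof (rule dense_ge)
  obtain T where sg: "C0_semigroup (L2_on L) T" and gen: "generator_graph (L2_on L) T = A_graph D L \<kappa>"
    and stable: "\<And>\<beta>. - \<alpha> < \<beta> \<Longrightarrow> \<beta> \<le> 0 \<Longrightarrow> growth_bound (L2_on L) T < ereal \<beta>"
    using feas by (auto simp: feasible_def exponentially_stable_def)
  have eig: "(x, c *\<^sub>R x) \<in> generator_graph (L2_on L) T"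
    using eig gen by simp
  then have xX: "x \<in> L2_on L" by (simp add: generator_graph_def)
  \<comment> \<open>The case \<beta> = 0 provides the uniform bound required by
    \<open>eigenvector_orbit\<close>.\<close>
  have "growth_bound (L2_on L) T < ereal 0"
    using \<alpha> by (intro stable) auto
  then obtain w0 M0 where w0: "w0 < 0"
    "\<And>t x. 0 \<le> t \<Longrightarrow> x \<in> L2_on L \<Longrightarrow> norm (T t x) \<le> M0 * exp (w0 * t) * norm x"
    by (rule growth_bound_lessD) blast
  have orbit: "T t x = exp (c * t) *\<^sub>R x" if "0 \<le> t" for t
  proof (rule eigenvector_orbit[OF sg subspace_L2_on _ eig that])
    fix s y assume s: "0 \<le> (s :: real)" and y: "y \<in> L2_on L"
    have "M0 * exp (w0 * s) \<le> \<bar>M0\<bar> * 1"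
      using w0(1) s by (intro mult_mono) (auto simp: mult_nonpos_nonneg)
    then have "M0 * exp (w0 * s) * norm y \<le> \<bar>M0\<bar> * norm y"
      using mult_right_mono[of "M0 * exp (w0 * s)" "\<bar>M0\<bar>" "norm y"] by simp
    with w0(2)[OF s y] show "norm (T s y) \<le> \<bar>M0\<bar> * norm y" by simp
  qed
  fix \<beta> assume \<beta>: "- \<alpha> < \<beta>"
  \<comment> \<open>Condition (ii) speaks of \<beta> \<le> 0 only, hence the minimum.\<close>
  have "growth_bound (L2_on L) T < ereal (min \<beta> 0)"
    using \<alpha> \<beta> by (intro stable) auto
  then obtain w M where w: "w < min \<beta> 0"
    "\<And>t x. 0 \<le> t \<Longrightarrow> x \<in> L2_on L \<Longrightarrow> norm (T t x) \<le> M * exp (w * t) * norm x"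
    by (rule growth_bound_lessD) blast
  have M: "exp ((c - w) * t) \<le> M" if "0 \<le> t" for t
  proof -
    have "exp (c * t) * norm x \<le> M * exp (w * t) * norm x"
      using w(2)[OF that xX] orbit[OF that] by simp
    then have "exp (c * t) \<le> M * exp (w * t)"
      using x by simp
    then show ?thesis
      by (simp add: exp_diff left_diff_distrib field_simps)
  qed
  have "c \<le> w"
  proof (rule ccontr)
    assume "\<not> c \<le> w"
    moreover have "0 \<le> M"
      using M[of 0] by simp
    \<comment> \<open>The time M / (c - w) turns the exponent into \<open>M\<close>, in conflict
      with exp M \<ge> 1 + M.\<close>
    ultimately have "exp M \<le> M"
      using M[of "M / (c - w)"] by simp
    with exp_ge_add_one_self[of M] show False by linarith
  qed
  with w(1) show "c \<le> \<beta>" by simp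
qed

section \<open>Explicit eigenfunctions and the bounds they impose\<close>

lemma eigenvector_nonneg:
  assumes L: "0 < L" and \<kappa>: "0 \<le> \<kappa>" and D: "0 < D"
  obtains x c where "0 \<le> c" "x \<noteq> 0" "(x, c *\<^sub>R x) \<in> A_graph D L \<kappa>"
proof -
  let ?F = "\<lambda>s. s * sinh (L * s) - \<kappa> * cosh (L * s)"
  \<comment> \<open>Chosen to make \<open>?F b\<close> nonnegative: 1 \<le> L b yields tanh (L b)
    \<ge> 1/2, and 2 \<kappa> \<le> b does the rest. At 0 the value is -\<kappa>; for \<kappa> = 0
    the root is 0 and the eigenfunction is constant.\<close>
  define b where "b = max (2 * \<kappa>) (1 / L)"
  have "1 / L \<le> b" by (simp add: b_def)
  then have "1 \<le> L * b"
    using L by (simp add: divide_le_eq mult.commute)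
  then have b: "0 < b" "1 \<le> L * b" "2 * \<kappa> \<le> b"
    using L by (auto simp: b_def less_max_iff_disj)
  have "2 * cosh (L * b) \<le> 4 * sinh (L * b)"
  proof -
    have "2 \<le> exp (L * b)"
      using exp_ge_add_one_self[of "L * b"] b by linarith
    then have "2 * 2 \<le> exp (L * b) * exp (L * b)"
      by (intro mult_mono) auto
    then have "3 / exp (L * b) \<le> exp (L * b)"
      by (simp add: pos_divide_le_eq)
    then have "3 * exp (- (L * b)) \<le> exp (L * b)"
      by (simp add: exp_minus divide_inverse)
    then show ?thesis by (simp add: cosh_field_def sinh_field_def)
  qed
  moreover have "0 \<le> sinh (L * b)" using L b by simp
  ultimately have "\<kappa> * cosh (L * b) \<le> \<kappa> * (2 * sinh (L * b))"
    using \<kappa> by (intro mult_left_mono) auto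
  also have "\<dots> = (2 * \<kappa>) * sinh (L * b)" by simp
  also have "\<dots> \<le> b * sinh (L * b)"
    using b \<open>0 \<le> sinh (L * b)\<close> by (intro mult_right_mono) auto
  finally have "\<exists>s\<ge>0. s \<le> b \<and> ?F s = 0"
    using \<kappa> b by (intro IVT') (auto intro!: continuous_intros)
  then obtain s where s: "?F s = 0" by blast
  define g where "g z = cosh (s * (L - z))" for z
  define g' where "g' z = - s * sinh (s * (L - z))" for z
  have "(g has_real_derivative g' z) (at z)" for z
    unfolding g_def g'_def by (auto intro!: derivative_eq_intros)
  moreover have "(g' has_real_derivative s\<^sup>2 * g z) (at z)" for z
    unfolding g_def g'_def by (auto intro!: derivative_eq_intros simp: power2_eq_square)
  moreover have "g' 0 + \<kappa> * g 0 = 0" "g' L = 0"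
    using s by (simp_all add: g_def g'_def mult.commute)
  ultimately have "(emb L g, (D * s\<^sup>2) *\<^sub>R emb L g) \<in> A_graph D L \<kappa>"
    using L by (intro A_graph_classical[where g' = g']) auto
  moreover have "emb L g \<noteq> 0"
    using L by (intro emb_nonzero[of L g L]) (auto simp: g_def intro!: continuous_intros)
  ultimately show ?thesis
    using D by (intro that[of "D * s\<^sup>2"]) auto
qed

lemma eigenvector_neg:
  assumes L: "0 < L" and \<kappa>: "\<kappa> < 0"
  obtains x s where "0 < s" "L * s < pi / 2" "\<kappa> = - s * tan (L * s)" "x \<noteq> 0"
    "(x, (- (D * s\<^sup>2)) *\<^sub>R x) \<in> A_graph D L \<kappa>"
proof -
  \<comment> \<open>The equation \<kappa> = -s tan (L s) multiplied by the cosine, which removes the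
    pole at pi / (2 L). The end values \<kappa> and pi / (2 L) have opposite signs, so the root is
    interior.\<close>
  let ?F = "\<lambda>s. s * sin (L * s) + \<kappa> * cos (L * s)"
  have "\<exists>s\<ge>0. s \<le> pi / (2 * L) \<and> ?F s = 0"
    using L \<kappa> by (intro IVT') (auto intro!: continuous_intros)
  then obtain s where s: "0 \<le> s" "s \<le> pi / (2 * L)" "?F s = 0" by blast
  have "s \<noteq> 0" using s(3) \<kappa> by auto
  moreover have "s \<noteq> pi / (2 * L)"
    using s(3) L by auto
  ultimately have s': "0 < s" "L * s < pi / 2"
    using s L by (auto simp: field_simps)
  then have "cos (L * s) > 0"
    using L by (intro cos_gt_zero) auto
  then have \<kappa>_eq: "\<kappa> = - s * tan (L * s)"
    using s(3) by (simp add: tan_def field_simps)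
  define g where "g z = cos (s * (L - z))" for z
  define g' where "g' z = s * sin (s * (L - z))" for z
  have "(g has_real_derivative g' z) (at z)" for z
    unfolding g_def g'_def by (auto intro!: derivative_eq_intros)
  moreover have "(g' has_real_derivative (- s\<^sup>2) * g z) (at z)" for z
    unfolding g_def g'_def by (auto intro!: derivative_eq_intros simp: power2_eq_square)
  moreover have "g' 0 + \<kappa> * g 0 = 0" "g' L = 0"
    using s by (simp_all add: g_def g'_def mult.commute)
  ultimately have "(emb L g, (D * (- s\<^sup>2)) *\<^sub>R emb L g) \<in> A_graph D L \<kappa>"
    using L by (intro A_graph_classical[where g' = g']) auto
  moreover have "emb L g \<noteq> 0"
    using L by (intro emb_nonzero[of L g L]) (auto simp: g_def intro!: continuous_intros)
  ultimately show ?thesis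
    using s' \<kappa>_eq by (intro that[of s]) auto
qed

text \<open>An eigenvalue \<ge> 0 contradicts decay, so \<kappa> = -s tan (L s) with L s < pi / 2.
  The eigenvalue -D s^2 may not exceed -D r^2, hence r \<le> s, and both claims follow by
  monotonicity.\<close>

lemma feasible_bounds:
  assumes D: "0 < D" and L: "0 < L" and r: "0 < r" and feas: "feasible D L (D * r\<^sup>2) \<kappa>"
  shows "L * r < pi / 2" "\<kappa> \<le> - r * tan (L * r)"
proof -
  have \<alpha>: "0 < D * r\<^sup>2" using D r by simp
  have "\<kappa> < 0"
  proof (rule ccontr)
    assume "\<not> \<kappa> < 0"
    then obtain x c where "0 \<le> c" "x \<noteq> 0" "(x, c *\<^sub>R x) \<in> A_graph D L \<kappa>"
      using eigenvector_nonneg[OF L _ D, of \<kappa>] by (metis not_less)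
    with feasible_eigenvalue_le[OF feas \<alpha>, of x c] \<alpha> show False by simp
  qed
  then obtain x s where s: "0 < s" "L * s < pi / 2" "\<kappa> = - s * tan (L * s)" "x \<noteq> 0"
    "(x, (- (D * s\<^sup>2)) *\<^sub>R x) \<in> A_graph D L \<kappa>"
    by (rule eigenvector_neg[OF L])
  have "- (D * s\<^sup>2) \<le> - (D * r\<^sup>2)"
    by (rule feasible_eigenvalue_le[OF feas \<alpha> s(5,4)])
  then have "r\<^sup>2 \<le> s\<^sup>2"
    using D by simp
  then have "r \<le> s"
    by (rule power2_le_imp_le) (use s(1) in simp)
  then have rs: "L * r \<le> L * s" using L by simp
  with s(2) show rL: "L * r < pi / 2" by simp
  have "tan (L * r) \<le> tan (L * s)"
    using rs s(2) L r by (intro tan_mono_le) (auto intro: less_le_trans[of _ 0])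
  moreover have "0 \<le> tan (L * r)"
    using rL L r by (intro less_imp_le tan_gt_zero) auto
  ultimately have "r * tan (L * r) \<le> s * tan (L * s)"
    using r \<open>r \<le> s\<close> by (intro mult_mono) auto
  with s(3) show "\<kappa> \<le> - r * tan (L * r)" by simp
qed

theorem theorem7:
  fixes D L \<alpha> :: real
  assumes "D > 0" and "L > 0" and "\<alpha> > 0"
  shows "((\<exists>\<kappa>. feasible D L \<alpha> \<kappa>) \<longleftrightarrow> \<alpha> < pi\<^sup>2 * D / (4 * L\<^sup>2)) \<and>
    ((\<exists>\<kappa>. feasible D L \<alpha> \<kappa>) \<longrightarrow>
      (\<forall>\<kappa>. is_arg_min (\<lambda>\<kappa>. \<kappa>\<^sup>2) (feasible D L \<alpha>) \<kappa> \<longleftrightarrow>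
            \<kappa> = - sqrt (\<alpha> / D) * tan (L * sqrt (\<alpha> / D))))"
proof -
  define r where "r = sqrt (\<alpha> / D)"
  have r: "0 < r" and \<alpha>: "\<alpha> = D * r\<^sup>2"
    using assms by (auto simp: r_def)
  have bounds: "L * r < pi / 2" "\<kappa> \<le> - r * tan (L * r)" if "feasible D L \<alpha> \<kappa>" for \<kappa>
    using feasible_bounds[OF assms(1,2) r, of \<kappa>] that \<alpha> by auto
  have opt: "feasible D L \<alpha> (- r * tan (L * r))" if "L * r < pi / 2"
  proof -
    have robin: "robin_diffusion D L r"
      using assms r that by unfold_locales
    show ?thesis
      using robin_diffusion.feasible_K[OF robin] by (simp add: robin_diffusion.K_def[OF robin] \<alpha>)
  qed
  have "\<alpha> < pi\<^sup>2 * D / (4 * L\<^sup>2) \<longleftrightarrow> (L * r)\<^sup>2 < (pi / 2)\<^sup>2"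
    using assms by (simp add: \<alpha> power_mult_distrib power_divide field_simps)
  also have "\<dots> \<longleftrightarrow> L * r < pi / 2"
    using assms r power_mono_iff[of "pi / 2" "L * r" 2] by (simp add: not_le[symmetric])
  finally have small: "\<alpha> < pi\<^sup>2 * D / (4 * L\<^sup>2) \<longleftrightarrow> L * r < pi / 2" .
  have "is_arg_min (\<lambda>\<kappa>. \<kappa>\<^sup>2) (feasible D L \<alpha>) \<kappa> \<longleftrightarrow> \<kappa> = - r * tan (L * r)" if rL: "L * r < pi / 2" for \<kappa>
  proof -
    \<comment> \<open>All feasible values lie to the left of this nonpositive number, where squaring
      reverses the order; its square is therefore minimal and attained nowhere else.\<close>
    have neg: "- r * tan (L * r) \<le> 0"
      using rL r assms by (simp add: less_imp_le tan_gt_zero)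
    have sq: "(- r * tan (L * r))\<^sup>2 \<le> \<kappa>'\<^sup>2" if "feasible D L \<alpha> \<kappa>'" for \<kappa>'
      using bounds(2)[OF that] neg by (simp add: abs_le_square_iff[symmetric])
    have eq: "\<kappa>' = - r * tan (L * r)" if "feasible D L \<alpha> \<kappa>'" "\<kappa>'\<^sup>2 \<le> (- r * tan (L * r))\<^sup>2" for \<kappa>'
      using bounds(2)[OF that(1)] neg that(2) by (simp add: abs_le_square_iff[symmetric])
    show ?thesis
      unfolding is_arg_min_def using opt[OF rL] sq eq by (metis not_less)
  qed
  then show ?thesis
    unfolding small r_def[symmetric] using bounds(1) opt by blast
qed

end
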